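(* Let $p\in(0,1]$. As $n\to\infty$, $$\left(\Big(\frac{G_{p,n}(\lfloor nt\rfloor)}{n},\frac{D_{p,n}(\lfloor nt\rfloor)}{n}\Big),\ t\ge 0\right)\ \longrightarrow\ \big((g_p(t),d_p(t)),\ t\ge 0\big)$$ in probability, for the topology of uniform convergence on compact subsets of $[0,\infty)$.
   Context: Discrete $p$-frozen model. Fix $p\in(0,1]$. For an integer $n\ge 2$ the random (multi)graph process $(F_{p,n}(m))_{m\in\mathbb Z_+}$ on vertex set $\{1,\dots,n\}$ is defined recursively. All its connected components are either trees (number of edges = number of vertices minus one) or unicycles (number of edges = number of vertices); vertices of unicycles are called frozen. $F_{p,n}(0)$ has $n$ isolated non-frozen vertices. At step $m\ge 1$, given $F_{p,n}(m-1)$, one of the $n(n-1)/2$ possible edges is selected uniformly at random, independently of the past (the same edge may be selected several times), and: (i) if it connects two vertices of trees of $F_{p,n}(m-1)$ (possibly the same tree), it is added; if two different trees are involved this produces a new tree (non-frozen), otherwise it produces a unicycle whose vertices become frozen (if the selected edge is already present in the tree, it is added as a parallel edge, creating a cycle of length two); (ii) if it connects two vertices of unicycles (possibly the same), it is discarded; (iii) if it connects a tree and a unicycle, it is added with probability $p$ (the tree is glued to the unicycle and all its vertices become frozen) and discarded with probability $1-p$. Notation: $G_{p,n}(m)$ is the number of frozen vertices of $F_{p,n}(m)$ and $D_{p,n}(m)$ is the number of edges discarded up to step $m$. Limit functions: let $f_p:[0,1)\to[1/2,\infty)$, $f_p(s)=\frac12\sum_{j=0}^\infty \frac{s^j}{1+pj}$,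 an increasing bijection. The function $g_p:[0,\infty)\to[0,1)$ is $0$ on $[0,1/2]$ and is the inverse of $f_p$ on $[1/2,\infty)$. Moreover $d_p(t)=t-g_p(t)-t(1-g_p(t))^2$ for $t\ge0$. *)

theory Defs
  imports "HOL-Probability.Probability"
begin

section \<open>Multigraphs\<close>

text \<open>An edge joining the vertices \<open>u < v\<close> is encoded as the pair \<open>(u, v)\<close>.  A multigraph is
  given by its multiset of edges, so parallel edges are allowed; its vertex set is \<open>{1..n}\<close>,
  with \<open>n\<close> passed separately where it matters.\<close>

type_synonym edge = "nat \<times> nat"
type_synonym mgraph = "edge multiset"

definition possible_edges :: "nat \<Rightarrow> edge set" where
  "possible_edges n = {(u, v). 1 \<le> u \<and> u < v \<and> v \<le> n}"

definition adjacent :: "mgraph \<Rightarrow> nat \<Rightarrow> nat \<Rightarrow> bool" where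
  "adjacent E u v \<longleftrightarrow> (u, v) \<in># E \<or> (v, u) \<in># E"

definition component :: "mgraph \<Rightarrow> nat \<Rightarrow> nat set" where
  "component E v = {w. (adjacent E)\<^sup>*\<^sup>* v w}"

definition component_edges :: "mgraph \<Rightarrow> nat \<Rightarrow> mgraph" where
  "component_edges E v = {#e \<in># E. fst e \<in> component E v \<and> snd e \<in> component E v#}"

definition in_tree :: "mgraph \<Rightarrow> nat \<Rightarrow> bool" where
  "in_tree E v \<longleftrightarrow> size (component_edges E v) + 1 = card (component E v)"

definition in_unicycle :: "mgraph \<Rightarrow> nat \<Rightarrow> bool" where
  "in_unicycle E v \<longleftrightarrow> size (component_edges E v) = card (component E v)"

definition num_frozen :: "nat \<Rightarrow> mgraph \<Rightarrow> nat" where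
  "num_frozen n E = card {v \<in> {1..n}. in_unicycle E v}"


section \<open>The discrete \<open>p\<close>-frozen model\<close>

text \<open>The law of one step from a state \<open>(E, d)\<close>: multigraph \<open>E\<close> and number \<open>d\<close> of edges discarded
  so far.  Since all components of a reachable multigraph are trees or unicycles, the last
  alternative is the case of an edge between a tree and a unicycle.\<close>

definition frozen_step :: "real \<Rightarrow> nat \<Rightarrow> mgraph \<times> nat \<Rightarrow> (mgraph \<times> nat) pmf" where
  "frozen_step p n = (\<lambda>(E, d).
     bind_pmf (pmf_of_set (possible_edges n)) (\<lambda>(u, v).
       if in_tree E u \<and> in_tree E v then return_pmf (add_mset (u, v) E, d)
       else if in_unicycle E u \<and> in_unicycle E v then return_pmf (E, Suc d)
       else map_pmf (\<lambda>keep. if keep then (add_mset (u, v) E, d) else (E, Suc d))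
              (bernoulli_pmf p)))"

text \<open>\<open>F m\<close> and \<open>D m\<close> are random variables on an arbitrary probability space \<open>M\<close>, describing
  the multigraph after \<open>m\<close> steps and the number of edges discarded up to step \<open>m\<close>.  The last
  clause says that, given any past trajectory, the next state is distributed according to
  \<open>frozen_step\<close>; it is multiplied out so that no conditioning on null events occurs.\<close>

definition frozen_process ::
    "real \<Rightarrow> nat \<Rightarrow> 'a measure \<Rightarrow> (nat \<Rightarrow> 'a \<Rightarrow> mgraph) \<Rightarrow> (nat \<Rightarrow> 'a \<Rightarrow> nat) \<Rightarrow> bool" where
  "frozen_process p n M F D \<longleftrightarrow>
     prob_space M \<and>
     (\<forall>m. F m \<in> measurable M (count_space UNIV)) \<and>
     (\<forall>m. D m \<in> measurable M (count_space UNIV)) \<and>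
     (AE \<omega> in M. F 0 \<omega> = {#} \<and> D 0 \<omega> = 0) \<and>
     (\<forall>m s. measure M {\<omega> \<in> space M. \<forall>i\<le>Suc m. (F i \<omega>, D i \<omega>) = s i} =
              measure M {\<omega> \<in> space M. \<forall>i\<le>m. (F i \<omega>, D i \<omega>) = s i} *
              pmf (frozen_step p n (s m)) (s (Suc m)))"


section \<open>The limit functions\<close>

definition f_lim :: "real \<Rightarrow> real \<Rightarrow> real" where
  "f_lim p s = 1/2 * (\<Sum>j. s ^ j / (1 + p * real j))"

definition g_lim :: "real \<Rightarrow> real \<Rightarrow> real" where
  "g_lim p t = (if t \<le> 1/2 then 0 else the_inv_into {0..<1} (f_lim p) t)"

definition d_lim :: "real \<Rightarrow> real \<Rightarrow> real" where
  "d_lim p t = t - g_lim p t - t * (1 - g_lim p t)\<^sup>2"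


section \<open>Convergence in probability, uniformly on compact sets\<close>

text \<open>The limit \<open>y\<close> is deterministic.  For nonempty \<open>K\<close>, the event below is that the supremum over
  \<open>t \<in> K\<close> of the distance exceeds \<open>\<epsilon>\<close>; the existential form avoids the junk value of a supremum
  of reals over an empty or unbounded set.\<close>

definition converges_ucp ::
    "(nat \<Rightarrow> 'a measure) \<Rightarrow> (nat \<Rightarrow> real \<Rightarrow> 'a \<Rightarrow> 'b::metric_space) \<Rightarrow> (real \<Rightarrow> 'b) \<Rightarrow> bool" where
  "converges_ucp M Y y \<longleftrightarrow>
     (\<forall>K \<epsilon>. compact K \<and> K \<subseteq> {0..} \<and> \<epsilon> > 0 \<longrightarrow>
        (\<lambda>n. measure (M n) {\<omega> \<in> space (M n). \<exists>t\<in>K. dist (Y n t \<omega>) (y t) > \<epsilon>}) \<longlonglongrightarrow> 0)"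


section \<open>Existence of the process\<close>

definition update :: "(mgraph \<times> nat) \<Rightarrow> edge \<times> bool \<Rightarrow> mgraph \<times> nat" where
  "update x c = (case x of (E, d) \<Rightarrow> case c of ((u, v), keep) \<Rightarrow>
       if in_tree E u \<and> in_tree E v then (add_mset (u, v) E, d)
       else if in_unicycle E u \<and> in_unicycle E v then (E, Suc d)
       else if keep then (add_mset (u, v) E, d) else (E, Suc d))"

definition choice_pmf :: "real \<Rightarrow> nat \<Rightarrow> (edge \<times> bool) pmf" where
  "choice_pmf p n = pair_pmf (pmf_of_set (possible_edges n)) (bernoulli_pmf p)"

lemma frozen_step_eq: "frozen_step p n x = map_pmf (update x) (choice_pmf p n)"
proof -
  have step: "(case e of (u, v) \<Rightarrow>
       if in_tree E u \<and> in_tree E v then return_pmf (add_mset (u, v) E, d)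
       else if in_unicycle E u \<and> in_unicycle E v then return_pmf (E, Suc d)
       else map_pmf (\<lambda>keep. if keep then (add_mset (u, v) E, d) else (E, Suc d))
              (bernoulli_pmf p)) = map_pmf (\<lambda>b. update (E, d) (e, b)) (bernoulli_pmf p)" for e E d
  proof (cases e)
    case (Pair u v)
    consider (tree) "in_tree E u \<and> in_tree E v"
      | (uni) "\<not> (in_tree E u \<and> in_tree E v)" "in_unicycle E u \<and> in_unicycle E v"
      | (mixed) "\<not> (in_tree E u \<and> in_tree E v)" "\<not> (in_unicycle E u \<and> in_unicycle E v)"
      by blast
    then show ?thesis
    proof cases
      case mixed
      then have "update (E, d) ((u, v), b) = (if b then (add_mset (u, v) E, d) else (E, Suc d))" for b
        by (simp only: update_def prod.case if_False)
      with mixed show ?thesis by (simp only: Pair prod.case if_False)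
    next
      case uni
      then have "update (E, d) ((u, v), b) = (E, Suc d)" for b
        by (simp only: update_def prod.case if_False if_True simp_thms)
      with uni show ?thesis by (simp only: Pair prod.case if_False if_True simp_thms map_pmf_const)
    qed (simp add: Pair update_def)
  qed
  obtain E d where x: "x = (E, d)" by (cases x)
  have "frozen_step p n x = bind_pmf (pmf_of_set (possible_edges n))
      (\<lambda>e. map_pmf (\<lambda>b. update (E, d) (e, b)) (bernoulli_pmf p))"
    unfolding frozen_step_def x prod.case by (intro bind_pmf_cong refl step)
  also have "\<dots> = map_pmf (update x) (choice_pmf p n)"
    by (simp add: x choice_pmf_def pair_pmf_def map_pmf_def bind_assoc_pmf bind_return_pmf)
  finally show ?thesis .
qed

definition traj :: "mgraph \<times> nat \<Rightarrow> nat \<Rightarrow> (edge \<times> bool) stream \<Rightarrow> mgraph \<times> nat" where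
  "traj x m \<omega> = foldl update x (stake m \<omega>)"

lemma measurable_traj [measurable]:
  "traj x m \<in> measurable (stream_space (measure_pmf Q)) (count_space UNIV)"
proof -
  have "stake m \<in> measurable (stream_space (count_space UNIV :: (edge \<times> bool) measure)) (count_space UNIV)"
    by measurable
  then have "stake m \<in> measurable (stream_space (measure_pmf Q)) (count_space UNIV)"
    by (simp add: measurable_def sets_stream_space_cong[of "measure_pmf Q" "count_space UNIV"] space_stream_space)
  then show ?thesis
    unfolding traj_def by (rule measurable_compose) simp
qed

lemma emeasure_traj:
  "emeasure (stream_space (measure_pmf (choice_pmf p n)))
     {\<omega> \<in> space (stream_space (measure_pmf (choice_pmf p n))). \<forall>i\<le>m. traj x i \<omega> = s i} =
   (if x = s 0 then ennreal (\<Prod>i<m. pmf (frozen_step p n (s i)) (s (Suc i))) else 0)"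
proof (induction m arbitrary: x s)
  case 0
  let ?S = "stream_space (measure_pmf (choice_pmf p n))"
  interpret prob_space ?S
    by (rule prob_space.prob_space_stream_space) unfold_locales
  show ?case using emeasure_space_1 by (simp add: traj_def)
next
  case (Suc m)
  let ?Q = "measure_pmf (choice_pmf p n)"
  let ?S = "stream_space ?Q"
  let ?c = "ennreal (\<Prod>i<m. pmf (frozen_step p n (s (Suc i))) (s (Suc (Suc i))))"
  have sp: "space ?S = UNIV" by (simp add: space_stream_space)
  have meas: "{\<omega> \<in> space ?S. \<forall>i\<le>Suc m. traj x i \<omega> = s i} \<in> sets ?S"
    by measurable
  have split: "(\<forall>i\<le>Suc m. traj x i (t ## \<omega>) = s i) \<longleftrightarrow>
      x = s 0 \<and> (\<forall>i\<le>m. traj (update x t) i \<omega> = s (Suc i))" for t \<omega>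
  proof -
    have "(\<forall>i\<le>Suc m. traj x i (t ## \<omega>) = s i) \<longleftrightarrow>
        traj x 0 (t ## \<omega>) = s 0 \<and> (\<forall>i\<le>m. traj x (Suc i) (t ## \<omega>) = s (Suc i))"
      by (metis Suc_le_mono le0 not0_implies_Suc)
    then show ?thesis by (simp add: traj_def)
  qed
  have "emeasure ?S {\<omega> \<in> space ?S. \<forall>i\<le>Suc m. traj x i \<omega> = s i} =
      (\<integral>\<^sup>+t. emeasure ?S {\<omega> \<in> space ?S. t ## \<omega> \<in> {\<omega> \<in> space ?S. \<forall>i\<le>Suc m. traj x i \<omega> = s i}} \<partial>?Q)"
    by (rule prob_space.emeasure_stream_space[OF _ meas]) unfold_locales
  also have "\<dots> = (\<integral>\<^sup>+t. (if x = s 0 then ?c else 0) * indicator {t. update x t = s 1} t \<partial>?Q)"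
  proof (rule nn_integral_cong)
    fix t
    show "emeasure ?S {\<omega> \<in> space ?S. t ## \<omega> \<in> {\<omega> \<in> space ?S. \<forall>i\<le>Suc m. traj x i \<omega> = s i}} =
       (if x = s 0 then ?c else 0) * indicator {t. update x t = s 1} t"
      using Suc.IH[of "update x t" "\<lambda>i. s (Suc i)"]
      by (auto simp: split sp indicator_def)
  qed
  also have "\<dots> = (if x = s 0 then ?c else 0) * emeasure ?Q {t. update x t = s 1}"
    by (simp add: nn_integral_cmult_indicator)
  also have "emeasure ?Q {t. update x t = s 1} = ennreal (pmf (frozen_step p n x) (s 1))"
    by (simp add: frozen_step_eq pmf_map measure_pmf.emeasure_eq_measure vimage_def)
  finally show ?case
    by (auto simp: prod.lessThan_Suc_shift ennreal_mult'[symmetric] prod_nonneg mult.commute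
        simp del: prod.lessThan_Suc)
qed

text \<open>The notion is not vacuous: the process is realised on the space of i.i.d. sequences of
  uniformly chosen edges and Bernoulli coins.\<close>

lemma frozen_process_exists:
  "frozen_process p n (stream_space (measure_pmf (choice_pmf p n)))
     (\<lambda>m \<omega>. fst (traj ({#}, 0) m \<omega>)) (\<lambda>m \<omega>. snd (traj ({#}, 0) m \<omega>))"
proof -
  let ?S = "stream_space (measure_pmf (choice_pmf p n))"
  interpret S: prob_space ?S
    by (rule prob_space.prob_space_stream_space) unfold_locales
  have "measure ?S {\<omega> \<in> space ?S. \<forall>i\<le>m. traj x i \<omega> = s i} =
      (if x = s 0 then (\<Prod>i<m. pmf (frozen_step p n (s i)) (s (Suc i))) else 0)" for m x s
    unfolding measure_def emeasure_traj by (simp add: prod_nonneg)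
  moreover have "(\<lambda>\<omega>. fst (traj x m \<omega>)) \<in> measurable ?S (count_space UNIV)"
    "(\<lambda>\<omega>. snd (traj x m \<omega>)) \<in> measurable ?S (count_space UNIV)" for x m
    by (rule measurable_compose[OF measurable_traj], simp)+
  ultimately show ?thesis
    unfolding frozen_process_def prod.collapse
    by (simp add: S.prob_space_axioms traj_def[of _ 0])
qed

end

theory Submission
  imports Defs
begin

text \<open>
  Let \<open>h\<close> be the fraction of vertices in trees and \<open>X t z\<close> the sum of \<open>z ^ k\<close> over the vertices lying in a
  tree of size \<open>k\<close>, divided by \<open>n\<close>. In the limit \<open>X\<close> solves a Burgers-type equation driven by \<open>h\<close>. Along the
  characteristic \<open>z = a * exp (A t - 2 * t * a)\<close>, where \<open>A t = 2 * \<integral>\<^sub>0\<^sup>t (1 - (1 - p) * (1 - h))\<close>, it keeps the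
  value \<open>a\<close>; in the discrete model this is a stopped second-moment estimate, valid as long as \<open>z\<close> stays
  away from \<open>1\<close>. Letting \<open>z\<close> approach \<open>1\<close> gives \<open>h \<ge> a\<close>, and \<open>h \<le> a\<close> up to the mass \<open>y\<close> of the large trees.

  No giant tree can persist: the number of trees of size at least \<open>K\<close>, plus \<open>1/K\<close> times the number of
  vertices in smaller trees, never increases and drops by one whenever an edge inside the large trees is
  selected, so the time integral of \<open>y\<^sup>2\<close> is at most of order \<open>1/K\<close>.

  Hence \<open>ln h - 2 * t * h = - A t\<close> approximately, and \<open>h = 1 - g_lim p\<close> is the exact solution. Uniqueness is a
  sign argument: the left-hand side increases in \<open>h\<close>, while \<open>A\<close> increases with the integral of \<open>h\<close>, so a
  deviation of that integral is pushed back to \<open>0\<close>. Monotonicity of \<open>h\<close> turns integrated closeness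
  into uniform closeness, and the number of discarded edges follows its compensator, an integral of \<open>h\<close>.
\<close>

section \<open>The limit functions\<close>

text \<open>Origin of the characteristic: an edge joining trees of sizes i and j changes the sum of
  \<open>z ^ k\<close> by (i + j) * z^(i + j) - i * z^i - j * z^j, and an edge to a frozen vertex
  removes i * z^i with probability p. With z = exp l and q = h + p * (1 - h), averaging gives dX/dt
  = 2 * (dX/dl) * (X - q). So X is constant where l moves at speed 2 * (q - X), and X = z at time 0
  makes the constant equal to the starting point a.

  The obstacle is z = 1: the stochastic estimate needs k^2 * z^k bounded, which fails exactly where
  h is read off. Each characteristic is therefore followed only while ln z <= - \<delta>, and
  replacing z by 1 costs K * (- ln z) for trees smaller than K and y for the others. The order of
  choices makes this consistent: \<kappa>, the tolerated time integral of y, depends only on the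
  time horizon and the accuracy; K follows from \<kappa> and the error probability; \<delta> is then
  taken small against 1 / K; n comes last. Finitely many values a on a grid suffice, so a union
  bound applies.\<close>

locale limit_param =
  fixes p :: real
  assumes p: "0 < p" "p \<le> 1"
begin

lemma denom_ge_1: "1 \<le> 1 + p * real j"
  using p by simp

lemma f_lim_summable:
  assumes "\<bar>s\<bar> < 1"
  shows "summable (\<lambda>j. s ^ j / (1 + p * real j))"
proof (rule summable_comparison_test)
  show "\<exists>N. \<forall>j\<ge>N. norm (s ^ j / (1 + p * real j)) \<le> \<bar>s\<bar> ^ j"
  proof (intro exI allI impI)
    fix j :: nat
    have "\<bar>s\<bar> ^ j / (1 + p * real j) \<le> \<bar>s\<bar> ^ j / 1"
      using denom_ge_1[of j] by (intro divide_left_mono) auto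
    then show "norm (s ^ j / (1 + p * real j)) \<le> \<bar>s\<bar> ^ j"
      using denom_ge_1[of j] by (simp add: power_abs)
  qed
  show "summable (\<lambda>j. \<bar>s\<bar> ^ j)" using assms by (intro summable_geometric) simp
qed

definition f' :: "real \<Rightarrow> real" where
  "f' s = 1/2 * (\<Sum>j. diffs (\<lambda>j. 1 / (1 + p * real j)) j * s ^ j)"

lemma f_lim_deriv:
  assumes "\<bar>s\<bar> < 1"
  shows "(f_lim p has_real_derivative f' s) (at s)"
proof -
  define r where "r = (1 + \<bar>s\<bar>) / 2"
  have r: "\<bar>s\<bar> < r" "r < 1" "0 \<le> r" using assms by (auto simp: r_def)
  have "((\<lambda>s. \<Sum>j. 1 / (1 + p * real j) * s ^ j) has_real_derivative
      (\<Sum>j. diffs (\<lambda>j. 1 / (1 + p * real j)) j * s ^ j)) (at s)"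
    using f_lim_summable[of r] r by (intro termdiffs_strong[where K = r]) simp_all
  from DERIV_cmult[OF this, of "1/2"] show ?thesis
    by (simp add: f_lim_def[abs_def] f'_def)
qed

text \<open>Multiplying the coefficient 1 / (1 + p * j) by 1 + p * j leaves the geometric series,
  and s * d/ds supplies the factor j. At s = g_lim p t this first-order equation becomes
  \<open>g_lim_ode\<close>.\<close>

lemma f_lim_identity:
  assumes "\<bar>s\<bar> < 1"
  shows "f_lim p s + p * s * f' s = 1 / (2 * (1 - s))"
proof -
  let ?c = "\<lambda>j. 1 / (1 + p * real j)"
  define r where "r = (1 + \<bar>s\<bar>) / 2"
  have r: "\<bar>s\<bar> < r" "r < 1" "0 \<le> r" using assms by (auto simp: r_def)
  have "summable (\<lambda>j. diffs ?c j * s ^ j)"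
    using termdiff_converges[of s 1 ?c] f_lim_summable assms by simp
  then have 1: "(\<lambda>j. real j * ?c j * s ^ (j - Suc 0)) sums (\<Sum>j. diffs ?c j * s ^ j)"
    by (rule diffs_equiv)
  have 2: "(\<lambda>j. s ^ j / (1 + p * real j)) sums (\<Sum>j. s ^ j / (1 + p * real j))"
    using f_lim_summable[OF assms] by (simp add: summable_sums)
  have eq: "s ^ j / (1 + p * real j) + p * s * (real j * ?c j * s ^ (j - Suc 0)) = s ^ j" for j
  proof -
    have "s * (real j * s ^ (j - Suc 0)) = real j * s ^ j" by (cases j) auto
    then have "p * s * (real j * ?c j * s ^ (j - Suc 0)) = p * real j * s ^ j / (1 + p * real j)"
      by (simp add: field_simps)
    then have "s ^ j / (1 + p * real j) + p * s * (real j * ?c j * s ^ (j - Suc 0)) =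
        (1 + p * real j) * s ^ j / (1 + p * real j)"
      by (simp only: add_divide_distrib[symmetric] distrib_right mult_1)
    then show ?thesis using denom_ge_1[of j] by simp
  qed
  have "(\<lambda>j. s ^ j) sums ((\<Sum>j. s ^ j / (1 + p * real j)) + p * s * (\<Sum>j. diffs ?c j * s ^ j))"
    using sums_add[OF 2 sums_mult[OF 1, of "p * s"]] by (simp only: eq)
  moreover have "(\<lambda>j. s ^ j) sums (1 / (1 - s))" using assms by (intro geometric_sums) simp
  ultimately have "(\<Sum>j. s ^ j / (1 + p * real j)) + p * s * (\<Sum>j. diffs ?c j * s ^ j) = 1 / (1 - s)"
    by (rule sums_unique2)
  then show ?thesis by (simp add: f_lim_def f'_def field_simps)
qed

lemma f_lim_0 [simp]: "f_lim p 0 = 1/2"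
  using f_lim_identity[of 0] by simp

lemma f_lim_le_geometric:
  assumes "0 \<le> s" "s < 1"
  shows "2 * f_lim p s * (1 - s) \<le> 1"
proof -
  have "(\<Sum>j. s ^ j / (1 + p * real j)) \<le> (\<Sum>j. s ^ j)"
  proof (rule suminf_le)
    show "s ^ j / (1 + p * real j) \<le> s ^ j" for j
      using divide_left_mono[of 1 "1 + p * real j" "s ^ j"] denom_ge_1[of j] assms by simp
  qed (use f_lim_summable[of s] summable_geometric[of s] assms in simp_all)
  also have "\<dots> = 1 / (1 - s)" using assms by (intro suminf_geometric) simp
  finally show ?thesis using assms by (simp add: f_lim_def field_simps)
qed

lemma f'_pos:
  assumes "0 \<le> s" "s < 1"
  shows "f' s > 0"
proof -
  have "summable (\<lambda>j. diffs (\<lambda>j. 1 / (1 + p * real j)) j * s ^ j)"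
    using termdiff_converges[of s 1 "\<lambda>j. 1 / (1 + p * real j)"] f_lim_summable assms by simp
  then have "(\<Sum>j. diffs (\<lambda>j. 1 / (1 + p * real j)) j * s ^ j) > 0"
  proof (rule suminf_pos2[where i = 0])
    fix j show "0 \<le> diffs (\<lambda>j. 1 / (1 + p * real j)) j * s ^ j"
      using denom_ge_1[of "Suc j"] assms by (simp add: diffs_def)
  qed (use p in \<open>simp add: diffs_def\<close>)
  then show ?thesis by (simp add: f'_def)
qed

lemma f_lim_strict_mono:
  assumes "0 \<le> s" "s < t" "t < 1"
  shows "f_lim p s < f_lim p t"
proof (rule DERIV_pos_imp_increasing[OF assms(2)])
  fix x assume "s \<le> x" "x \<le> t"
  then show "\<exists>y. (f_lim p has_real_derivative y) (at x) \<and> 0 < y"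
    using assms f_lim_deriv[of x] f'_pos[of x] by auto
qed

lemma f_lim_inj: "inj_on (f_lim p) {0..<1}"
proof (rule linorder_inj_onI)
  fix x y :: real assume "x < y" "x \<in> {0..<1}" "y \<in> {0..<1}"
  then show "f_lim p x \<noteq> f_lim p y" using f_lim_strict_mono[of x y] by auto
qed auto

lemma f_lim_cont: "continuous_on {0..<1} (f_lim p)"
proof (intro continuous_at_imp_continuous_on ballI)
  fix x :: real assume "x \<in> {0..<1}"
  then show "isCont (f_lim p) x" using DERIV_isCont[OF f_lim_deriv[of x]] by simp
qed

text \<open>Since p <= 1, the series at s = 1 dominates the harmonic series. One finite partial sum
  at s = 1 already exceeds the bound, and by continuity it still does for some s < 1.\<close>

lemma f_lim_unbounded: "\<exists>s. 0 \<le> s \<and> s < 1 \<and> B < f_lim p s"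
proof -
  have "\<not> summable (\<lambda>j. 1 / (1 + p * real j))"
  proof
    assume s: "summable (\<lambda>j. 1 / (1 + p * real j))"
    have "summable (\<lambda>j. inverse (real (Suc j)))"
    proof (rule summable_comparison_test[OF _ s], intro exI allI impI)
      fix j :: nat
      have "1 + p * real j \<le> real (Suc j)" using p mult_right_mono[of p 1 "real j"] by simp
      then show "norm (inverse (real (Suc j))) \<le> 1 / (1 + p * real j)"
        using denom_ge_1[of j] by (simp add: inverse_eq_divide frac_le)
    qed
    then show False
      using not_summable_harmonic[where ?'a = real] by (subst (asm) summable_Suc_iff) blast
  qed
  then have "\<not> (\<forall>n. (\<Sum>j\<le>n. 1 / (1 + p * real j)) \<le> 2 * B)"
    using bounded_imp_summable[of "\<lambda>j. 1 / (1 + p * real j)" "2 * B"] p by auto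
  then obtain M where "\<not> (\<Sum>j\<le>M. 1 / (1 + p * real j)) \<le> 2 * B" by blast
  then obtain N where N: "(\<Sum>j<N. 1 / (1 + p * real j)) > 2 * B"
    by (metis lessThan_Suc_atMost not_le)
  have "((\<lambda>s. \<Sum>j<N. s ^ j / (1 + p * real j)) \<longlongrightarrow> (\<Sum>j<N. 1 ^ j / (1 + p * real j))) (at_left 1)"
  proof (intro tendsto_sum tendsto_divide tendsto_power tendsto_ident_at tendsto_const)
    show "1 + p * real j \<noteq> 0" for j using denom_ge_1[of j] by linarith
  qed
  then have "\<forall>\<^sub>F s in at_left 1. (\<Sum>j<N. s ^ j / (1 + p * real j)) > 2 * B"
    using N by (intro order_tendstoD(1)) simp_all
  moreover have "\<forall>\<^sub>F s in at_left (1::real). s \<in> {0<..<1}"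
    by (rule eventually_at_left_real) simp
  ultimately have ev: "\<forall>\<^sub>F s in at_left (1::real). s \<in> {0<..<1} \<and> (\<Sum>j<N. s ^ j / (1 + p * real j)) > 2 * B"
    by (simp add: eventually_conj_iff)
  obtain s where s: "0 < s" "s < 1" "(\<Sum>j<N. s ^ j / (1 + p * real j)) > 2 * B"
    using eventually_happens'[OF trivial_limit_at_left_real ev] by auto
  have "(\<Sum>j<N. s ^ j / (1 + p * real j)) \<le> (\<Sum>j. s ^ j / (1 + p * real j))"
  proof (rule sum_le_suminf[OF f_lim_summable])
    show "0 \<le> s ^ j / (1 + p * real j)" for j using s denom_ge_1[of j] by simp
  qed (use s in simp_all)
  then show ?thesis using s by (intro exI[of _ s]) (simp add: f_lim_def)
qed

lemma f_lim_surj: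
  assumes "t \<ge> 1/2"
  shows "\<exists>s. 0 \<le> s \<and> s < 1 \<and> f_lim p s = t"
proof -
  obtain u where u: "0 \<le> u" "u < 1" "t < f_lim p u" using f_lim_unbounded by blast
  have "\<exists>s\<ge>0. s \<le> u \<and> f_lim p s = t"
    using assms u by (intro IVT') (auto intro: continuous_on_subset[OF f_lim_cont])
  then show ?thesis using u by force
qed

section \<open>The limiting frozen fraction as an inverse function, and its differential
  equation\<close>

lemma g_lim_props:
  assumes "t \<ge> 1/2"
  shows "0 \<le> g_lim p t" "g_lim p t < 1" "f_lim p (g_lim p t) = t"
proof -
  obtain s where s: "0 \<le> s" "s < 1" "f_lim p s = t" using f_lim_surj[OF assms] by blast
  have "g_lim p t = s"
  proof (cases "t = 1/2")
    case True
    then have "s = 0" using s f_lim_strict_mono[of 0 s] by (cases "s = 0") auto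
    then show ?thesis using True by (simp add: g_lim_def)
  next
    case False
    then show ?thesis using assms s the_inv_into_f_f[OF f_lim_inj, of s] by (simp add: g_lim_def)
  qed
  then show "0 \<le> g_lim p t" "g_lim p t < 1" "f_lim p (g_lim p t) = t" using s by simp_all
qed

lemma g_lim_eq_0: "t \<le> 1/2 \<Longrightarrow> g_lim p t = 0"
  by (simp add: g_lim_def)

lemma g_lim_range: "0 \<le> g_lim p t" "g_lim p t < 1"
  using g_lim_props[of t] g_lim_eq_0[of t] by (cases "t \<ge> 1/2"; simp)+

lemma g_lim_f_lim: "0 \<le> s \<Longrightarrow> s < 1 \<Longrightarrow> g_lim p (f_lim p s) = s"
proof -
  assume s: "0 \<le> s" "s < 1"
  then have "f_lim p s \<ge> 1/2" using f_lim_strict_mono[of 0 s] by (cases "s = 0") auto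
  from g_lim_props[OF this] show "g_lim p (f_lim p s) = s"
    using s by (auto intro: inj_onD[OF f_lim_inj])
qed

lemma g_lim_mono:
  assumes "s \<le> t"
  shows "g_lim p s \<le> g_lim p t"
proof (cases "s < 1/2")
  case True
  then show ?thesis using g_lim_range by (simp add: g_lim_eq_0)
next
  case False
  then show ?thesis
    using assms g_lim_props[of s] g_lim_props[of t] f_lim_strict_mono[of "g_lim p t" "g_lim p s"]
    by (cases "g_lim p s \<le> g_lim p t") (simp, linarith)
qed

lemma g_lim_pos: "t > 1/2 \<Longrightarrow> g_lim p t > 0"
  using g_lim_props[of t] by (cases "g_lim p t = 0") auto

lemma g_lim_cont_gt:
  assumes "t > 1/2"
  shows "isCont (g_lim p) t"
proof -
  have g: "0 < g_lim p t" "g_lim p t < 1" using g_lim_pos[OF assms] g_lim_range by auto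
  define d where "d = min (g_lim p t) (1 - g_lim p t) / 2"
  have d: "0 < d" "d < g_lim p t" "d < 1 - g_lim p t" using g by (auto simp: d_def)
  have "isCont (g_lim p) (f_lim p (g_lim p t))"
  proof (rule isCont_inverse_function[where f = "f_lim p" and x = "g_lim p t", OF d(1)])
    fix z assume "\<bar>z - g_lim p t\<bar> \<le> d"
    then have z: "0 \<le> z" "z < 1" using d by auto
    show "g_lim p (f_lim p z) = z" using g_lim_f_lim[OF z] .
    show "isCont (f_lim p) z" using f_lim_deriv[of z] z DERIV_isCont by auto
  qed
  then show ?thesis using g_lim_props(3)[of t] assms by simp
qed

lemma g_lim_deriv:
  assumes "t > 1/2"
  shows "(g_lim p has_real_derivative inverse (f' (g_lim p t))) (at t)"
proof (rule DERIV_inverse_function[where f = "f_lim p" and a = "1/2" and b = "t + 1"])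
  have g: "0 < g_lim p t" "g_lim p t < 1" using g_lim_pos[OF assms] g_lim_range by auto
  show "(f_lim p has_real_derivative f' (g_lim p t)) (at (g_lim p t))"
    using f_lim_deriv g by auto
  show "f' (g_lim p t) \<noteq> 0" using f'_pos[of "g_lim p t"] g by simp
qed (use assms g_lim_props g_lim_cont_gt in auto)

lemma g_lim_isCont: "isCont (g_lim p) t"
proof -
  consider "t < 1/2" | "t > 1/2" | "t = 1/2" by linarith
  then show ?thesis
  proof cases
    case 1
    have "\<forall>\<^sub>F x in nhds t. g_lim p x = 0"
      using eventually_nhds_in_open[of "{..<1/2}" t] 1 by (auto elim!: eventually_mono simp: g_lim_eq_0)
    then show ?thesis by (subst isCont_cong[where g = "\<lambda>_. 0"]) auto
  next
    case 2
    then show ?thesis by (rule g_lim_cont_gt)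
  next
    case 3
    have "(g_lim p \<longlongrightarrow> 0) (at (1/2))"
    proof (rule tendstoI)
      fix e :: real assume e: "e > 0"
      \<comment> \<open>Continuity at the critical time: left of \<open>f_lim p s\<close>,
        monotonicity keeps \<open>g_lim p\<close> at most s.\<close>
      define s where "s = min e 1 / 2"
      have s: "0 < s" "s < 1" "s < e" using e by (auto simp: s_def)
      have "f_lim p s > 1/2" using f_lim_strict_mono[of 0 s] s by simp
      then have "\<forall>\<^sub>F x in at (1/2). x < f_lim p s"
        by (intro order_tendstoD(2)[OF tendsto_ident_at])
      then show "\<forall>\<^sub>F x in at (1/2). dist (g_lim p x) 0 < e"
      proof (rule eventually_mono)
        fix x assume "x < f_lim p s"
        then have "g_lim p x \<le> s" using g_lim_mono[of x "f_lim p s"] g_lim_f_lim[of s] s by simp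
        then show "dist (g_lim p x) 0 < e" using s g_lim_range(1)[of x] by simp
      qed
    qed
    then show ?thesis unfolding 3 isCont_def by (simp add: g_lim_eq_0)
  qed
qed

text \<open>Comparison with the geometric series at s = g_lim p t. The map x -> ln x - 2 * t * x
  increases up to x = 1 / (2 * t), so the tree fraction 1 - g_lim p t lies on its increasing
  branch.\<close>

lemma g_lim_crit: "t \<ge> 0 \<Longrightarrow> 2 * t * (1 - g_lim p t) \<le> 1"
  using f_lim_le_geometric[of "g_lim p t"] g_lim_props[of t] g_lim_eq_0[of t]
  by (cases "t \<ge> 1/2") auto

text \<open>\<open>f_lim_identity\<close> at s = g_lim p t, where \<open>f_lim p s\<close> is t; the
  first factor is the derivative of \<open>g_lim p\<close>. The product form avoids dividing by 1 -
  2 * t * (1 - g).\<close>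

lemma g_lim_ode:
  assumes "t > 1/2"
  shows "inverse (f' (g_lim p t)) * (1 - 2 * t * (1 - g_lim p t)) = 2 * p * g_lim p t * (1 - g_lim p t)"
proof -
  let ?g = "g_lim p t"
  have g: "0 < ?g" "?g < 1" "f_lim p ?g = t" using g_lim_pos[OF assms] g_lim_range g_lim_props[of t] assms by auto
  have "t + p * ?g * f' ?g = 1 / (2 * (1 - ?g))" using f_lim_identity[of ?g] g by simp
  then have "1 - 2 * t * (1 - ?g) = 2 * p * ?g * (1 - ?g) * f' ?g" using g by (simp add: field_simps)
  then show ?thesis using f'_pos[of ?g] g by simp
qed

text \<open>The value at time \<open>t\<close> of \<open>2 * \<integral>\<^sub>0\<^sup>t (1 - (1 - p) * g_lim p s) ds\<close>, in closed form.\<close>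

definition A_lim :: "real \<Rightarrow> real" where
  "A_lim t = 2 * t * (1 - g_lim p t) - ln (1 - g_lim p t)"

text \<open>With h = 1 - g the derivative is 2 * h + g' * (1 - 2 * t * h) / h. By
  \<open>g_lim_ode\<close> the second term is 2 * p * g, and h + p * g = 1 - (1 - p) * g.\<close>

lemma A_lim_deriv:
  assumes "t > 1/2"
  shows "(A_lim has_real_derivative 2 * (1 - (1 - p) * g_lim p t)) (at t)"
proof -
  let ?g = "g_lim p t" and ?D = "inverse (f' (g_lim p t))"
  have g: "0 < ?g" "?g < 1" using g_lim_pos[OF assms] g_lim_range by auto
  have D1: "((\<lambda>t. 1 - g_lim p t) has_real_derivative - ?D) (at t)"
    using DERIV_diff[OF DERIV_const g_lim_deriv[OF assms]] by simp
  have D2: "((\<lambda>t. ln (1 - g_lim p t)) has_real_derivative 1 / (1 - ?g) * - ?D) (at t)"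
    by (rule DERIV_chain2[OF DERIV_ln_divide D1]) (use g in simp)
  have D: "(A_lim has_real_derivative (2 * (1 - ?g) + - ?D * (2 * t) - 1 / (1 - ?g) * - ?D)) (at t)"
    unfolding A_lim_def[abs_def] by (intro DERIV_diff[OF DERIV_mult[OF DERIV_cmult_Id D1] D2])
  have alg: "2 * x + - d * (2 * t) - 1 / x * - d = 2 * x + d * (1 - 2 * t * x) / x" if "x > 0" for x d
    using that by (simp add: field_simps)
  have "2 * (1 - ?g) + - ?D * (2 * t) - 1 / (1 - ?g) * - ?D = 2 * (1 - ?g) + ?D * (1 - 2 * t * (1 - ?g)) / (1 - ?g)"
    using alg[of "1 - ?g" ?D] g by simp
  also have "\<dots> = 2 * (1 - (1 - p) * ?g)"
    unfolding g_lim_ode[OF assms] using g by (simp add: field_simps)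
  finally show ?thesis using D by (simp only:)
qed

text \<open>The derivative is 1 - (1 - g)^2 - g' * (1 - 2 * t * (1 - g)), and
  \<open>g_lim_ode\<close> evaluates the last product.\<close>

lemma d_lim_deriv:
  assumes "t > 1/2"
  shows "(d_lim p has_real_derivative (g_lim p t)\<^sup>2 + 2 * (1 - p) * g_lim p t * (1 - g_lim p t)) (at t)"
proof -
  let ?g = "g_lim p t" and ?D = "inverse (f' (g_lim p t))"
  have g: "0 < ?g" "?g < 1" using g_lim_pos[OF assms] g_lim_range by auto
  have D1: "((\<lambda>t. 1 - g_lim p t) has_real_derivative - ?D) (at t)"
    using DERIV_diff[OF DERIV_const g_lim_deriv[OF assms]] by simp
  have D2: "((\<lambda>t. (1 - g_lim p t) * (1 - g_lim p t)) has_real_derivative (- ?D * (1 - ?g) + - ?D * (1 - ?g))) (at t)"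
    by (rule DERIV_mult[OF D1 D1])
  have D: "(d_lim p has_real_derivative
      (1 - ?D - (1 * ((1 - ?g) * (1 - ?g)) + (- ?D * (1 - ?g) + - ?D * (1 - ?g)) * t))) (at t)"
    unfolding d_lim_def[abs_def] power2_eq_square
    by (intro DERIV_diff[OF DERIV_diff[OF DERIV_ident g_lim_deriv[OF assms]] DERIV_mult[OF DERIV_ident D2]])
  have "1 - ?D - (1 * ((1 - ?g) * (1 - ?g)) + (- ?D * (1 - ?g) + - ?D * (1 - ?g)) * t) =
      1 - (1 - ?g)\<^sup>2 - ?D * (1 - 2 * t * (1 - ?g))"
    by (simp add: power2_eq_square algebra_simps)
  also have "\<dots> = ?g\<^sup>2 + 2 * (1 - p) * ?g * (1 - ?g)"
    unfolding g_lim_ode[OF assms] by (simp add: power2_eq_square algebra_simps)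
  finally show ?thesis using D by simp
qed

lemma A_lim_cont: "isCont A_lim t" and d_lim_cont: "isCont (d_lim p) t"
  using g_lim_range(2)[of t]
  unfolding A_lim_def[abs_def] d_lim_def[abs_def] by (auto intro!: continuous_intros g_lim_isCont)

text \<open>Avoids differentiating at the critical time \<open>1/2\<close>.\<close>

lemma increment_bounds:
  fixes \<Psi> r :: "real \<Rightarrow> real"
  assumes cont: "\<And>t. isCont \<Psi> t"
    and small: "\<And>t. t \<le> 1/2 \<Longrightarrow> \<Psi> t = r 0 * t" "\<And>t. t \<le> 1/2 \<Longrightarrow> r t = r 0"
    and deriv: "\<And>t. t > 1/2 \<Longrightarrow> (\<Psi> has_real_derivative r t) (at t)"
    and mono: "\<And>s t. s \<le> t \<Longrightarrow> r s \<le> r t"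
    and st: "s \<le> t"
  shows "r s * (t - s) \<le> \<Psi> t - \<Psi> s" "\<Psi> t - \<Psi> s \<le> r t * (t - s)"
proof -
  have large: "r s * (t - s) \<le> \<Psi> t - \<Psi> s \<and> \<Psi> t - \<Psi> s \<le> r t * (t - s)" if st: "1/2 \<le> s" "s \<le> t" for s t
  proof (cases "s = t")
    case False
    then have "s < t" using st by simp
    moreover have "continuous_on {s..t} \<Psi>" using cont by (simp add: continuous_at_imp_continuous_on)
    moreover have "\<Psi> differentiable (at x)" if "s < x" for x
      using deriv[of x] st that by (auto simp: real_differentiable_def)
    ultimately obtain l z where z: "s < z" "z < t" "(\<Psi> has_real_derivative l) (at z)" "\<Psi> t - \<Psi> s = (t - s) * l"
      using MVT[of s t \<Psi>] by blast
    have "l = r z" using deriv[of z] z st DERIV_unique by fastforce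
    then have "r s \<le> l" "l \<le> r t" using mono z by auto
    then have "r s * (t - s) \<le> l * (t - s)" "l * (t - s) \<le> r t * (t - s)"
      using st by (intro mult_right_mono; simp)+
    then show ?thesis using z(4) by (simp add: mult.commute)
  qed simp
  show "r s * (t - s) \<le> \<Psi> t - \<Psi> s" "\<Psi> t - \<Psi> s \<le> r t * (t - s)"
  proof -
    consider "1/2 \<le> s" | "t \<le> 1/2" | "s < 1/2" "1/2 < t" by linarith
    then have "r s * (t - s) \<le> \<Psi> t - \<Psi> s \<and> \<Psi> t - \<Psi> s \<le> r t * (t - s)"
    proof cases
      case 1
      then show ?thesis using large st by blast
    next
      case 2
      then have s: "s \<le> 1/2" using st by simp
      have "\<Psi> t - \<Psi> s = r 0 * (t - s)"
        unfolding small(1)[OF 2] small(1)[OF s] by (rule right_diff_distrib[symmetric])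
      then show ?thesis unfolding small(2)[OF 2] small(2)[OF s] by simp
    next
      case 3
      have "\<Psi> s = r 0 * s" "\<Psi> (1/2) = r 0 * (1/2)" "r s = r 0" "r (1/2) = r 0"
        using small[of s] small[of "1/2"] 3 by simp_all
      moreover have "r (1/2) * (t - 1/2) \<le> \<Psi> t - \<Psi> (1/2)" "\<Psi> t - \<Psi> (1/2) \<le> r t * (t - 1/2)"
        using large[of "1/2" t] 3 by auto
      moreover have "r 0 * (1/2 - s) \<le> r t * (1/2 - s)"
        using mono[of "1/2" t] small(2)[of "1/2"] 3 by (intro mult_right_mono) auto
      ultimately show ?thesis by (simp add: algebra_simps)
    qed
    then show "r s * (t - s) \<le> \<Psi> t - \<Psi> s" "\<Psi> t - \<Psi> s \<le> r t * (t - s)" by auto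
  qed
qed

lemma A_lim_increment:
  assumes "s \<le> t"
  shows "2 * (1 - (1 - p) * g_lim p t) * (t - s) \<le> A_lim t - A_lim s"
    "A_lim t - A_lim s \<le> 2 * (1 - (1 - p) * g_lim p s) * (t - s)"
proof -
  \<comment> \<open>The rate of \<open>A_lim\<close> is nonincreasing, so
    \<open>increment_bounds\<close> is applied to its negative.\<close>
  let ?r = "\<lambda>t. - (2 * (1 - (1 - p) * g_lim p t))"
  have cont: "isCont (\<lambda>t. - A_lim t) t" for t using A_lim_cont by (intro continuous_minus)
  have small: "- A_lim t = ?r 0 * t" "?r t = ?r 0" if "t \<le> 1/2" for t
    using that by (simp_all add: A_lim_def g_lim_eq_0)
  have deriv: "((\<lambda>t. - A_lim t) has_real_derivative ?r t) (at t)" if "t > 1/2" for t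
    by (rule DERIV_minus[OF A_lim_deriv[OF that]])
  have mono: "?r s \<le> ?r t" if "s \<le> t" for s t
    using mult_left_mono[OF g_lim_mono[OF that], of "1 - p"] p by simp
  note * = increment_bounds[where \<Psi> = "\<lambda>t. - A_lim t" and r = ?r, OF cont small deriv mono assms]
  show "2 * (1 - (1 - p) * g_lim p t) * (t - s) \<le> A_lim t - A_lim s"
    "A_lim t - A_lim s \<le> 2 * (1 - (1 - p) * g_lim p s) * (t - s)"
    using * by linarith+
qed

text \<open>Limiting probability of a discard when a fraction x is frozen: both endpoints frozen, or
  exactly one of them and the coin rejects the edge.\<close>

definition d_rate :: "real \<Rightarrow> real" where
  "d_rate x = x\<^sup>2 + 2 * (1 - p) * x * (1 - x)"

lemma d_rate_mono:
  assumes "0 \<le> x" "x \<le> y" "y \<le> 1"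
  shows "d_rate x \<le> d_rate y"
proof -
  have "d_rate y - d_rate x = (y - x) * ((1 - p) * (2 - x - y) + p * (x + y))"
    by (simp add: d_rate_def power2_eq_square algebra_simps)
  also have "\<dots> \<ge> 0" using assms p by (intro mult_nonneg_nonneg add_nonneg_nonneg) auto
  finally show ?thesis by simp
qed

lemma d_lim_increment:
  assumes "s \<le> t"
  shows "d_rate (g_lim p s) * (t - s) \<le> d_lim p t - d_lim p s"
    "d_lim p t - d_lim p s \<le> d_rate (g_lim p t) * (t - s)"
proof -
  let ?r = "\<lambda>t. d_rate (g_lim p t)"
  have small: "d_lim p t = ?r 0 * t" "?r t = ?r 0" if "t \<le> 1/2" for t
    using that by (simp_all add: d_lim_def d_rate_def g_lim_eq_0)
  have deriv: "(d_lim p has_real_derivative ?r t) (at t)" if "t > 1/2" for t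
    unfolding d_rate_def by (rule d_lim_deriv[OF that])
  have mono: "?r s \<le> ?r t" if "s \<le> t" for s t
    using d_rate_mono g_lim_mono[OF that] g_lim_range by (simp add: less_imp_le)
  show "?r s * (t - s) \<le> d_lim p t - d_lim p s" "d_lim p t - d_lim p s \<le> ?r t * (t - s)"
    using increment_bounds[where \<Psi> = "d_lim p" and r = ?r, OF d_lim_cont small deriv mono assms] by linarith+
qed

end

section \<open>Stability of the integral equation\<close>

lemma exists_descent:
  fixes f :: "nat \<Rightarrow> real"
  assumes "k \<le> m" "f m < f k"
  shows "\<exists>l. k \<le> l \<and> l < m \<and> f (Suc l) < f l"
proof (rule ccontr)
  assume neg: "\<not> ?thesis"
  have "i \<le> m \<longrightarrow> f k \<le> f i" if "k \<le> i" for i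
    using that
  proof (induction i rule: dec_induct)
    case (step i)
    show ?case
    proof
      assume "Suc i \<le> m"
      then have "f i \<le> f (Suc i)" "f k \<le> f i" using neg step by (auto simp: not_less)
      then show "f k \<le> f (Suc i)" by simp
    qed
  qed simp
  then show False using assms by fastforce
qed

context limit_param
begin

abbreviation h_lim :: "real \<Rightarrow> real" where "h_lim t \<equiv> 1 - g_lim p t"

lemma A_lim_le: "0 \<le> t \<Longrightarrow> A_lim t \<le> 2 * t"
  using A_lim_increment(2)[of 0 t] by (simp add: A_lim_def g_lim_eq_0)

lemma A_lim_0 [simp]: "A_lim 0 = 0"
  by (simp add: A_lim_def g_lim_eq_0)

text \<open>Combines ln h >= - A_lim with A_lim t <= 2 * t. The bound is uniform on bounded time
  intervals, so a grid of values a can start below all values of \<open>h_lim\<close>.\<close>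

lemma h_lim_ge: "0 \<le> t \<Longrightarrow> exp (- 2 * t) \<le> h_lim t"
proof -
  assume t: "0 \<le> t"
  have "- 2 * t \<le> - A_lim t" using A_lim_le[OF t] by simp
  also have "\<dots> \<le> ln (h_lim t)" using t g_lim_range(2)[of t] by (simp add: A_lim_def)
  finally show ?thesis using g_lim_range(2)[of t] by (simp add: ln_ge_iff)
qed

text \<open>The difference of the two sides has derivative - x^2 / (1 - x). The quadratic term is
  what leaves a gap in \<open>lower\<close> at criticality, where the linear terms cancel.\<close>

lemma ln_one_minus_quadratic:
  fixes x :: real
  assumes "0 \<le> x" "x < 1"
  shows "ln (1 - x) \<le> - x - x\<^sup>2 / 2"
proof -
  define \<phi> where "\<phi> x = ln (1 - x) + x + x\<^sup>2 / 2" for x :: real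
  have "\<phi> x \<le> \<phi> 0"
  proof (rule DERIV_nonpos_imp_nonincreasing[OF assms(1)])
    fix z assume z: "0 \<le> z" "z \<le> x"
    have "(\<phi> has_real_derivative (- 1 / (1 - z) + 1 + z)) (at z)"
      unfolding \<phi>_def by (rule derivative_eq_intros refl | use z assms in force)+
    moreover have "- 1 / (1 - z) + 1 + z = - z\<^sup>2 / (1 - z)"
      using z assms by (simp add: field_simps power2_eq_square)
    moreover have "- z\<^sup>2 / (1 - z) \<le> 0" using z assms by (intro divide_nonpos_pos) auto
    ultimately show "\<exists>y. (\<phi> has_real_derivative y) (at z) \<and> y \<le> 0" by auto
  qed
  then show ?thesis by (simp add: \<phi>_def)
qed

definition drift :: "nat \<Rightarrow> (nat \<Rightarrow> real) \<Rightarrow> nat \<Rightarrow> real" where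
  "drift n h m = 2 / real n * (\<Sum>k<m. 1 - (1 - p) * (1 - h k))"

text \<open>The logarithm of the characteristic started at \<open>a\<close>, along which the generating function of the
  tree sizes keeps the value \<open>a\<close>; here \<open>h k\<close> is the fraction of vertices in trees after \<open>k\<close> steps.\<close>

definition log_char :: "nat \<Rightarrow> (nat \<Rightarrow> real) \<Rightarrow> nat \<Rightarrow> real \<Rightarrow> real" where
  "log_char n h m a = ln a - 2 * (real m / real n) * a + drift n h m"

end

section \<open>Deterministic comparison of a profile of tree fractions with the limit\<close>

locale profile = limit_param +
  fixes T :: real and n N :: nat and h :: "nat \<Rightarrow> real"
  assumes T: "1 \<le> T" and n: "n > 0" and N: "real N \<le> real n * T"
    and h_range: "\<And>k. k \<le> N \<Longrightarrow> 0 \<le> h k \<and> h k \<le> 1"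
    and h_mono: "\<And>k m. k \<le> m \<Longrightarrow> m \<le> N \<Longrightarrow> h m \<le> h k"
begin

abbreviation A :: "nat \<Rightarrow> real" where "A \<equiv> drift n h"
abbreviation psi :: "nat \<Rightarrow> real \<Rightarrow> real" where "psi \<equiv> log_char n h"

text \<open>The accumulated deviation whose sign drives the uniqueness argument; by
  \<open>A_compare\<close> it is, up to the factor 2 * (1 - p), the deviation of
  \<open>A\<close>.\<close>

definition H :: "nat \<Rightarrow> real" where
  "H m = (\<Sum>k<m. h k - h_lim (real k / real n)) / real n"

lemma time_le: "m \<le> N \<Longrightarrow> real m / real n \<le> T"
  using N n by (simp add: divide_le_eq mult.commute)

lemma A_Suc: "A (Suc m) = A m + 2 / real n * (1 - (1 - p) * (1 - h m))"
  by (simp add: drift_def distrib_left)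

lemma A_le: "m \<le> N \<Longrightarrow> A m \<le> 2 * T"
proof -
  assume m: "m \<le> N"
  have "(\<Sum>k<m. 1 - (1 - p) * (1 - h k)) \<le> (\<Sum>k<m. 1)"
    using m h_range p by (intro sum_mono) (auto intro!: mult_nonneg_nonneg)
  then have "A m \<le> 2 / real n * real m" unfolding drift_def by (intro mult_left_mono) auto
  also have "\<dots> \<le> 2 * T" using time_le[OF m] by simp
  finally show ?thesis .
qed

text \<open>Without \<open>H\<close> this is a left Riemann sum of the nonincreasing rate of
  \<open>A_lim\<close>. It overshoots the integral by at most the total drop of the rate divided by
  n; the induction carries this telescoping drop, \<open>?c * ?u m\<close>, and the cruder 2 / n is
  inserted only at the end.\<close>

lemma A_compare:
  "A_lim (real m / real n) + 2 * (1 - p) * H m \<le> A m"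
  "A m \<le> A_lim (real m / real n) + 2 * (1 - p) * H m + 2 / real n"
proof -
  let ?c = "2 / real n"
  let ?u = "\<lambda>m. (1 - p) * g_lim p (real m / real n)"
  have main: "A_lim (real m / real n) + 2 * ((1 - p) * H m) \<le> A m \<and>
     A m - ?c * ?u m \<le> A_lim (real m / real n) + 2 * ((1 - p) * H m)"
  proof (induction m)
    case 0
    then show ?case by (simp add: drift_def H_def g_lim_eq_0)
  next
    case (Suc m)
    let ?s = "real m / real n" and ?t = "real (Suc m) / real n"
    define \<Delta> where "\<Delta> = (h m - h_lim ?s) / real n"
    have st: "?s \<le> ?t" "?t - ?s = 1 / real n" using n by (simp_all add: divide_simps)
    have H: "(1 - p) * H (Suc m) = (1 - p) * H m + (1 - p) * \<Delta>"
      by (simp add: H_def \<Delta>_def add_divide_distrib distrib_left)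
    have "?c * (1 - ?u (Suc m)) \<le> A_lim ?t - A_lim ?s" "A_lim ?t - A_lim ?s \<le> ?c * (1 - ?u m)"
      using A_lim_increment[OF st(1)] unfolding st(2) by simp_all
    moreover have "A (Suc m) = A m + ?c * (1 - ?u m) + 2 * ((1 - p) * \<Delta>)"
      unfolding A_Suc \<Delta>_def using n by (simp add: field_simps)
    moreover have "a' + 2 * (x + d) \<le> b' \<and> b' - u' \<le> a' + 2 * (x + d)"
      if "c - u' \<le> a' - a" "a' - a \<le> c - u" "b' = b + (c - u) + 2 * d" "a + 2 * x \<le> b \<and> b - u \<le> a + 2 * x"
      for a a' b b' c d u u' x :: real
      using that by auto
    ultimately show ?case
      using Suc.IH unfolding H right_diff_distrib[of ?c] by blast
  qed
  have "(1 - p) * g_lim p (real m / real n) \<le> 1 * 1"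
    using p g_lim_range[of "real m / real n"] by (intro mult_mono) auto
  then have "?c * ?u m \<le> ?c * 1" by (intro mult_left_mono) auto
  then show "A_lim (real m / real n) + 2 * (1 - p) * H m \<le> A m"
    "A m \<le> A_lim (real m / real n) + 2 * (1 - p) * H m + 2 / real n"
    using main unfolding mult.assoc by linarith+
qed

lemma psi_lipschitz:
  assumes "0 < a0" "a0 \<le> a" "a \<le> b" "m \<le> N"
  shows "\<bar>psi m b - psi m a\<bar> \<le> (1 / a0 + 2 * T) * (b - a)"
proof -
  have 1: "0 \<le> ln b - ln a" using assms by simp
  have "ln b - ln a = ln (b / a)" using assms by (simp add: ln_div)
  also have "\<dots> \<le> b / a - 1" using assms by (intro ln_le_minus_one) auto
  also have "\<dots> = 1 / a * (b - a)" using assms by (simp add: field_simps)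
  also have "\<dots> \<le> 1 / a0 * (b - a)" using assms by (intro mult_right_mono) (auto simp: frac_le)
  finally have 2: "ln b - ln a \<le> 1 / a0 * (b - a)" .
  have "0 \<le> (real m / real n) * (b - a)" "(real m / real n) * (b - a) \<le> T * (b - a)"
    using assms mult_right_mono[OF time_le[OF assms(4)], of "b - a"] by simp_all
  moreover have "psi m b - psi m a = (ln b - ln a) - 2 * ((real m / real n) * (b - a))"
    unfolding log_char_def right_diff_distrib mult.assoc by linarith
  moreover have "(1 / a0 + 2 * T) * (b - a) = 1 / a0 * (b - a) + 2 * (T * (b - a))"
    by (simp only: distrib_right mult.assoc)
  ultimately show ?thesis using 1 2 by linarith
qed

end

text \<open>\<open>control\<close> is where the random estimates enter: X stays near a along a
  characteristic that has never come within \<delta> of 0, and \<open>y\<close> and \<open>K\<close>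
  bound the passage from z to 1. The mesh \<tau> is so fine that one grid step changes
  \<open>psi\<close> by less than \<delta>, and a0 so small that its characteristic never exceeds -
  1.\<close>

locale controlled_profile = profile +
  fixes a0 \<tau> \<delta> \<epsilon> K :: real and y :: "nat \<Rightarrow> real"
  assumes params: "0 < a0" "a0 \<le> exp (- 2 * T - 1)" "0 < \<tau>" "(1 / a0 + 2 * T) * \<tau> < \<delta>" "0 < \<delta>" "\<delta> \<le> 1"
      "0 < \<epsilon>" "0 \<le> K"
    and y: "\<And>k. 0 \<le> y k"
    and control: "\<And>j m. a0 + real j * \<tau> \<le> 1 \<Longrightarrow> m \<le> N \<Longrightarrow> (\<forall>k\<le>m. psi k (a0 + real j * \<tau>) \<le> - \<delta>) \<Longrightarrow>
       a0 + real j * \<tau> - \<epsilon> \<le> h m \<and> h m \<le> a0 + real j * \<tau> + \<epsilon> + y m + K * (- psi m (a0 + real j * \<tau>))"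
begin

text \<open>The factor 2, from exp 1 >= 2, leaves room to go down from \<open>h_lim\<close> by a
  small \<eta> <= a0 without leaving the grid.\<close>

lemma a0_le_h_lim: "m \<le> N \<Longrightarrow> 2 * a0 \<le> h_lim (real m / real n)"
proof -
  assume m: "m \<le> N"
  have "2 * a0 \<le> exp 1 * exp (- 2 * T - 1)"
    using params exp_ge_add_one_self[of 1] by (intro mult_mono) auto
  also have "\<dots> = exp (- 2 * T)" by (simp add: exp_add[symmetric])
  also have "\<dots> \<le> exp (- 2 * (real m / real n))" using time_le[OF m] by simp
  also have "\<dots> \<le> h_lim (real m / real n)" by (rule h_lim_ge) simp
  finally show ?thesis .
qed

lemma grid_below:
  assumes "a0 \<le> x"
  obtains j where "a0 + real j * \<tau> \<le> x" "x < a0 + real j * \<tau> + \<tau>"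
proof
  let ?j = "nat \<lfloor>(x - a0) / \<tau>\<rfloor>"
  have j: "real ?j \<le> (x - a0) / \<tau>" "(x - a0) / \<tau> < real ?j + 1" using assms params by (auto simp: of_nat_nat)
  then show "a0 + real ?j * \<tau> \<le> x" "x < a0 + real ?j * \<tau> + \<tau>"
    using params by (simp_all add: field_simps)
qed

text \<open>Choose \<open>a\<close> on the grid so that the running maximum of \<open>psi _ a\<close> lies between \<open>- 2 * \<delta>\<close> and
  \<open>- \<delta>\<close>. Either \<open>psi m a\<close> is still that large and \<open>control\<close> applies, or \<open>psi _ a\<close> has decreased since,
  which already forces \<open>h < a\<close>.\<close>

lemma upper:
  assumes m: "m \<le> N" and Hm: "H m \<ge> 0"
  shows "h m \<le> h_lim (real m / real n) + \<epsilon> + y m + 2 * \<delta> * K"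
proof -
  let ?t = "real m / real n"
  let ?a = "\<lambda>j. a0 + real j * \<tau>"
  have t: "0 \<le> ?t" by simp
  have hl: "2 * a0 \<le> h_lim ?t" "h_lim ?t \<le> 1" using a0_le_h_lim[OF m] g_lim_range[of ?t] by auto
  \<comment> \<open>The sign of \<open>H m\<close> enters here: the driving term is at least its
    limit, so the characteristic of \<open>h_lim\<close> itself has reached 0.\<close>
  have "0 \<le> A m - A_lim ?t" using A_compare(1)[of m] Hm p mult_nonneg_nonneg[of "1 - p" "H m"] by linarith
  then have psi_h: "psi m (h_lim ?t) \<ge> 0" by (simp add: log_char_def A_lim_def)
  obtain b where b: "?a b \<le> h_lim ?t" "h_lim ?t < ?a b + \<tau>" using grid_below[of "h_lim ?t"] hl params by auto
  have L: "(1 / a0 + 2 * T) * x \<le> (1 / a0 + 2 * T) * \<tau>" if "x \<le> \<tau>" for x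
    using that params T by (intro mult_left_mono) auto
  have "\<bar>psi m (h_lim ?t) - psi m (?a b)\<bar> \<le> (1 / a0 + 2 * T) * (h_lim ?t - ?a b)"
    using b params m by (intro psi_lipschitz) auto
  then have Pb: "psi m (?a b) > - \<delta>" using L[of "h_lim ?t - ?a b"] b psi_h params by linarith
  let ?P = "\<lambda>j. \<exists>k\<le>m. psi k (?a j) > - \<delta>"
  define i where "i = (LEAST j. ?P j)"
  have Pi: "?P i" unfolding i_def by (rule LeastI[of ?P b]) (use Pb in auto)
  have i_le: "i \<le> b" unfolding i_def by (rule Least_le) (use Pb in auto)
  \<comment> \<open>The lowest characteristic stays at or below - 1, hence at or below - \<delta>.
    So i is positive, and its predecessor j has never come within \<delta> of 0.\<close>
  have "\<not> ?P 0"
  proof -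
    have "psi k a0 \<le> - 1" if "k \<le> m" for k
    proof -
      have "ln a0 \<le> - 2 * T - 1" using params by (metis exp_gt_zero ln_exp ln_le_cancel_iff)
      moreover have "A k \<le> 2 * T" using that m by (intro A_le) simp
      moreover have "0 \<le> 2 * (real k / real n) * a0" using params by simp
      ultimately show ?thesis by (simp add: log_char_def)
    qed
    then show ?thesis using params by force
  qed
  then obtain j where j: "i = Suc j" using Pi by (cases i) auto
  have "\<not> ?P j" using j not_less_Least[of j ?P] by (simp add: i_def)
  then have below: "\<forall>k\<le>m. psi k (?a j) \<le> - \<delta>" by (auto simp: not_less)
  have "?a j \<le> ?a b" using i_le j params by simp
  then have aj: "?a j \<le> h_lim ?t" using b(1) by (rule order_trans)
  obtain k where k: "k \<le> m" "psi k (?a i) > - \<delta>" using Pi by blast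
  have "\<bar>psi k (?a i) - psi k (?a j)\<bar> \<le> (1 / a0 + 2 * T) * (?a i - ?a j)"
    using params k m j by (intro psi_lipschitz) (auto simp: algebra_simps)
  moreover have "?a i - ?a j = \<tau>" by (simp add: j algebra_simps)
  ultimately have k2: "psi k (?a j) > - 2 * \<delta>" using k params by auto
  show ?thesis
  proof (cases "psi m (?a j) > - 2 * \<delta>")
    case True
    have "h m \<le> ?a j + \<epsilon> + y m + K * (- psi m (?a j))"
      using control[of j m] aj hl m below by auto
    also have "K * (- psi m (?a j)) \<le> K * (2 * \<delta>)" using True params by (intro mult_left_mono) auto
    finally show ?thesis using aj by (simp add: mult_ac)
  next
    case False
    then have "psi m (?a j) < psi k (?a j)" using k2 by simp
    then obtain l where l: "k \<le> l" "l < m" "psi (Suc l) (?a j) < psi l (?a j)"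
      using exists_descent[of k m "\<lambda>k. psi k (?a j)"] k(1) by blast
    \<comment> \<open>The increment has the sign of 1 - (1 - p) * (1 - h l) - a, and h l is at most
      the first part. A decrease at l therefore gives h l < a, and monotonicity passes this on to
      m.\<close>
    have "psi (Suc l) (?a j) - psi l (?a j) = 2 / real n * (1 - (1 - p) * (1 - h l) - ?a j)"
      unfolding log_char_def A_Suc of_nat_Suc add_divide_distrib right_diff_distrib[of "2 / real n"]
      by (simp add: algebra_simps)
    then have "2 / real n * (1 - (1 - p) * (1 - h l) - ?a j) < 0" using l by simp
    then have "1 - (1 - p) * (1 - h l) - ?a j < 0"
      using n mult_less_cancel_left_pos[of "2 / real n" "1 - (1 - p) * (1 - h l) - ?a j" 0]
      by (simp only: mult_zero_right) simp
    moreover have "h l \<le> 1 - (1 - p) * (1 - h l)"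
    proof -
      have "1 - (1 - p) * (1 - h l) - h l = p * (1 - h l)" by (simp add: algebra_simps)
      also have "\<dots> \<ge> 0" using p h_range[of l] l m by simp
      finally show ?thesis by simp
    qed
    moreover have "h m \<le> h l" using h_mono[of l m] l m by simp
    ultimately show ?thesis using aj params y[of m] mult_nonneg_nonneg[of \<delta> K] by linarith
  qed
qed

text \<open>The sign argument, one step at a time: from H m >= 0 the increment is controlled by
  \<open>upper\<close>; from H m < 0 one step can lift H to at most 1 / n, which is the summand
  1.\<close>

lemma H_le:
  assumes "m \<le> N"
  shows "H m \<le> (real m * (\<epsilon> + 2 * \<delta> * K) + (\<Sum>k<m. y k) + 1) / real n"
  using assms
proof (induction m)
  case 0
  then show ?case by (simp add: H_def)
next
  case (Suc m)
  let ?s = "real m / real n"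
  have H: "H (Suc m) = H m + (h m - h_lim ?s) / real n" by (simp add: H_def add_divide_distrib)
  have e: "0 \<le> \<epsilon> + 2 * \<delta> * K" using params by simp
  show ?case
  proof (cases "H m \<ge> 0")
    case True
    have "(h m - h_lim ?s) / real n \<le> (\<epsilon> + y m + 2 * \<delta> * K) / real n"
      using upper[of m] True Suc.prems by (intro divide_right_mono) auto
    moreover have "H m \<le> (real m * (\<epsilon> + 2 * \<delta> * K) + (\<Sum>k<m. y k) + 1) / real n"
      using Suc by simp
    ultimately have "H (Suc m) \<le> (real m * (\<epsilon> + 2 * \<delta> * K) + (\<Sum>k<m. y k) + 1) / real n + (\<epsilon> + y m + 2 * \<delta> * K) / real n"
      unfolding H by simp
    then show ?thesis by (simp add: add_divide_distrib[symmetric] algebra_simps)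
  next
    case False
    have "h m - h_lim ?s \<le> 1" using h_range[of m] g_lim_range[of ?s] Suc.prems by simp
    then have "(h m - h_lim ?s) / real n \<le> 1 / real n" by (intro divide_right_mono) auto
    then have "H (Suc m) \<le> 1 / real n" using False unfolding H by simp
    also have "\<dots> \<le> (real (Suc m) * (\<epsilon> + 2 * \<delta> * K) + (\<Sum>k<Suc m. y k) + 1) / real n"
      using e y by (intro divide_right_mono) (auto intro!: add_nonneg_nonneg sum_nonneg)
    finally show ?thesis .
  qed
qed

text \<open>Once \<open>H\<close> is bounded above, every characteristic started a little below \<open>h_lim\<close> stays below
  \<open>- \<delta>\<close>: since \<open>2 * t * h_lim t \<le> 1\<close>, lowering \<open>a\<close> from \<open>h_lim t\<close> by \<open>\<eta> / 2\<close> lowers \<open>ln a - 2 * t * a\<close> by at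
  least \<open>\<eta>\<^sup>2 / 8\<close>.\<close>

lemma lower:
  assumes m: "m \<le> N" and \<kappa>: "0 \<le> \<kappa>" "\<And>k. k \<le> N \<Longrightarrow> H k \<le> \<kappa>"
    and \<eta>: "0 < \<eta>" "\<eta> \<le> a0" "\<tau> \<le> \<eta> / 4" "\<epsilon> \<le> \<eta> / 4" "\<delta> + 2 / real n + 2 * \<kappa> \<le> \<eta>\<^sup>2 / 8"
  shows "h_lim (real m / real n) - \<eta> \<le> h m"
proof -
  let ?t = "real m / real n"
  have t: "0 \<le> ?t" by simp
  have hl: "2 * a0 \<le> h_lim ?t" "h_lim ?t \<le> 1" using a0_le_h_lim[OF m] g_lim_range[of ?t] by auto
  obtain j where j: "a0 + real j * \<tau> \<le> h_lim ?t - \<eta> / 2" "h_lim ?t - \<eta> / 2 < a0 + real j * \<tau> + \<tau>"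
    using grid_below[of "h_lim ?t - \<eta> / 2"] hl \<eta> by auto
  define a where "a = a0 + real j * \<tau>"
  have a: "a0 \<le> a" "a \<le> h_lim ?t - \<eta> / 2" "h_lim ?t - 3 * \<eta> / 4 \<le> a"
    using j \<eta> params by (auto simp: a_def)
  have bound: "psi k a \<le> - \<delta>" if k: "k \<le> m" for k
  proof -
    let ?s = "real k / real n"
    have st: "?s \<le> ?t" using k n by (simp add: divide_right_mono)
    have "0 \<le> p * g_lim p ?t" using p g_lim_range[of ?t] by simp
    then have "a \<le> 1 - (1 - p) * g_lim p ?t" using a(2) \<eta>(1) unfolding left_diff_distrib by linarith
    \<comment> \<open>On the interval from s to t the slope of \<open>A_lim\<close> is at least 2 *
      a, so A_lim - 2 * a * time is largest at t. This reduces every earlier k to the final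
      time.\<close>
    then have "2 * a * (?t - ?s) \<le> 2 * (1 - (1 - p) * g_lim p ?t) * (?t - ?s)"
      using st by (intro mult_right_mono) auto
    also have "\<dots> \<le> A_lim ?t - A_lim ?s" by (rule A_lim_increment[OF st])
    finally have 1: "A_lim ?s - 2 * ?s * a \<le> A_lim ?t - 2 * ?t * a" by (simp add: algebra_simps)
    have "(1 - p) * H k \<le> (1 - p) * \<kappa>" using \<kappa>(2)[of k] k m p by (intro mult_left_mono) auto
    also have "\<dots> \<le> 1 * \<kappa>" using p \<kappa> by (intro mult_right_mono) auto
    finally have 2: "A k \<le> A_lim ?s + 2 * \<kappa> + 2 / real n" using A_compare(2)[of k] unfolding mult.assoc by linarith
    define x where "x = (h_lim ?t - a) / h_lim ?t"
    have hp: "h_lim ?t > 0" "a > 0" using hl params a by auto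
    have x: "0 \<le> x" "x < 1" using a hp \<eta> by (auto simp: x_def)
    have "\<eta> / 2 * h_lim ?t \<le> \<eta> / 2 * 1" using hl \<eta> by (intro mult_left_mono) auto
    then have "\<eta> / 2 \<le> x" using a hp unfolding x_def by (simp add: field_simps)
    then have "(\<eta> / 2)\<^sup>2 \<le> x\<^sup>2" using \<eta> by (intro power_mono) auto
    then have x2: "\<eta>\<^sup>2 / 8 \<le> x\<^sup>2 / 2" by (simp add: power_divide)
    have "1 - x = a / h_lim ?t" using hp by (simp add: x_def field_simps)
    then have "ln a - ln (h_lim ?t) = ln (1 - x)" using hp by (simp add: ln_div)
    then have 3: "ln a - ln (h_lim ?t) \<le> - x - x\<^sup>2 / 2" using ln_one_minus_quadratic[OF x] by simp
    \<comment> \<open>By \<open>g_lim_crit\<close> the gain 2 * t * (h_lim t - a) from lowering a is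
      at most x. The linear part of ln (1 - x) absorbs it, and - x^2 / 2 remains.\<close>
    have "2 * ?t * h_lim ?t * x \<le> 1 * x" using g_lim_crit[of ?t] x by (intro mult_right_mono) auto
    moreover have "h_lim ?t * x = h_lim ?t - a" using hp by (simp add: x_def)
    ultimately have 4: "2 * ?t * (h_lim ?t - a) \<le> x" by (simp only: mult.assoc mult_1)
    have "psi k a \<le> ln a - 2 * ?s * a + (A_lim ?s + 2 * \<kappa> + 2 / real n)" using 2 by (simp add: log_char_def)
    also have "\<dots> \<le> ln a + (A_lim ?t - 2 * ?t * a) + 2 * \<kappa> + 2 / real n" using 1 by simp
    also have "\<dots> = ln a - ln (h_lim ?t) + 2 * ?t * (h_lim ?t - a) + 2 * \<kappa> + 2 / real n"
    proof -
      have "l + (2 * s * x - y - 2 * s * a) + k + r = l - y + 2 * s * (x - a) + k + r" for l s x y k r :: real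
        by (simp add: algebra_simps)
      then show ?thesis unfolding A_lim_def .
    qed
    also have "\<dots> \<le> - \<delta>" using 3 4 x2 \<eta>(5) by linarith
    finally show ?thesis .
  qed
  have "a \<le> 1" using a hl \<eta> by simp
  then have "a - \<epsilon> \<le> h m" using control[of j m] bound m by (simp add: a_def)
  then show ?thesis using a \<eta> by simp
qed

end

context profile
begin

text \<open>If h exceeded the limit by \<omega> at step m, monotonicity of h and continuity of the
  limit would keep an excess of \<omega> / 2 over the preceding \<rho> * n steps. This adds at least
  \<rho> * \<omega> / 4 to \<open>H\<close>, earlier deficits cancel at most \<eta> * T, and the
  bound \<kappa> is violated.\<close>

lemma close_from_averages:
  assumes \<kappa>: "\<And>k. k \<le> N \<Longrightarrow> H k \<le> \<kappa>" and \<eta>: "0 < \<eta>" "\<And>k. k \<le> N \<Longrightarrow> h_lim (real k / real n) - \<eta> \<le> h k"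
    and \<omega>: "0 < \<omega>" "\<eta> \<le> \<omega>" and \<rho>: "0 < \<rho>" "\<rho> \<le> 1/2" "2 / \<rho> \<le> real n" "\<kappa> + \<eta> * T < \<rho> * \<omega> / 4"
    and uc: "\<And>s t. 0 \<le> s \<Longrightarrow> s \<le> T \<Longrightarrow> 0 \<le> t \<Longrightarrow> t \<le> T \<Longrightarrow> \<bar>s - t\<bar> \<le> \<rho> \<Longrightarrow> \<bar>g_lim p s - g_lim p t\<bar> \<le> \<omega> / 2"
    and m: "m \<le> N"
  shows "\<bar>h m - h_lim (real m / real n)\<bar> \<le> \<omega>"
proof (rule ccontr)
  let ?t = "real m / real n"
  assume "\<not> ?thesis"
  then have big: "h m > h_lim ?t + \<omega>" using \<eta>(2)[OF m] \<omega> by linarith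
  then have "g_lim p ?t > 0" using h_range[OF m] \<omega> by simp
  \<comment> \<open>Up to time 1/2 the limit is 1, which h cannot exceed. Past it, a window of
    length \<rho> <= 1/2 fits into the past.\<close>
  then have "?t > 1/2" using g_lim_eq_0[of ?t] by (cases "?t \<le> 1/2") auto
  then have "real n / 2 < real m" using n by (simp add: field_simps)
  then have mq: "\<rho> * real n \<le> real m" using \<rho>(2) mult_right_mono[of \<rho> "1/2" "real n"] by simp
  define q where "q = nat \<lfloor>\<rho> * real n\<rfloor>"
  have q: "real q \<le> \<rho> * real n" "\<rho> * real n - 1 < real q" using \<rho> n by (auto simp: q_def of_nat_nat)
  have q2: "\<rho> * real n / 2 \<le> real q" using q \<rho> by (simp add: field_simps)
  have qm: "q \<le> m" using q mq by simp
  have each: "\<omega> / 2 \<le> h k - h_lim (real k / real n)" if k: "m - q \<le> k" "k < m" for k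
  proof -
    have "?t - real k / real n \<le> real q / real n"
      using k n by (simp add: diff_divide_distrib[symmetric] divide_right_mono)
    also have "\<dots> \<le> \<rho>" using q n by (simp add: field_simps)
    finally have "\<bar>real k / real n - ?t\<bar> \<le> \<rho>" using k n by (simp add: abs_le_iff divide_right_mono)
    then have "\<bar>g_lim p (real k / real n) - g_lim p ?t\<bar> \<le> \<omega> / 2"
      using uc[of "real k / real n" ?t] time_le[OF m] time_le[of k] k m by simp
    moreover have "h m \<le> h k" using h_mono[of k m] k m by simp
    ultimately show ?thesis using big by linarith
  qed
  let ?F = "\<lambda>k. h k - h_lim (real k / real n)"
  have "{..<m} = {..<m - q} \<union> {m - q..<m}" using qm by auto
  then have "sum ?F {..<m} = sum ?F ({..<m - q} \<union> {m - q..<m})" by (rule arg_cong)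
  also have "\<dots> = sum ?F {..<m - q} + sum ?F {m - q..<m}" by (rule sum.union_disjoint) auto
  finally have split: "sum ?F {..<m} = sum ?F {..<m - q} + sum ?F {m - q..<m}" .
  have "- \<eta> \<le> ?F k" if "k \<in> {..<m - q}" for k
    using \<eta>(2)[of k] m that by (simp add: algebra_simps)
  then have "real (card {..<m - q}) * - \<eta> \<le> sum ?F {..<m - q}" by (rule sum_bounded_below)
  moreover have "real (m - q) * \<eta> \<le> real m * \<eta>" using \<eta>(1) by (intro mult_right_mono) auto
  ultimately have 1: "- (real m * \<eta>) \<le> sum ?F {..<m - q}" by simp
  have "real (card {m - q..<m}) * (\<omega> / 2) \<le> sum ?F {m - q..<m}"
    by (rule sum_bounded_below) (use each in auto)
  then have 2: "real q * (\<omega> / 2) \<le> sum ?F {m - q..<m}" using qm by simp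
  have 3: "\<rho> * real n / 2 * (\<omega> / 2) \<le> real q * (\<omega> / 2)" using q2 \<omega> by (intro mult_right_mono) auto
  have "\<rho> * \<omega> / 4 * real n - real m * \<eta> = \<rho> * real n / 2 * (\<omega> / 2) - real m * \<eta>" by simp
  also have "\<dots> \<le> sum ?F {..<m}" using 1 2 3 split by linarith
  finally have "\<rho> * \<omega> / 4 * real n - real m * \<eta> \<le> sum ?F {..<m}" .
  then have "(\<rho> * \<omega> / 4 * real n - real m * \<eta>) / real n \<le> H m" unfolding H_def by (intro divide_right_mono) auto
  moreover have "(\<rho> * \<omega> / 4 * real n - real m * \<eta>) / real n = \<rho> * \<omega> / 4 - ?t * \<eta>" using n by (simp add: field_simps)
  moreover have "?t * \<eta> \<le> T * \<eta>" using time_le[OF m] \<eta> by (intro mult_right_mono) auto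
  ultimately show False using \<kappa>[OF m] \<rho>(4) by (simp add: mult.commute)
qed

end

context limit_param
begin

text \<open>The quantifiers put \<kappa> before K: a large K is what makes the bound on the sum of
  \<open>y\<close> likely, and only a \<delta> chosen after K can absorb the loss K * (-
  psi).\<close>

lemma stability:
  fixes T \<omega> :: real
  assumes T: "1 \<le> T" and \<omega>: "0 < \<omega>"
  shows "\<exists>\<kappa>>0. \<forall>K\<ge>0. \<exists>\<delta> \<epsilon> S n0. 0 < \<delta> \<and> \<delta> \<le> 1 \<and> 0 < \<epsilon> \<and> finite S \<and> S \<subseteq> {0<..1} \<and>
    (\<forall>n\<ge>n0. \<forall>N h y. profile p T n N h \<longrightarrow> (\<forall>k. 0 \<le> y k) \<longrightarrow>
       (\<forall>a\<in>S. \<forall>m\<le>N. (\<forall>k\<le>m. log_char n h k a \<le> - \<delta>) \<longrightarrow>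
          a - \<epsilon> \<le> h m \<and> h m \<le> a + \<epsilon> + y m + K * (- log_char n h m a)) \<longrightarrow>
       (\<Sum>k<N. y k) \<le> \<kappa> * real n \<longrightarrow> (\<forall>m\<le>N. \<bar>h m - h_lim (real m / real n)\<bar> \<le> \<omega>))"
proof -
  have "uniformly_continuous_on {0..T} (g_lim p)"
    by (intro compact_uniformly_continuous continuous_at_imp_continuous_on) (auto intro: g_lim_isCont)
  then obtain \<rho>0 where \<rho>0: "\<rho>0 > 0"
      "\<And>s t. s \<in> {0..T} \<Longrightarrow> t \<in> {0..T} \<Longrightarrow> dist s t < \<rho>0 \<Longrightarrow> dist (g_lim p s) (g_lim p t) < \<omega> / 2"
    using \<omega> unfolding uniformly_continuous_on_def by (metis half_gt_zero)
  define \<rho> where "\<rho> = min (1/2) (\<rho>0 / 2)"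
  define a0 where "a0 = exp (- 2 * T - 1)"
  \<comment> \<open>\<eta> is the accuracy from below: at most a0 to stay on the grid, and with
    \<eta> * T at most \<rho> * \<omega> / 16 so that deficits cannot hide an excess in
    \<open>close_from_averages\<close>.\<close>
  define \<eta> where "\<eta> = min a0 (min \<omega> (\<rho> * \<omega> / (16 * T)))"
  \<comment> \<open>The second bound keeps 2 * \<kappa> within the gap \<eta>^2 / 8 of
    \<open>lower\<close>; the first leaves \<open>close_from_averages\<close> its margin.\<close>
  define \<kappa> where "\<kappa> = min (\<rho> * \<omega> / 16) (\<eta>\<^sup>2 / 64)"
  have \<rho>: "0 < \<rho>" "\<rho> \<le> 1/2" "\<rho> < \<rho>0" using \<rho>0(1) by (auto simp: \<rho>_def)
  have uc: "\<bar>g_lim p s - g_lim p t\<bar> \<le> \<omega> / 2"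
    if "0 \<le> s" "s \<le> T" "0 \<le> t" "t \<le> T" "\<bar>s - t\<bar> \<le> \<rho>" for s t
    using \<rho>0(2)[of s t] that \<rho>(3) by (auto simp: dist_real_def)
  have a0: "0 < a0" by (simp add: a0_def)
  have "0 < \<rho> * \<omega> / (16 * T)" using \<rho> \<omega> T by simp
  then have \<eta>: "0 < \<eta>" "\<eta> \<le> a0" "\<eta> \<le> \<omega>" "\<eta> \<le> \<rho> * \<omega> / (16 * T)"
    using a0 \<omega> by (auto simp: \<eta>_def)
  have \<eta>T: "\<eta> * T \<le> \<rho> * \<omega> / 16" using \<eta>(4) T by (simp add: field_simps)
  have \<kappa>: "0 < \<kappa>" "\<kappa> \<le> \<rho> * \<omega> / 16" "\<kappa> \<le> \<eta>\<^sup>2 / 64" using \<rho> \<omega> \<eta> by (auto simp: \<kappa>_def)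
  have "\<exists>\<delta> \<epsilon> S n0. 0 < \<delta> \<and> \<delta> \<le> 1 \<and> 0 < \<epsilon> \<and> finite S \<and> S \<subseteq> {0<..1} \<and>
    (\<forall>n\<ge>n0. \<forall>N h y. profile p T n N h \<longrightarrow> (\<forall>k. 0 \<le> y k) \<longrightarrow>
       (\<forall>a\<in>S. \<forall>m\<le>N. (\<forall>k\<le>m. log_char n h k a \<le> - \<delta>) \<longrightarrow>
          a - \<epsilon> \<le> h m \<and> h m \<le> a + \<epsilon> + y m + K * (- log_char n h m a)) \<longrightarrow>
       (\<Sum>k<N. y k) \<le> \<kappa> / 4 * real n \<longrightarrow> (\<forall>m\<le>N. \<bar>h m - h_lim (real m / real n)\<bar> \<le> \<omega>))"
    if K: "0 \<le> K" for K
  proof -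
    \<comment> \<open>The budget \<kappa> for \<open>H\<close> in \<open>H_le\<close> has four
      quarters: \<epsilon> * T, 2 * \<delta> * K * T, the sum of \<open>y\<close> divided by n, and
      the summand 1 / n. In \<open>lower\<close>, each of \<delta>, 2 / n and 2 * \<kappa> gets
      \<eta>^2 / 32.\<close>
    define \<delta> where "\<delta> = min 1 (min (\<eta>\<^sup>2 / 32) (\<kappa> / (8 * (K + 1) * T)))"
    define \<epsilon> where "\<epsilon> = min (\<eta> / 4) (\<kappa> / (4 * T))"
    define \<tau> where "\<tau> = min (\<eta> / 4) (\<delta> / (2 * (1 / a0 + 2 * T)))"
    define S where "S = (\<lambda>j. a0 + real j * \<tau>) ` {..nat \<lceil>1 / \<tau>\<rceil>} \<inter> {..1}"
    define n0 where "n0 = nat \<lceil>max (4 / \<kappa>) (max (64 / \<eta>\<^sup>2) (2 / \<rho>))\<rceil> + 1"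
    have L: "0 < 1 / a0 + 2 * T" using a0 T by (simp add: add_pos_nonneg)
    have "0 < \<kappa> / (8 * (K + 1) * T)" using \<kappa> K T by simp
    then have "0 < \<delta>" using \<eta> by (simp add: \<delta>_def)
    moreover have "\<delta> \<le> 1" "\<delta> \<le> \<eta>\<^sup>2 / 32" "\<delta> \<le> \<kappa> / (8 * (K + 1) * T)"
      unfolding \<delta>_def by (meson min.cobounded1 min.cobounded2 order_trans)+
    ultimately have \<delta>: "0 < \<delta>" "\<delta> \<le> 1" "\<delta> \<le> \<eta>\<^sup>2 / 32" "\<delta> \<le> \<kappa> / (8 * (K + 1) * T)" by auto
    have "2 * \<delta> * K * T \<le> 2 * \<delta> * (K + 1) * T" using \<delta> T by (intro mult_right_mono mult_left_mono) auto
    also have "\<dots> \<le> 2 * (\<kappa> / (8 * (K + 1) * T)) * (K + 1) * T"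
      using \<delta>(4) K T by (intro mult_right_mono mult_left_mono) auto
    also have "\<dots> = 2 * (\<kappa> / (8 * ((K + 1) * T))) * ((K + 1) * T)" by (simp only: mult.assoc)
    also have "\<dots> = \<kappa> / 4"
    proof -
      have "(K + 1) * T \<noteq> 0" using K T by simp
      then show ?thesis by simp
    qed
    finally have \<delta>KT: "2 * \<delta> * K * T \<le> \<kappa> / 4" .
    have \<epsilon>: "0 < \<epsilon>" "\<epsilon> \<le> \<eta> / 4" "\<epsilon> * T \<le> \<kappa> / 4"
      using \<eta> \<kappa> T by (auto simp: \<epsilon>_def min_def field_simps)
    have "0 < \<tau>" using \<eta> \<delta> L by (simp add: \<tau>_def)
    moreover have "\<tau> \<le> \<eta> / 4" "\<tau> \<le> \<delta> / (2 * (1 / a0 + 2 * T))"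
      unfolding \<tau>_def by (rule min.cobounded1, rule min.cobounded2)
    ultimately have \<tau>: "0 < \<tau>" "\<tau> \<le> \<eta> / 4" "\<tau> \<le> \<delta> / (2 * (1 / a0 + 2 * T))" by auto
    have half: "c * (\<delta> / (2 * c)) = \<delta> / 2" if "0 < c" for c using that by simp
    have "(1 / a0 + 2 * T) * \<tau> \<le> (1 / a0 + 2 * T) * (\<delta> / (2 * (1 / a0 + 2 * T)))"
      using \<tau>(3) L by (intro mult_left_mono) auto
    also have "\<dots> = \<delta> / 2" by (rule half[OF L])
    also have "\<dots> < \<delta>" using \<delta>(1) by simp
    finally have L\<tau>: "(1 / a0 + 2 * T) * \<tau> < \<delta>" .
    have close: "\<bar>h m - h_lim (real m / real n)\<bar> \<le> \<omega>"
      if n_ge: "n \<ge> n0" and prof: "profile p T n N h" and y: "\<forall>k. 0 \<le> y k"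
        and ctrl: "\<forall>a\<in>S. \<forall>m\<le>N. (\<forall>k\<le>m. log_char n h k a \<le> - \<delta>) \<longrightarrow>
          a - \<epsilon> \<le> h m \<and> h m \<le> a + \<epsilon> + y m + K * (- log_char n h m a)"
        and ys: "(\<Sum>k<N. y k) \<le> \<kappa> / 4 * real n" and m: "m \<le> N" for n N h y m
    proof -
      interpret profile p T n N h by (fact prof)
      have "max (4 / \<kappa>) (max (64 / \<eta>\<^sup>2) (2 / \<rho>)) \<le> real n"
        using n_ge unfolding n0_def by linarith
      then have nn: "4 / \<kappa> \<le> real n" "64 / \<eta>\<^sup>2 \<le> real n" "2 / \<rho> \<le> real n" "0 < real n"
        using n by auto
      have n1: "1 / real n \<le> \<kappa> / 4" "2 / real n \<le> \<eta>\<^sup>2 / 32"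
        using nn \<kappa> \<eta> by (simp_all add: field_simps)
      interpret controlled_profile p T n N h a0 \<tau> \<delta> \<epsilon> K y
      proof unfold_locales
        fix j m
        assume j: "a0 + real j * \<tau> \<le> 1" and rest: "m \<le> N" "\<forall>k\<le>m. log_char n h k (a0 + real j * \<tau>) \<le> - \<delta>"
        have "real j \<le> 1 / \<tau>" using j a0 \<tau> by (simp add: field_simps)
        then have "j \<le> nat \<lceil>1 / \<tau>\<rceil>" by linarith
        then have "a0 + real j * \<tau> \<in> S" using j by (auto simp: S_def)
        then show "a0 + real j * \<tau> - \<epsilon> \<le> h m \<and>
            h m \<le> a0 + real j * \<tau> + \<epsilon> + y m + K * (- log_char n h m (a0 + real j * \<tau>))"
          using ctrl rest by blast
      qed (use a0 \<tau> \<delta> \<epsilon> K L\<tau> y in \<open>simp_all add: a0_def\<close>)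
      have Hk: "H k \<le> \<kappa>" if k: "k \<le> N" for k
      proof -
        have "(\<Sum>i<k. y i) \<le> (\<Sum>i<N. y i)" using k y by (intro sum_mono2) auto
        then have "(\<Sum>i<k. y i) \<le> \<kappa> / 4 * real n" using ys by linarith
        moreover have "real k * (\<epsilon> + 2 * \<delta> * K) \<le> \<kappa> / 2 * real n"
        proof -
          have "real k * (\<epsilon> + 2 * \<delta> * K) \<le> (real n * T) * (\<epsilon> + 2 * \<delta> * K)"
            using k N \<epsilon> \<delta> K by (intro mult_right_mono) auto
          also have "\<dots> = real n * (\<epsilon> * T + 2 * \<delta> * K * T)" by (simp add: algebra_simps)
          also have "\<dots> \<le> real n * (\<kappa> / 2)" using \<epsilon> \<delta>KT by (intro mult_left_mono) auto
          finally show ?thesis by (simp add: mult.commute)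
        qed
        moreover have "1 \<le> \<kappa> / 4 * real n" using n1 nn by (simp add: field_simps)
        ultimately have "real k * (\<epsilon> + 2 * \<delta> * K) + (\<Sum>i<k. y i) + 1 \<le> \<kappa> * real n" by linarith
        then have "(real k * (\<epsilon> + 2 * \<delta> * K) + (\<Sum>i<k. y i) + 1) / real n \<le> \<kappa>"
          using nn by (simp add: divide_le_eq)
        then show ?thesis using H_le[OF k] by simp
      qed
      have low: "h_lim (real k / real n) - \<eta> \<le> h k" if "k \<le> N" for k
        by (rule lower[OF that, of \<kappa>]) (use Hk \<kappa> \<eta> \<tau> \<epsilon> \<delta> n1 in auto)
      have gap: "\<kappa> + \<eta> * T < \<rho> * \<omega> / 4" using \<kappa>(2) \<eta>T mult_pos_pos[OF \<rho>(1) \<omega>] by linarith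
      show ?thesis
        using Hk \<eta>(1) low \<omega> \<eta>(3) \<rho>(1,2) nn(3) gap uc m by (rule close_from_averages)
    qed
    show ?thesis
    proof (rule exI[of _ \<delta>], rule exI[of _ \<epsilon>], rule exI[of _ S], rule exI[of _ n0], intro conjI allI impI)
      show "finite S" by (simp add: S_def)
      show "S \<subseteq> {0<..1}" using a0 \<tau> by (auto simp: S_def add_pos_nonneg)
    qed (rule \<delta> \<epsilon> close; assumption)+
  qed
  note main = this
  show ?thesis
  proof (rule exI[of _ "\<kappa> / 4"], intro conjI allI impI)
    show "0 < \<kappa> / 4" using \<kappa>(1) by simp
  qed (rule main)
qed

section \<open>Lipschitz bound and Riemann sums for the discard rate\<close>

lemma d_rate_lipschitz:
  assumes "0 \<le> x" "x \<le> 1" "0 \<le> y" "y \<le> 1"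
  shows "\<bar>d_rate x - d_rate y\<bar> \<le> 2 * \<bar>x - y\<bar>"
proof -
  \<comment> \<open>A convex combination of 2 - x - y and x + y, both between 0 and 2.\<close>
  let ?c = "(1 - p) * (2 - x - y) + p * (x + y)"
  have "d_rate x - d_rate y = ?c * (x - y)"
    by (simp add: d_rate_def power2_eq_square algebra_simps)
  moreover have "0 \<le> ?c" using assms p by (intro add_nonneg_nonneg mult_nonneg_nonneg) auto
  moreover have "?c \<le> (1 - p) * 2 + p * 2" using assms p by (intro add_mono mult_left_mono) auto
  ultimately show ?thesis by (simp add: abs_mult mult_right_mono)
qed

lemma d_rate_range:
  assumes "0 \<le> x" "x \<le> 1"
  shows "0 \<le> d_rate x" "d_rate x \<le> 1"
  using d_rate_mono[of 0 x] d_rate_mono[of x 1] assms by (simp_all add: d_rate_def)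

text \<open>The rate is nondecreasing here, so the left Riemann sum falls short, by at most the
  total rise of the rate divided by n. The rise telescopes in the induction as in
  \<open>A_compare\<close>.\<close>

lemma d_lim_riemann:
  assumes "n > 0"
  shows "\<bar>(\<Sum>k<m. d_rate (g_lim p (real k / real n))) / real n - d_lim p (real m / real n)\<bar> \<le> 1 / real n"
proof -
  have "d_lim p (real m / real n) - d_rate (g_lim p (real m / real n)) / real n
      \<le> (\<Sum>k<m. d_rate (g_lim p (real k / real n))) / real n \<and>
    (\<Sum>k<m. d_rate (g_lim p (real k / real n))) / real n \<le> d_lim p (real m / real n)"
  proof (induction m)
    case 0
    then show ?case by (simp add: d_lim_def g_lim_eq_0 d_rate_def)
  next
    case (Suc m)
    let ?s = "real m / real n" and ?t = "real (Suc m) / real n"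
    have st: "?s \<le> ?t" "?t - ?s = 1 / real n" using assms by (simp_all add: divide_simps)
    show ?case using d_lim_increment[OF st(1)] Suc.IH unfolding st(2) by (simp add: add_divide_distrib)
  qed
  moreover have "d_rate (g_lim p (real m / real n)) / real n \<le> 1 / real n"
    using d_rate_range g_lim_range[of "real m / real n"] by (intro divide_right_mono) (auto simp: less_imp_le)
  ultimately show ?thesis by linarith
qed

end

section \<open>Histories of Markov chains\<close>

text \<open>The newest state comes first, so the next step depends on the head alone, functionals of
  the past are functions of the list, and \<open>drop\<close> recovers earlier histories.\<close>

fun run_pmf :: "('s \<Rightarrow> 's pmf) \<Rightarrow> nat \<Rightarrow> 's list \<Rightarrow> 's list pmf" where
  "run_pmf K 0 xs = return_pmf xs"
| "run_pmf K (Suc r) xs = bind_pmf (K (hd xs)) (\<lambda>y. run_pmf K r (y # xs))"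

text \<open>The recursion peels off the first step, which suits induction on the remaining time;
  \<open>frozen_process\<close> prescribes the law through the last step.\<close>

lemma run_pmf_Suc_right:
  "run_pmf K (Suc r) xs = bind_pmf (run_pmf K r xs) (\<lambda>ys. map_pmf (\<lambda>y. y # ys) (K (hd ys)))"
proof (induction r arbitrary: xs)
  case 0
  show ?case by (simp add: bind_return_pmf map_pmf_def)
next
  case (Suc r)
  have "run_pmf K (Suc (Suc r)) xs = bind_pmf (K (hd xs)) (\<lambda>y. run_pmf K (Suc r) (y # xs))"
    by (rule run_pmf.simps)
  also have "\<dots> = bind_pmf (K (hd xs)) (\<lambda>y. bind_pmf (run_pmf K r (y # xs)) (\<lambda>ys. map_pmf (\<lambda>y. y # ys) (K (hd ys))))"
    by (simp only: Suc.IH)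
  also have "\<dots> = bind_pmf (run_pmf K (Suc r) xs) (\<lambda>ys. map_pmf (\<lambda>y. y # ys) (K (hd ys)))"
    by (simp add: bind_assoc_pmf)
  finally show ?case .
qed

lemma length_run_pmf: "ys \<in> set_pmf (run_pmf K r xs) \<Longrightarrow> length ys = length xs + r"
  by (induction r arbitrary: xs) auto

lemma drop_run_pmf: "ys \<in> set_pmf (run_pmf K r xs) \<Longrightarrow> drop r ys = xs"
proof (induction r arbitrary: xs)
  case (Suc r)
  then obtain y where "ys \<in> set_pmf (run_pmf K r (y # xs))" by auto
  then have "drop r ys = y # xs" by (rule Suc.IH)
  then show ?case by (metis drop_Suc list.sel(3) tl_drop)
qed simp

lemma run_pmf_invariant:
  assumes "ys \<in> set_pmf (run_pmf K r xs)" and "I xs"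
    and "\<And>xs y. I xs \<Longrightarrow> y \<in> set_pmf (K (hd xs)) \<Longrightarrow> I (y # xs)"
  shows "I ys"
  using assms(1,2) by (induction r arbitrary: xs) (auto intro: assms(3))

lemma finite_set_run_pmf:
  assumes "\<And>x. finite (set_pmf (K x))"
  shows "finite (set_pmf (run_pmf K r xs))"
  by (induction r arbitrary: xs) (auto simp: assms)

lemma expectation_bind_pmf_finite:
  fixes f :: "'b \<Rightarrow> real"
  assumes "finite (set_pmf P)" and "\<And>x. x \<in> set_pmf P \<Longrightarrow> finite (set_pmf (Q x))"
  shows "measure_pmf.expectation (bind_pmf P Q) f =
    measure_pmf.expectation P (\<lambda>x. measure_pmf.expectation (Q x) f)"
  using pmf_expectation_bind[of "set_pmf P" Q P f] assms
  by (simp add: integral_measure_pmf[of "set_pmf P"])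

lemma prob_bind_pmf_finite:
  assumes "finite (set_pmf P)"
  shows "measure_pmf.prob (bind_pmf P Q) A = measure_pmf.expectation P (\<lambda>x. measure_pmf.prob (Q x) A)"
proof -
  have "ennreal (measure_pmf.prob (bind_pmf P Q) A) = (\<integral>\<^sup>+x. emeasure (Q x) A \<partial>P)"
    by (simp add: measure_pmf.emeasure_eq_measure[symmetric])
  also have "\<dots> = (\<integral>\<^sup>+x. ennreal (measure_pmf.prob (Q x) A) \<partial>P)"
    by (simp add: measure_pmf.emeasure_eq_measure)
  also have "\<dots> = ennreal (measure_pmf.expectation P (\<lambda>x. measure_pmf.prob (Q x) A))"
    by (rule nn_integral_eq_integral) (auto intro: integrable_measure_pmf_finite assms)
  finally show ?thesis
    by (subst (asm) ennreal_inj) (auto intro: integral_nonneg_AE)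
qed

lemma expectation_mono_pmf:
  fixes f g :: "'a \<Rightarrow> real"
  assumes "finite (set_pmf P)" and "\<And>x. x \<in> set_pmf P \<Longrightarrow> f x \<le> g x"
  shows "measure_pmf.expectation P f \<le> measure_pmf.expectation P g"
  using assms by (intro integral_mono_AE) (auto intro: integrable_measure_pmf_finite simp: AE_measure_pmf_iff)

lemma expectation_affine_pmf:
  fixes f :: "'a \<Rightarrow> real"
  assumes "finite (set_pmf P)"
  shows "measure_pmf.expectation P (\<lambda>x. a * f x + b) = a * measure_pmf.expectation P f + b"
  using assms by (simp add: integrable_measure_pmf_finite)

text \<open>Optional stopping in disguise: the bound is proved by induction on the remaining time,
  and it is trivial as soon as the process has left \<open>alive\<close> or \<open>V\<close> has reached \<open>c\<close>.\<close>

lemma run_pmf_maximal_ineq: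
  fixes V :: "'s list \<Rightarrow> real"
  assumes fin: "\<And>x. finite (set_pmf (K x))"
    and inv: "I xs" "\<And>xs y. I xs \<Longrightarrow> y \<in> set_pmf (K (hd xs)) \<Longrightarrow> I (y # xs)"
    and nonneg: "\<And>xs. V xs \<ge> 0" "\<alpha> \<ge> 0" "\<beta> \<ge> 0" and c: "c > 0"
    and drift: "\<And>xs. I xs \<Longrightarrow> alive xs \<Longrightarrow>
      measure_pmf.expectation (K (hd xs)) (\<lambda>y. V (y # xs)) \<le> (1 + \<alpha>) * V xs + \<beta>"
  shows "measure_pmf.prob (run_pmf K r xs)
      {ys. \<exists>m\<le>r. V (drop m ys) \<ge> c \<and> (\<forall>k\<in>{m..r}. alive (drop k ys))}
    \<le> (1 + \<alpha>) ^ r * (V xs + real r * \<beta>) / c"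
  using inv(1)
proof (induction r arbitrary: xs)
  case 0
  show ?case using nonneg(1)[of xs] c by (auto simp: indicator_def)
next
  case (Suc r)
  \<comment> \<open>Indices count back from the end: \<open>drop m ys\<close> is the history after r
    - m steps, and k in {m..r} runs over it and its own past.\<close>
  let ?A = "\<lambda>r. {ys. \<exists>m\<le>r. V (drop m ys) \<ge> c \<and> (\<forall>k\<in>{m..r}. alive (drop k ys))}"
  let ?B = "\<lambda>r xs. (1 + \<alpha>) ^ r * (V xs + real r * \<beta>) / c"
  have B0: "?B (Suc r) xs \<ge> 0" using nonneg(1)[of xs] nonneg(2,3) c by simp
  consider "\<not> alive xs" | "alive xs" "V xs \<ge> c" | "alive xs" "V xs < c" by linarith
  then show ?case
  proof cases
    case 1
    have "measure_pmf.prob (run_pmf K (Suc r) xs) (?A (Suc r)) = 0"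
      using 1 drop_run_pmf[of _ K "Suc r" xs]
      by (subst measure_pmf_zero_iff) fastforce
    then show ?thesis using B0 by simp
  next
    case 2
    have "1 * c \<le> (1 + \<alpha>) ^ Suc r * (V xs + real (Suc r) * \<beta>)"
      using 2 nonneg c by (intro mult_mono one_le_power) (auto intro: add_increasing2)
    then have "1 \<le> ?B (Suc r) xs" using c by (simp add: field_simps)
    then show ?thesis using measure_pmf.prob_le_1 order_trans by blast
  next
    case 3
    have "measure_pmf.prob (run_pmf K (Suc r) xs) (?A (Suc r)) =
        measure_pmf.expectation (K (hd xs)) (\<lambda>y. measure_pmf.prob (run_pmf K r (y # xs)) (?A (Suc r)))"
      by (simp add: prob_bind_pmf_finite fin)
    also have "\<dots> \<le> measure_pmf.expectation (K (hd xs)) (\<lambda>y. ?B r (y # xs))"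
    proof (rule expectation_mono_pmf[OF fin])
      fix y assume y: "y \<in> set_pmf (K (hd xs))"
      have "measure_pmf.prob (run_pmf K r (y # xs)) (?A (Suc r)) \<le> measure_pmf.prob (run_pmf K r (y # xs)) (?A r)"
      proof (rule measure_pmf.finite_measure_mono_AE)
        show "AE ys in run_pmf K r (y # xs). ys \<in> ?A (Suc r) \<longrightarrow> ys \<in> ?A r"
          unfolding AE_measure_pmf_iff
        proof (intro ballI impI)
          fix ys assume "ys \<in> set_pmf (run_pmf K r (y # xs))" and "ys \<in> ?A (Suc r)"
          then obtain m where m: "m \<le> Suc r" "V (drop m ys) \<ge> c" "\<forall>k\<in>{m..Suc r}. alive (drop k ys)"
            and dr: "drop r ys = y # xs" using drop_run_pmf by blast
          have "drop (Suc r) ys = xs" by (metis dr drop_Suc list.sel(3) tl_drop)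
          with m(2) 3(2) have "m \<noteq> Suc r" by auto
          then have "m \<le> r" using m(1) by simp
          then show "ys \<in> ?A r" using m(2,3) by auto
        qed
      qed simp
      also have "\<dots> \<le> ?B r (y # xs)"
        using Suc.IH Suc.prems y inv(2) by blast
      finally show "measure_pmf.prob (run_pmf K r (y # xs)) (?A (Suc r)) \<le> ?B r (y # xs)" .
    qed
    also have "\<dots> = (1 + \<alpha>) ^ r / c * measure_pmf.expectation (K (hd xs)) (\<lambda>y. V (y # xs)) + (1 + \<alpha>) ^ r * real r * \<beta> / c"
      unfolding expectation_affine_pmf[OF fin, symmetric]
      by (simp add: add_divide_distrib distrib_left mult_ac)
    also have "\<dots> \<le> (1 + \<alpha>) ^ r / c * ((1 + \<alpha>) * V xs + \<beta>) + (1 + \<alpha>) ^ r * real r * \<beta> / c"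
      using drift[OF Suc.prems 3(1)] nonneg c by (intro add_mono mult_left_mono) auto
    also have "\<dots> = (1 + \<alpha>) ^ r * ((1 + \<alpha>) * V xs + real (Suc r) * \<beta>) / c"
      using c by (simp add: field_simps)
    also have "\<dots> \<le> ?B (Suc r) xs"
    proof -
      have "(1 + \<alpha>) * V xs + real (Suc r) * \<beta> \<le> (1 + \<alpha>) * (V xs + real (Suc r) * \<beta>)"
        using nonneg by (simp add: algebra_simps)
      then have "(1 + \<alpha>) ^ r * ((1 + \<alpha>) * V xs + real (Suc r) * \<beta>) \<le> (1 + \<alpha>) ^ r * ((1 + \<alpha>) * (V xs + real (Suc r) * \<beta>))"
        using nonneg by (intro mult_left_mono) auto
      then show ?thesis using c by (simp add: divide_right_mono mult_ac)
    qed
    finally show ?thesis .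
  qed
qed

text \<open>The potential plus the cost so far does not grow in mean, and the final potential is
  nonnegative. A state is charged when it is left; hence \<open>tl\<close>, which omits the newest
  state.\<close>

lemma run_pmf_potential:
  fixes L c :: "'s \<Rightarrow> real"
  assumes fin: "\<And>x. finite (set_pmf (K x))"
    and inv: "I xs" "\<And>xs y. I xs \<Longrightarrow> y \<in> set_pmf (K (hd xs)) \<Longrightarrow> I (y # xs)" "\<And>xs. I xs \<Longrightarrow> xs \<noteq> []"
    and L: "\<And>x. L x \<ge> 0"
    and drift: "\<And>xs. I xs \<Longrightarrow> measure_pmf.expectation (K (hd xs)) L \<le> L (hd xs) - c (hd xs)"
  shows "measure_pmf.expectation (run_pmf K r xs) (\<lambda>ys. \<Sum>x\<leftarrow>tl ys. c x) \<le> (\<Sum>x\<leftarrow>tl xs. c x) + L (hd xs)"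
  using inv(1)
proof (induction r arbitrary: xs)
  case 0
  show ?case by (simp add: L)
next
  case (Suc r)
  have "measure_pmf.expectation (run_pmf K (Suc r) xs) (\<lambda>ys. \<Sum>x\<leftarrow>tl ys. c x) =
     measure_pmf.expectation (K (hd xs)) (\<lambda>y. measure_pmf.expectation (run_pmf K r (y # xs)) (\<lambda>ys. \<Sum>x\<leftarrow>tl ys. c x))"
    by (simp add: expectation_bind_pmf_finite finite_set_run_pmf fin)
  also have "\<dots> \<le> measure_pmf.expectation (K (hd xs)) (\<lambda>y. 1 * L y + (\<Sum>x\<leftarrow>xs. c x))"
    by (rule expectation_mono_pmf[OF fin]) (use Suc.IH Suc.prems inv(2) in fastforce)
  also have "\<dots> = measure_pmf.expectation (K (hd xs)) L + (\<Sum>x\<leftarrow>xs. c x)"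
    by (subst expectation_affine_pmf[OF fin]) simp
  also have "\<dots> \<le> L (hd xs) - c (hd xs) + (\<Sum>x\<leftarrow>xs. c x)"
    using drift[OF Suc.prems] by simp
  also have "\<dots> = (\<Sum>x\<leftarrow>tl xs. c x) + L (hd xs)"
    using inv(3)[OF Suc.prems] by (cases xs) auto
  finally show ?case .
qed

lemma prob_le_expectation_pmf:
  fixes f :: "'a \<Rightarrow> real"
  assumes "finite (set_pmf P)" "c > 0" "\<And>x. x \<in> set_pmf P \<Longrightarrow> f x \<ge> 0"
  shows "measure_pmf.prob P {x. f x \<ge> c} \<le> measure_pmf.expectation P f / c"
proof -
  have "measure_pmf.prob P {x. f x \<ge> c} = measure_pmf.expectation P (indicator {x. f x \<ge> c})"
    by simp
  also have "\<dots> \<le> measure_pmf.expectation P (\<lambda>x. f x / c)"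
    using assms by (intro expectation_mono_pmf) (auto simp: indicator_def)
  also have "\<dots> = measure_pmf.expectation P f / c" by simp
  finally show ?thesis .
qed

section \<open>Transfer from an arbitrary realisation to the law of histories\<close>

definition hist :: "(nat \<Rightarrow> 's) \<Rightarrow> nat \<Rightarrow> 's list" where
  "hist s m = map s (rev [0..<Suc m])"

lemma hist_0 [simp]: "hist s 0 = [s 0]" by (simp add: hist_def)
lemma hist_Suc [simp]: "hist s (Suc m) = s (Suc m) # hist s m" by (simp add: hist_def)
lemma hd_hist [simp]: "hd (hist s m) = s m" by (cases m) auto
lemma length_hist [simp]: "length (hist s m) = Suc m" by (simp add: hist_def)
lemma hist_not_Nil [simp]: "hist s m \<noteq> []" by (simp add: hist_def)

lemma drop_hist: "m \<le> N \<Longrightarrow> drop (N - m) (hist s N) = hist s m"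
proof (induction N)
  case (Suc N)
  show ?case
  proof (cases "m = Suc N")
    case False
    then have "Suc N - m = Suc (N - m)" "m \<le> N" using Suc.prems by auto
    then show ?thesis using Suc.IH by simp
  qed simp
qed simp

lemma sum_list_tl_hist: "(\<Sum>x\<leftarrow>tl (hist s m). f x) = (\<Sum>k<m. f (s k))"
proof (induction m)
  case (Suc m)
  then show ?case by (cases m) (auto simp: add_ac)
qed simp

lemma hist_eq_iff: "hist s m = hist t m \<longleftrightarrow> (\<forall>i\<le>m. s i = t i)"
  by (auto simp: hist_def)

lemma list_eq_hist: "length xs = Suc m \<Longrightarrow> \<exists>s. xs = hist s m"
proof (induction m arbitrary: xs)
  case 0
  then show ?case by (auto simp: length_Suc_conv)
next
  case (Suc m)
  then obtain y ys where xs: "xs = y # ys" "length ys = Suc m" by (metis length_Suc_conv)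
  then obtain s where s: "ys = hist s m" using Suc.IH by blast
  have "hist (s(Suc m := y)) m = hist s m" by (simp add: hist_eq_iff)
  then have "xs = hist (s(Suc m := y)) (Suc m)" using xs s by simp
  then show ?case by blast
qed

text \<open>\<open>frozen_process\<close> prescribes the probabilities of cylinder events only.
  Finitely many of them, one per reachable history, carry all the mass, so they determine the law up
  to a null set. The set B is bounded through a measurable superset, so its own measurability is not
  at issue.\<close>

lemma frozen_process_prob_le:
  assumes fp: "frozen_process p n M F D" and fin: "\<And>x. finite (set_pmf (frozen_step p n x))"
    and sub: "B \<subseteq> {\<omega> \<in> space M. hist (\<lambda>i. (F i \<omega>, D i \<omega>)) N \<in> S}"
  shows "measure M B \<le> measure_pmf.prob (run_pmf (frozen_step p n) N [({#}, 0)]) S"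
proof -
  interpret prob_space M using fp by (simp add: frozen_process_def)
  have F [measurable]: "F m \<in> measurable M (count_space UNIV)"
    and D [measurable]: "D m \<in> measurable M (count_space UNIV)" for m
    using fp by (simp_all add: frozen_process_def)
  let ?X = "\<lambda>i \<omega>. (F i \<omega>, D i \<omega>)"
  let ?R = "\<lambda>N. run_pmf (frozen_step p n) N [({#}, 0)]"
  let ?h = "\<lambda>N xs. {\<omega> \<in> space M. hist (\<lambda>i. ?X i \<omega>) N = xs}"
  have meas: "?h N (hist s N) \<in> sets M" for s N
    unfolding hist_eq_iff prod_eq_iff fst_conv snd_conv by measurable
  have meas': "?h N xs \<in> sets M" for xs N
  proof (cases "length xs = Suc N")
    case True
    then show ?thesis using list_eq_hist meas by blast
  next
    case False
    then have e: "?h N xs = {}" by auto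
    show ?thesis unfolding e by simp
  qed
  have law: "prob (?h N (hist s N)) = pmf (?R N) (hist s N)" for s N
  proof (induction N)
    case 0
    have ae: "AE \<omega> in M. ?X 0 \<omega> = ({#}, 0)" using fp by (simp add: frozen_process_def)
    show ?case
    proof (cases "s 0 = ({#}, 0)")
      case True
      have "prob (?h 0 (hist s 0)) = 1"
        by (subst prob_Collect_eq_1) (use ae True meas[of 0 s] in auto)
      then show ?thesis using True by simp
    next
      case False
      have "prob (?h 0 (hist s 0)) = 0"
        by (subst prob_Collect_eq_0) (use ae False meas[of 0 s] in auto)
      then show ?thesis using False by simp
    qed
  next
    case (Suc N)
    have "prob (?h (Suc N) (hist s (Suc N))) = prob (?h N (hist s N)) * pmf (frozen_step p n (s N)) (s (Suc N))"
      using fp unfolding frozen_process_def hist_eq_iff by metis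
    also have "\<dots> = pmf (?R N) (hist s N) * pmf (frozen_step p n (s N)) (s (Suc N))"
      by (simp only: Suc.IH)
    also have "\<dots> = pmf (?R (Suc N)) (hist s (Suc N))"
    proof -
      have "pmf (map_pmf (\<lambda>y. y # ys) (frozen_step p n (hd ys))) (hist s (Suc N)) =
          indicator {hist s N} ys * pmf (frozen_step p n (s N)) (s (Suc N))" for ys
      proof (cases "ys = hist s N")
        case True
        then show ?thesis
          using pmf_map_inj'[of "\<lambda>y. y # ys" "frozen_step p n (hd ys)" "s (Suc N)"] by (simp add: inj_def)
      next
        case False
        then have "hist s (Suc N) \<notin> set_pmf (map_pmf (\<lambda>y. y # ys) (frozen_step p n (hd ys)))" by auto
        then show ?thesis using False by (simp add: pmf_eq_0_set_pmf)
      qed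
      then have "pmf (?R (Suc N)) (hist s (Suc N)) =
          measure_pmf.expectation (?R N) (\<lambda>ys. indicator {hist s N} ys * pmf (frozen_step p n (s N)) (s (Suc N)))"
        unfolding run_pmf_Suc_right pmf_bind by simp
      then show ?thesis by (simp add: pmf.rep_eq)
    qed
    finally show ?case .
  qed
  let ?W = "set_pmf (?R N)"
  have finW: "finite ?W" by (rule finite_set_run_pmf[OF fin])
  have un: "prob (\<Union>xs\<in>A. ?h N xs) = (\<Sum>xs\<in>A. pmf (?R N) xs)" if "A \<subseteq> ?W" for A
  proof -
    have "prob (\<Union>xs\<in>A. ?h N xs) = (\<Sum>xs\<in>A. prob (?h N xs))"
      using that finW meas' finite_subset by (intro finite_measure_finite_Union) (auto simp: disjoint_family_on_def)
    also have "\<dots> = (\<Sum>xs\<in>A. pmf (?R N) xs)"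
    proof (rule sum.cong[OF refl])
      fix xs assume "xs \<in> A"
      then have "length xs = Suc N" using that length_run_pmf by fastforce
      then show "prob (?h N xs) = pmf (?R N) xs" using list_eq_hist law by blast
    qed
    finally show ?thesis .
  qed
  have Wm: "(\<Union>xs\<in>A. ?h N xs) \<in> sets M" if "A \<subseteq> ?W" for A
    using that finW finite_subset by (intro sets.finite_UN meas') auto
  have "prob (\<Union>xs\<in>?W. ?h N xs) = 1" by (simp add: un sum_pmf_eq_1 finW)
  \<comment> \<open>The reachable histories have total mass 1, so what lies outside their cylinders
    is null.\<close>
  then have null: "prob (space M - (\<Union>xs\<in>?W. ?h N xs)) = 0" using prob_compl[OF Wm] by simp
  have "prob B \<le>
      prob ((\<Union>xs\<in>?W \<inter> S. ?h N xs) \<union> (space M - (\<Union>xs\<in>?W. ?h N xs)))"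
    using sub by (intro finite_measure_mono sets.Un Wm sets.compl_sets) auto
  also have "\<dots> \<le> prob (\<Union>xs\<in>?W \<inter> S. ?h N xs) + prob (space M - (\<Union>xs\<in>?W. ?h N xs))"
    by (intro measure_Un_le Wm sets.compl_sets) auto
  also have "\<dots> = (\<Sum>xs\<in>?W \<inter> S. pmf (?R N) xs)" by (simp only: un null Int_lower1)
  also have "\<dots> = measure_pmf.prob (?R N) (?W \<inter> S)"
    using finW by (simp add: measure_measure_pmf_finite)
  also have "\<dots> = measure_pmf.prob (?R N) S" by (simp add: Int_commute measure_Int_set_pmf)
  finally show ?thesis .
qed

section \<open>Components after adding an edge\<close>

lemma component_refl [simp, intro]: "v \<in> component E v"
  by (simp add: component_def)

lemma component_sym: "w \<in> component E v \<Longrightarrow> v \<in> component E w"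
proof -
  have "symp (adjacent E)" by (auto simp: symp_def adjacent_def)
  then show "w \<in> component E v \<Longrightarrow> v \<in> component E w"
    by (auto simp: component_def dest: symp_rtranclp sympD)
qed

lemma component_eq: "w \<in> component E v \<Longrightarrow> component E w = component E v"
  using component_sym[of w E v] by (auto simp: component_def dest: rtranclp_trans)

lemma component_disjoint: "w \<notin> component E v \<Longrightarrow> component E v \<inter> component E w = {}"
  using component_eq component_refl by blast

lemma adjacent_add_mset:
  "adjacent (add_mset (u, v) E) x y \<longleftrightarrow> adjacent E x y \<or> (x = u \<and> y = v) \<or> (x = v \<and> y = u)"
  by (auto simp: adjacent_def)

lemma component_add_edge:
  "component (add_mset (u, v) E) w =
     (if w \<in> component E u \<union> component E v then component E u \<union> component E v else component E w)"
proof -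
  let ?E = "add_mset (u, v) E"
  let ?U = "component E u \<union> component E v"
  have step: "adjacent E x y \<Longrightarrow> x \<in> component E w \<Longrightarrow> y \<in> component E w" for x y w
    by (auto simp: component_def intro: rtranclp.rtrancl_into_rtrancl)
  have mono: "component E x \<subseteq> component ?E x" for x
    unfolding component_def
    by (auto simp: adjacent_add_mset elim!: rtranclp_mono[THEN predicate2D, rotated])
  have uv: "component ?E u = component ?E v"
    by (rule component_eq) (auto simp: component_def adjacent_add_mset)
  show ?thesis
  proof (cases "w \<in> ?U")
    case True
    have "x \<in> ?U" if "(adjacent ?E)\<^sup>*\<^sup>* w x" for x
      using that by induction (use True in \<open>auto simp: adjacent_add_mset intro: step\<close>)
    moreover have "component ?E w = component ?E u"
      using True mono component_eq uv by blast
    then have "?U \<subseteq> component ?E w" using mono uv by blast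
    ultimately show ?thesis using True by (auto simp: component_def)
  next
    case False
    then have uvw: "u \<notin> component E w" "v \<notin> component E w" using component_sym by blast+
    have "x \<in> component E w" if "(adjacent ?E)\<^sup>*\<^sup>* w x" for x
      using that by induction (use uvw in \<open>auto simp: adjacent_add_mset intro: step\<close>)
    then show ?thesis using False mono by (auto simp: component_def)
  qed
qed

lemma component_empty: "component {#} v = {v}"
proof -
  have "(adjacent {#})\<^sup>*\<^sup>* v w \<Longrightarrow> w = v" for w
    by (induction rule: rtranclp_induct) (auto simp: adjacent_def)
  then show ?thesis by (auto simp: component_def)
qed

text \<open>An edge never leaves a component, so testing one endpoint decides; edge counts then
  split in the same way as components.\<close>

lemma component_edges_eq: "component_edges E v = {#e \<in># E. fst e \<in> component E v#}"
  unfolding component_edges_def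
proof (rule filter_mset_cong[OF refl])
  fix e assume e: "e \<in># E"
  then have "adjacent E (fst e) (snd e)" by (simp add: adjacent_def)
  then have "snd e \<in> component E (fst e)" by (auto simp: component_def)
  then show "fst e \<in> component E v \<and> snd e \<in> component E v \<longleftrightarrow> fst e \<in> component E v"
    using component_eq by blast
qed

lemma component_edges_add_edge:
  assumes "w \<notin> component E u \<union> component E v"
  shows "component_edges (add_mset (u, v) E) w = component_edges E w"
proof -
  have "u \<notin> component E w" using assms component_sym by blast
  then show ?thesis using assms by (simp add: component_edges_eq component_add_edge)
qed

lemma size_component_edges_add_edge:
  assumes "w \<in> component E u \<union> component E v"
  shows "size (component_edges (add_mset (u, v) E) w) =
    (if v \<in> component E u then size (component_edges E u) + 1
     else size (component_edges E u) + size (component_edges E v) + 1)"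
proof -
  have eq: "size (component_edges (add_mset (u, v) E) w) =
      size {#e \<in># E. fst e \<in> component E u \<union> component E v#} + 1"
    using assms by (simp add: component_edges_eq component_add_edge)
  show ?thesis
  proof (cases "v \<in> component E u")
    case True
    then show ?thesis using eq component_eq[OF True] by (simp add: component_edges_eq)
  next
    case False
    have "{#e \<in># E. fst e \<in> component E u \<union> component E v#} =
        {#e \<in># E. fst e \<in> component E u#} + {#e \<in># E. fst e \<in> component E v#}"
      using component_disjoint[OF False] by (intro multiset_eqI) (auto split: if_splits)
    then show ?thesis using eq False by (simp add: component_edges_eq)
  qed
qed

definition valid_graph :: "nat \<Rightarrow> mgraph \<Rightarrow> bool" where
  "valid_graph n E \<longleftrightarrow> set_mset E \<subseteq> possible_edges n \<and> (\<forall>v\<in>{1..n}. in_tree E v \<or> in_unicycle E v)"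

lemma component_subset:
  assumes "set_mset E \<subseteq> possible_edges n" and "v \<in> {1..n}"
  shows "component E v \<subseteq> {1..n}"
proof -
  have "w \<in> {1..n}" if "(adjacent E)\<^sup>*\<^sup>* v w" for w
    using that by induction (use assms in \<open>auto simp: adjacent_def possible_edges_def\<close>)
  then show ?thesis by (auto simp: component_def)
qed

lemma finite_component:
  assumes "set_mset E \<subseteq> possible_edges n" and "v \<in> {1..n}"
  shows "finite (component E v)"
  using component_subset[OF assms] finite_subset by blast

lemma in_tree_component: "w \<in> component E v \<Longrightarrow> in_tree E w = in_tree E v"
  by (simp add: in_tree_def component_edges_def component_eq)

lemma not_in_tree_and_unicycle: "in_tree E v \<Longrightarrow> \<not> in_unicycle E v"
  by (simp add: in_tree_def in_unicycle_def)

lemma valid_graph_empty: "valid_graph n {#}"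
  by (simp add: valid_graph_def in_tree_def component_edges_def component_empty)

locale new_edge =
  fixes n :: nat and E :: mgraph and u v :: nat
  assumes valid: "valid_graph n E" and edge: "(u, v) \<in> possible_edges n"
begin

lemma edges: "set_mset E \<subseteq> possible_edges n"
  using valid by (simp add: valid_graph_def)

lemma uv: "u \<in> {1..n}" "v \<in> {1..n}" "u \<noteq> v"
  using edge by (auto simp: possible_edges_def)

abbreviation "E' \<equiv> add_mset (u, v) E"
abbreviation "U \<equiv> component E u \<union> component E v"

lemma U_subset: "U \<subseteq> {1..n}"
  using component_subset[OF edges] uv by blast

lemma edges': "set_mset E' \<subseteq> possible_edges n"
  using edges edge by simp

lemma fin: "finite (component E u)" "finite (component E v)"
  using finite_component[OF edges] uv by blast+

lemma outside:
  assumes "w \<notin> U"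
  shows "component E' w = component E w" "in_tree E' w = in_tree E w" "in_unicycle E' w = in_unicycle E w"
  using assms by (simp_all add: in_tree_def in_unicycle_def component_add_edge component_edges_add_edge)

lemma inside:
  assumes "w \<in> U"
  shows "component E' w = U"
    "size (component_edges E' w) = (if v \<in> component E u then size (component_edges E u) + 1
     else size (component_edges E u) + size (component_edges E v) + 1)"
  using assms size_component_edges_add_edge by (simp_all add: component_add_edge)

lemma card_U: "card U = (if v \<in> component E u then card (component E u)
    else card (component E u) + card (component E v))"
  using component_eq[of v E u] card_Un_disjoint[OF fin component_disjoint[of v E u]] by auto

lemma inside_tree:
  assumes "w \<in> U" "in_tree E u" "in_tree E v"
  shows "in_tree E' w \<longleftrightarrow> v \<notin> component E u" "in_unicycle E' w \<longleftrightarrow> v \<in> component E u"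
  using inside[OF assms(1)] assms(2,3) card_U
  by (auto simp: in_tree_def in_unicycle_def)

lemma inside_mixed:
  assumes "w \<in> U" "in_tree E u \<noteq> in_tree E v" "in_unicycle E u \<noteq> in_unicycle E v"
  shows "\<not> in_tree E' w" "in_unicycle E' w"
proof -
  have "v \<notin> component E u" using assms(2) in_tree_component by blast
  then show "\<not> in_tree E' w" "in_unicycle E' w"
    using inside[OF assms(1)] assms(2,3) card_U
    by (auto simp: in_tree_def in_unicycle_def)
qed

lemma valid':
  assumes "in_tree E u \<and> in_tree E v \<or> in_tree E u \<noteq> in_tree E v \<and> in_unicycle E u \<noteq> in_unicycle E v"
  shows "valid_graph n E'"
  unfolding valid_graph_def
proof (intro conjI ballI edges')
  fix w assume w: "w \<in> {1..n}"
  show "in_tree E' w \<or> in_unicycle E' w"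
  proof (cases "w \<in> U")
    case True
    then show ?thesis using assms inside_tree inside_mixed by blast
  next
    case False
    then show ?thesis using valid w by (simp add: outside valid_graph_def)
  qed
qed

end

text \<open>The sum runs over vertices, so a tree of size k contributes k * \<phi> k: constant 1
  counts tree vertices, and 1 / k would count trees.\<close>

definition tree_sum :: "nat \<Rightarrow> (nat \<Rightarrow> real) \<Rightarrow> mgraph \<Rightarrow> real" where
  "tree_sum n \<phi> E = (\<Sum>v\<in>{1..n}. if in_tree E v then \<phi> (card (component E v)) else 0)"

definition tree_weight :: "(nat \<Rightarrow> real) \<Rightarrow> mgraph \<Rightarrow> nat \<Rightarrow> real" where
  "tree_weight \<phi> E v = (if in_tree E v then real (card (component E v)) * \<phi> (card (component E v)) else 0)"

lemma tree_sum_component: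
  "(\<Sum>w\<in>component E v. if in_tree E w then \<phi> (card (component E w)) else 0) = tree_weight \<phi> E v"
proof -
  have "(\<Sum>w\<in>component E v. if in_tree E w then \<phi> (card (component E w)) else 0) =
      (\<Sum>w\<in>component E v. if in_tree E v then \<phi> (card (component E v)) else 0)"
    by (rule sum.cong) (simp_all add: component_eq in_tree_component)
  then show ?thesis by (simp add: tree_weight_def)
qed

context new_edge
begin

lemma tree_sum_diff:
  "tree_sum n \<phi> E' - tree_sum n \<phi> E =
    (\<Sum>w\<in>U. if in_tree E' w then \<phi> (card (component E' w)) else 0) -
    (if v \<in> component E u then tree_weight \<phi> E u else tree_weight \<phi> E u + tree_weight \<phi> E v)"
proof -
  have split: "tree_sum n \<phi> G = (\<Sum>w\<in>{1..n} - U. if in_tree G w then \<phi> (card (component G w)) else 0)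
      + (\<Sum>w\<in>U. if in_tree G w then \<phi> (card (component G w)) else 0)" for G
    unfolding tree_sum_def by (rule sum.subset_diff[OF U_subset]) simp
  have out: "(\<Sum>w\<in>{1..n} - U. if in_tree E' w then \<phi> (card (component E' w)) else 0) =
      (\<Sum>w\<in>{1..n} - U. if in_tree E w then \<phi> (card (component E w)) else 0)"
    by (rule sum.cong) (simp_all add: outside)
  have ins: "(\<Sum>w\<in>U. if in_tree E w then \<phi> (card (component E w)) else 0) =
      (if v \<in> component E u then tree_weight \<phi> E u else tree_weight \<phi> E u + tree_weight \<phi> E v)"
  proof (cases "v \<in> component E u")
    case True
    then have "U = component E u" using component_eq by blast
    then show ?thesis using True by (simp add: tree_sum_component)
  next
    case False
    then show ?thesis
      by (simp add: sum.union_disjoint fin component_disjoint tree_sum_component)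
  qed
  show ?thesis unfolding split out ins by simp
qed

lemma tree_sum_add_edge_tree:
  assumes "in_tree E u" "in_tree E v"
  shows "tree_sum n \<phi> E' - tree_sum n \<phi> E =
    (if v \<in> component E u then - tree_weight \<phi> E u
     else real (card (component E u) + card (component E v)) * \<phi> (card (component E u) + card (component E v))
       - tree_weight \<phi> E u - tree_weight \<phi> E v)"
proof -
  have "(\<Sum>w\<in>U. if in_tree E' w then \<phi> (card (component E' w)) else 0) =
      (\<Sum>w\<in>U. if v \<notin> component E u then \<phi> (card U) else 0)"
    by (rule sum.cong) (simp_all add: inside_tree assms inside)
  then show ?thesis unfolding tree_sum_diff by (simp add: card_U)
qed

lemma tree_sum_add_edge_mixed:
  assumes "in_tree E u \<noteq> in_tree E v" "in_unicycle E u \<noteq> in_unicycle E v"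
  shows "tree_sum n \<phi> E' - tree_sum n \<phi> E = - tree_weight \<phi> E u - tree_weight \<phi> E v"
proof -
  have "v \<notin> component E u" using assms(1) in_tree_component by blast
  moreover have "(\<Sum>w\<in>U. if in_tree E' w then \<phi> (card (component E' w)) else 0) = 0"
    by (rule sum.neutral) (simp add: inside_mixed assms)
  ultimately show ?thesis unfolding tree_sum_diff by simp
qed

end

section \<open>One-step expectations\<close>

lemma finite_possible_edges: "finite (possible_edges n)"
  by (rule finite_subset[of _ "{1..n} \<times> {1..n}"]) (auto simp: possible_edges_def)

lemma sum_possible_edges:
  fixes f :: "nat \<Rightarrow> nat \<Rightarrow> real"
  assumes sym: "\<And>u v. f u v = f v u"
  shows "2 * (\<Sum>(u, v)\<in>possible_edges n. f u v) = (\<Sum>u\<in>{1..n}. \<Sum>v\<in>{1..n} - {u}. f u v)"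
proof -
  let ?P = "possible_edges n"
  have "(\<Sum>u\<in>{1..n}. \<Sum>v\<in>{1..n} - {u}. f u v) = (\<Sum>(u, v)\<in>(SIGMA u:{1..n}. {1..n} - {u}). f u v)"
    by (rule sum.Sigma) auto
  also have "(SIGMA u:{1..n}. {1..n} - {u}) = ?P \<union> prod.swap ` ?P"
    by (auto simp: possible_edges_def image_iff)
  also have "(\<Sum>(u, v)\<in>?P \<union> prod.swap ` ?P. f u v) = (\<Sum>(u, v)\<in>?P. f u v) + (\<Sum>(u, v)\<in>prod.swap ` ?P. f u v)"
    using finite_possible_edges[of n] by (intro sum.union_disjoint) (auto simp: possible_edges_def)
  also have "(\<Sum>(u, v)\<in>prod.swap ` ?P. f u v) = (\<Sum>(u, v)\<in>?P. f u v)"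
    by (subst sum.reindex) (auto simp: inj_on_def sym case_prod_beta intro!: sum.cong)
  finally show ?thesis by simp
qed

lemma sum_off_diagonal_const:
  "(\<Sum>u\<in>{1..n}. \<Sum>v\<in>{1..n} - {u}. c) = real n * (real n - 1) * (c::real)"
  by (cases n) (simp_all add: card_Diff_singleton)

lemma card_possible_edges: "2 * real (card (possible_edges n)) = real n * (real n - 1)"
  using sum_possible_edges[of "\<lambda>_ _. 1" n] sum_off_diagonal_const[of 1 n] by simp

lemma possible_edges_nonempty: "n \<ge> 2 \<Longrightarrow> possible_edges n \<noteq> {}"
proof -
  assume "n \<ge> 2"
  then have "(1, 2) \<in> possible_edges n" by (simp add: possible_edges_def)
  then show ?thesis by blast
qed

lemma update_tree: "in_tree E u \<Longrightarrow> in_tree E v \<Longrightarrow> update (E, d) ((u, v), b) = (add_mset (u, v) E, d)"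
  by (simp add: update_def)

lemma update_unicycle:
  "in_unicycle E u \<Longrightarrow> in_unicycle E v \<Longrightarrow> update (E, d) ((u, v), b) = (E, Suc d)"
  using not_in_tree_and_unicycle by (auto simp: update_def)

lemma update_mixed:
  assumes "in_tree E u \<noteq> in_tree E v" "in_unicycle E u \<noteq> in_unicycle E v"
  shows "update (E, d) ((u, v), b) = (if b then add_mset (u, v) E else E, if b then d else Suc d)"
  using assms by (auto simp: update_def)

locale frozen =
  fixes p :: real and n :: nat
  assumes p: "0 < p" "p \<le> 1" and n: "2 \<le> n"
begin

lemma finite_step: "finite (set_pmf (frozen_step p n x))"
  unfolding frozen_step_eq choice_pmf_def
  by (simp add: set_pair_pmf set_pmf_of_set possible_edges_nonempty n finite_possible_edges)

lemma step_cases: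
  assumes "y \<in> set_pmf (frozen_step p n x)"
  obtains u v b where "(u, v) \<in> possible_edges n" "y = update x ((u, v), b)"
  using assms unfolding frozen_step_eq choice_pmf_def
  by (auto simp: set_pmf_of_set possible_edges_nonempty n finite_possible_edges)

lemma expectation_step:
  fixes f :: "mgraph \<times> nat \<Rightarrow> real"
  shows "measure_pmf.expectation (frozen_step p n x) f =
    (\<Sum>(u, v)\<in>possible_edges n. p * f (update x ((u, v), True)) + (1 - p) * f (update x ((u, v), False)))
      / real (card (possible_edges n))"
proof -
  have "measure_pmf.expectation (frozen_step p n x) f =
      measure_pmf.expectation (pmf_of_set (possible_edges n))
        (\<lambda>e. measure_pmf.expectation (map_pmf (Pair e) (bernoulli_pmf p)) (\<lambda>c. f (update x c)))"
    unfolding frozen_step_eq choice_pmf_def pair_pmf_def map_pmf_def[symmetric] integral_map_pmf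
    by (subst expectation_bind_pmf_finite)
       (simp_all add: set_pmf_of_set possible_edges_nonempty n finite_possible_edges)
  also have "\<dots> = measure_pmf.expectation (pmf_of_set (possible_edges n))
        (\<lambda>e. p * f (update x (e, True)) + (1 - p) * f (update x (e, False)))"
    using p by (simp add: integral_bernoulli_pmf mult.commute)
  also have "\<dots> = (\<Sum>e\<in>possible_edges n. p * f (update x (e, True)) + (1 - p) * f (update x (e, False)))
      / real (card (possible_edges n))"
    by (rule integral_pmf_of_set) (simp_all add: possible_edges_nonempty n finite_possible_edges)
  finally show ?thesis by (simp add: case_prod_unfold)
qed

lemma pairs_pos: "real n * (real n - 1) > 0"
  using n by simp

text \<open>Symmetry turns the uniform unordered edge into a sum over ordered pairs, which factors
  into sums over vertices.\<close>

lemma expectation_step_le: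
  fixes f :: "mgraph \<times> nat \<Rightarrow> real"
  assumes "\<And>u v. m u v = m v u"
    and "\<And>u v. (u, v) \<in> possible_edges n \<Longrightarrow>
      p * f (update x ((u, v), True)) + (1 - p) * f (update x ((u, v), False)) \<le> c + m u v"
  shows "measure_pmf.expectation (frozen_step p n x) f \<le>
    c + (\<Sum>u\<in>{1..n}. \<Sum>v\<in>{1..n} - {u}. m u v) / (real n * (real n - 1))"
proof -
  have "measure_pmf.expectation (frozen_step p n x) f \<le>
      (\<Sum>(u, v)\<in>possible_edges n. c + m u v) / real (card (possible_edges n))"
    unfolding expectation_step using assms(2) by (intro divide_right_mono sum_mono) auto
  also have "\<dots> = (2 * (\<Sum>(u, v)\<in>possible_edges n. c + m u v)) / (real n * (real n - 1))"
    unfolding card_possible_edges[symmetric] by simp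
  also have "2 * (\<Sum>(u, v)\<in>possible_edges n. c + m u v) = (\<Sum>u\<in>{1..n}. \<Sum>v\<in>{1..n} - {u}. c + m u v)"
    using assms(1) by (intro sum_possible_edges) simp
  also have "\<dots> = real n * (real n - 1) * c + (\<Sum>u\<in>{1..n}. \<Sum>v\<in>{1..n} - {u}. m u v)"
    unfolding sum.distrib sum_off_diagonal_const ..
  finally show ?thesis using n by (simp add: add_divide_distrib)
qed

lemma expectation_step_eq:
  fixes f :: "mgraph \<times> nat \<Rightarrow> real"
  assumes "\<And>u v. m u v = m v u"
    and eq: "\<And>u v. (u, v) \<in> possible_edges n \<Longrightarrow>
      p * f (update x ((u, v), True)) + (1 - p) * f (update x ((u, v), False)) = c + m u v"
  shows "measure_pmf.expectation (frozen_step p n x) f =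
    c + (\<Sum>u\<in>{1..n}. \<Sum>v\<in>{1..n} - {u}. m u v) / (real n * (real n - 1))"
proof (rule antisym)
  show "measure_pmf.expectation (frozen_step p n x) f \<le>
    c + (\<Sum>u\<in>{1..n}. \<Sum>v\<in>{1..n} - {u}. m u v) / (real n * (real n - 1))"
    by (rule expectation_step_le) (simp_all add: assms)
  have "measure_pmf.expectation (frozen_step p n x) (\<lambda>y. - f y) \<le>
    - c + (\<Sum>u\<in>{1..n}. \<Sum>v\<in>{1..n} - {u}. - m u v) / (real n * (real n - 1))"
    by (rule expectation_step_le) (use eq in \<open>fastforce simp: assms(1)\<close>)+
  then show "c + (\<Sum>u\<in>{1..n}. \<Sum>v\<in>{1..n} - {u}. m u v) / (real n * (real n - 1)) \<le>
    measure_pmf.expectation (frozen_step p n x) f"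
    by (simp add: sum_negf)
qed

text \<open>The change of \<open>tree_sum n \<phi>\<close> when the edge between \<open>u\<close> and \<open>v\<close> is selected, averaged over the
  coin that decides whether an edge between a tree and a unicycle is kept.\<close>

definition mean_change :: "(nat \<Rightarrow> real) \<Rightarrow> mgraph \<Rightarrow> nat \<Rightarrow> nat \<Rightarrow> real" where
  "mean_change \<phi> E u v =
    (if in_tree E u \<and> in_tree E v then
       if v \<in> component E u then - tree_weight \<phi> E u
       else real (card (component E u) + card (component E v)) * \<phi> (card (component E u) + card (component E v))
         - tree_weight \<phi> E u - tree_weight \<phi> E v
     else if in_tree E u \<or> in_tree E v then - p * (tree_weight \<phi> E u + tree_weight \<phi> E v)
     else 0)"

lemma tree_weight_component: "v \<in> component E u \<Longrightarrow> tree_weight \<phi> E v = tree_weight \<phi> E u"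
  by (simp add: tree_weight_def in_tree_component component_eq)

lemma mean_change_sym: "mean_change \<phi> E u v = mean_change \<phi> E v u"
  using component_sym[of u E v] component_sym[of v E u] tree_weight_component[of v E u \<phi>]
  by (auto simp: mean_change_def add.commute)

lemma edge_cases [consumes 2, case_names tree unicycle mixed]:
  assumes "valid_graph n E" "(u, v) \<in> possible_edges n"
  obtains "in_tree E u" "in_tree E v"
    | "in_unicycle E u" "in_unicycle E v" "\<not> in_tree E u" "\<not> in_tree E v"
    | "in_tree E u \<noteq> in_tree E v" "in_unicycle E u \<noteq> in_unicycle E v"
proof -
  interpret new_edge n E u v using assms by unfold_locales
  have "in_tree E u \<or> in_unicycle E u" "in_tree E v \<or> in_unicycle E v"
    using valid uv by (auto simp: valid_graph_def)
  then show ?thesis using that not_in_tree_and_unicycle by metis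
qed

lemma valid_step:
  assumes "valid_graph n (fst x)" "y \<in> set_pmf (frozen_step p n x)"
  shows "valid_graph n (fst y)"
proof -
  obtain E d where x: "x = (E, d)" by (cases x)
  obtain u v b where e: "(u, v) \<in> possible_edges n" "y = update x ((u, v), b)"
    using assms(2) by (rule step_cases)
  interpret new_edge n E u v using assms e x by unfold_locales simp_all
  from valid edge show ?thesis
    by (cases rule: edge_cases)
       (use valid valid' in \<open>auto simp: e x update_tree update_unicycle update_mixed\<close>)
qed

lemma mean_tree_sum_step:
  assumes "valid_graph n E" "(u, v) \<in> possible_edges n"
  shows "p * tree_sum n \<phi> (fst (update (E, d) ((u, v), True))) + (1 - p) * tree_sum n \<phi> (fst (update (E, d) ((u, v), False)))
    = tree_sum n \<phi> E + mean_change \<phi> E u v"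
proof -
  interpret new_edge n E u v using assms by unfold_locales
  from assms show ?thesis
  proof (cases rule: edge_cases)
    case tree
    then show ?thesis using tree_sum_add_edge_tree[OF tree, of \<phi>]
      by (simp add: update_tree mean_change_def algebra_simps)
  next
    case unicycle
    then show ?thesis by (simp add: update_unicycle mean_change_def algebra_simps)
  next
    case mixed
    then have eq: "tree_sum n \<phi> E' = tree_sum n \<phi> E - tree_weight \<phi> E u - tree_weight \<phi> E v"
      using tree_sum_add_edge_mixed[OF mixed, of \<phi>] by simp
    then show ?thesis using mixed by (auto simp: update_mixed mean_change_def eq algebra_simps)
  qed
qed

lemma expectation_tree_sum_step:
  assumes "valid_graph n (fst x)"
  shows "measure_pmf.expectation (frozen_step p n x) (\<lambda>y. tree_sum n \<phi> (fst y)) =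
    tree_sum n \<phi> (fst x) + (\<Sum>u\<in>{1..n}. \<Sum>v\<in>{1..n} - {u}. mean_change \<phi> (fst x) u v) / (real n * (real n - 1))"
proof -
  obtain E d where x: "x = (E, d)" by (cases x)
  show ?thesis
    unfolding x fst_conv
    by (rule expectation_step_eq[OF mean_change_sym mean_tree_sum_step]) (use assms x in simp_all)
qed

lemma tree_sum_step_bound:
  assumes valid: "valid_graph n (fst x)" and y: "y \<in> set_pmf (frozen_step p n x)"
    and B: "\<And>k. 0 \<le> real k * \<phi> k" "\<And>k. real k * \<phi> k \<le> B"
  shows "\<bar>tree_sum n \<phi> (fst y) - tree_sum n \<phi> (fst x)\<bar> \<le> 2 * B"
proof -
  obtain E d where x: "x = (E, d)" by (cases x)
  obtain u v b where e: "(u, v) \<in> possible_edges n" "y = update x ((u, v), b)"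
    using y by (rule step_cases)
  interpret new_edge n E u v using valid e x by unfold_locales simp_all
  have w: "0 \<le> tree_weight \<phi> E w" "tree_weight \<phi> E w \<le> B" for w
    using B[of "card (component E w)"] B[of 0] by (auto simp: tree_weight_def)
  note w = w[of u] w[of v] B[of "card (component E u) + card (component E v)"]
  from new_edge.valid[OF new_edge_axioms] edge show ?thesis
  proof (cases rule: edge_cases)
    case tree
    then show ?thesis using tree_sum_add_edge_tree[OF tree, of \<phi>] w
      by (simp add: e x update_tree split: if_splits)
  next
    case unicycle
    then show ?thesis using w by (simp add: e x update_unicycle)
  next
    case mixed
    then show ?thesis using tree_sum_add_edge_mixed[OF mixed, of \<phi>] w
      by (auto simp: e x update_mixed)
  qed
qed

lemma tree_sum_step_le:
  assumes valid: "valid_graph n (fst x)" and y: "y \<in> set_pmf (frozen_step p n x)"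
  shows "tree_sum n (\<lambda>_. 1) (fst y) \<le> tree_sum n (\<lambda>_. 1) (fst x)"
proof -
  obtain E d where x: "x = (E, d)" by (cases x)
  obtain u v b where e: "(u, v) \<in> possible_edges n" "y = update x ((u, v), b)"
    using y by (rule step_cases)
  interpret new_edge n E u v using valid e x by unfold_locales simp_all
  have w: "0 \<le> tree_weight (\<lambda>_. 1) E w" for w by (simp add: tree_weight_def)
  note w = w[of u] w[of v]
  from new_edge.valid[OF new_edge_axioms] edge show ?thesis
  proof (cases rule: edge_cases)
    case tree
    then show ?thesis using tree_sum_add_edge_tree[OF tree, of "\<lambda>_. 1"] w
      by (simp add: e x update_tree tree_weight_def split: if_splits)
  next
    case unicycle
    then show ?thesis by (simp add: e x update_unicycle)
  next
    case mixed
    then show ?thesis using tree_sum_add_edge_mixed[OF mixed, of "\<lambda>_. 1"] w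
      by (auto simp: e x update_mixed)
  qed
qed

text \<open>In a step that joins two trees with at least \<open>K\<close> vertices, or closes a cycle in such a
  tree, this sum decreases by one; hence few such edges are ever selected.\<close>

definition big_potential :: "nat \<Rightarrow> mgraph \<Rightarrow> real" where
  "big_potential K E = tree_sum n (\<lambda>k. 1 / real (max k K)) E"

definition big_mass :: "nat \<Rightarrow> mgraph \<Rightarrow> real" where
  "big_mass K E = tree_sum n (\<lambda>k. if k \<ge> K then 1 else 0) E"

text \<open>A tree of size k contributes min 1 (k / K), which is subadditive in k, so no edge raises
  the potential. A selected edge with both ends in large trees costs one unit, whether it merges two
  trees or closes a cycle. The \<open>- 1\<close> accounts for pairs with equal endpoints.\<close>

lemma big_potential_drift:
  assumes valid: "valid_graph n (fst x)" and K: "K \<ge> 1"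
  shows "measure_pmf.expectation (frozen_step p n x) (\<lambda>y. big_potential K (fst y)) \<le>
    big_potential K (fst x) - big_mass K (fst x) * (big_mass K (fst x) - 1) / (real n * (real n - 1))"
proof -
  let ?E = "fst x" and ?V = "{1..n}"
  let ?\<phi> = "\<lambda>k. 1 / real (max k K)"
  define b where "b v = (if in_tree ?E v \<and> K \<le> card (component ?E v) then 1 else 0 :: real)" for v
  have small: "real k * ?\<phi> k = (if K \<le> k then 1 else real k / real K)" for k
    using K by (auto simp: max_def)
  have w: "tree_weight ?\<phi> ?E v = (if in_tree ?E v then if K \<le> card (component ?E v) then 1 else real (card (component ?E v)) / real K else 0)" for v
    unfolding tree_weight_def small by simp
  have le: "mean_change ?\<phi> ?E u v \<le> - (b u * b v)" for u v
  proof -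
    let ?i = "card (component ?E u)" and ?j = "card (component ?E v)"
    have merge: "real (?i + ?j) * ?\<phi> (?i + ?j) - tree_weight ?\<phi> ?E u - tree_weight ?\<phi> ?E v \<le> - (b u * b v)"
      if "in_tree ?E u" "in_tree ?E v"
      unfolding small w b_def using that K by (auto simp: divide_simps)
    have "0 \<le> tree_weight ?\<phi> ?E u" "0 \<le> tree_weight ?\<phi> ?E v" unfolding w by auto
    then have mixed: "- p * (tree_weight ?\<phi> ?E u + tree_weight ?\<phi> ?E v) \<le> 0" using p by simp
    have same: "- tree_weight ?\<phi> ?E u \<le> - (b u * b v)" unfolding w b_def by auto
    show ?thesis using merge mixed same by (auto simp: mean_change_def b_def split del: if_split split: if_split)
  qed
  have b2: "b u * b u = b u" for u by (simp add: b_def)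
  have bm: "big_mass K ?E = (\<Sum>v\<in>?V. b v)"
    unfolding big_mass_def tree_sum_def b_def by (rule sum.cong) auto
  have "(\<Sum>u\<in>?V. \<Sum>v\<in>?V - {u}. mean_change ?\<phi> ?E u v) \<le> (\<Sum>u\<in>?V. \<Sum>v\<in>?V - {u}. - (b u * b v))"
    by (intro sum_mono le)
  also have "\<dots> = (\<Sum>u\<in>?V. b u - b u * big_mass K ?E)"
    unfolding bm by (intro sum.cong refl) (simp add: sum_diff1 sum_negf sum_distrib_left[symmetric] b2 right_diff_distrib)
  also have "\<dots> = - (big_mass K ?E * (big_mass K ?E - 1))"
    unfolding sum_subtractf sum_distrib_right[symmetric] bm by (simp add: algebra_simps)
  finally have "(\<Sum>u\<in>?V. \<Sum>v\<in>?V - {u}. mean_change ?\<phi> ?E u v) / (real n * (real n - 1)) \<le>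
      - (big_mass K ?E * (big_mass K ?E - 1)) / (real n * (real n - 1))"
    using pairs_pos by (intro divide_right_mono) auto
  then show ?thesis unfolding big_potential_def expectation_tree_sum_step[OF valid] by simp
qed

section \<open>The compensator of the number of discarded edges\<close>

definition trees :: "mgraph \<Rightarrow> real" where
  "trees E = tree_sum n (\<lambda>_. 1) E"

text \<open>The exact discard probability of the next step; the last subtraction removes the
  diagonal pairs of frozen vertices.\<close>

definition discard_rate :: "mgraph \<Rightarrow> real" where
  "discard_rate E = ((real n - trees E)\<^sup>2 + 2 * (1 - p) * trees E * (real n - trees E) - (real n - trees E))
     / (real n * (real n - 1))"

lemma expectation_discarded_step:
  assumes valid: "valid_graph n (fst x)"
  shows "measure_pmf.expectation (frozen_step p n x) (\<lambda>y. real (snd y)) = real (snd x) + discard_rate (fst x)"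
proof -
  obtain E d where x: "x = (E, d)" by (cases x)
  let ?V = "{1..n}"
  define \<tau> where "\<tau> v = (if in_tree E v then 1 else 0 :: real)" for v
  define m where "m u v = (1 - \<tau> u) * (1 - \<tau> v) + (1 - p) * (\<tau> u * (1 - \<tau> v) + (1 - \<tau> u) * \<tau> v)" for u v
  have tau: "trees E = (\<Sum>v\<in>?V. \<tau> v)" by (simp add: trees_def tree_sum_def \<tau>_def)
  have diag: "m u u = 1 - \<tau> u" for u by (simp add: m_def \<tau>_def)
  have row: "(\<Sum>v\<in>?V. m u v) = (1 - \<tau> u) * (real n - trees E) + (1 - p) * (\<tau> u * (real n - trees E) + (1 - \<tau> u) * trees E)" for u
    unfolding m_def tau sum.distrib sum_distrib_left[symmetric] by (simp add: sum_subtractf)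
  have "measure_pmf.expectation (frozen_step p n x) (\<lambda>y. real (snd y)) =
      real d + (\<Sum>u\<in>?V. \<Sum>v\<in>?V - {u}. m u v) / (real n * (real n - 1))"
  proof (rule expectation_step_eq)
    show "m u v = m v u" for u v by (simp add: m_def algebra_simps)
    fix u v assume e: "(u, v) \<in> possible_edges n"
    have "valid_graph n E" using valid x by simp
    then show "p * real (snd (update x ((u, v), True))) + (1 - p) * real (snd (update x ((u, v), False))) = real d + m u v"
      using e
      by (cases rule: edge_cases)
         (auto simp: x update_tree update_unicycle update_mixed m_def \<tau>_def algebra_simps)
  qed
  also have "(\<Sum>u\<in>?V. \<Sum>v\<in>?V - {u}. m u v) = (\<Sum>u\<in>?V. (\<Sum>v\<in>?V. m u v) - (1 - \<tau> u))"
    by (intro sum.cong refl) (simp add: sum_diff1 diag)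
  also have "\<dots> = (real n - trees E)\<^sup>2 + 2 * (1 - p) * trees E * (real n - trees E) - (real n - trees E)"
    unfolding row sum_subtractf sum.distrib sum_distrib_left[symmetric] sum_distrib_right[symmetric] tau
    by (simp add: power2_eq_square algebra_simps)
  finally show ?thesis by (simp add: x discard_rate_def)
qed

end

section \<open>The generating function along a characteristic\<close>

text \<open>The variance is at most the mean square deviation from any constant c, hence at most
  b^2.\<close>

lemma expectation_square_le:
  fixes f :: "'a \<Rightarrow> real"
  assumes fin: "finite (set_pmf P)" and b: "\<And>y. y \<in> set_pmf P \<Longrightarrow> \<bar>f y - c\<bar> \<le> b"
  shows "measure_pmf.expectation P (\<lambda>y. (f y)\<^sup>2) \<le> (measure_pmf.expectation P f)\<^sup>2 + b\<^sup>2"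
proof -
  let ?m = "measure_pmf.expectation P f"
  have "measure_pmf.expectation P (\<lambda>y. (f y)\<^sup>2) \<le> measure_pmf.expectation P (\<lambda>y. 2 * c * f y + (b\<^sup>2 - c\<^sup>2))"
  proof (rule expectation_mono_pmf[OF fin])
    fix y assume "y \<in> set_pmf P"
    then have "(f y - c)\<^sup>2 \<le> b\<^sup>2" using b abs_le_square_iff by (metis abs_ge_zero abs_of_nonneg order_trans power2_abs power_mono)
    then show "(f y)\<^sup>2 \<le> 2 * c * f y + (b\<^sup>2 - c\<^sup>2)" by (simp add: power2_diff algebra_simps)
  qed
  also have "\<dots> = 2 * c * ?m + (b\<^sup>2 - c\<^sup>2)" by (rule expectation_affine_pmf[OF fin])
  also have "\<dots> = ?m\<^sup>2 + b\<^sup>2 - (c - ?m)\<^sup>2" by (simp add: power2_diff)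
  finally show ?thesis using zero_le_power2[of "c - ?m"] by linarith
qed

text \<open>Here m is the mean of the next deviation, W the present one and s = 1 / n. Since the
  drift is proportional to W, squaring yields a factor 1 + O(s) and an error O(s^2), harmless over
  O(1 / s) steps.\<close>

lemma square_recursion:
  fixes B s R W m :: real
  assumes B: "1 \<le> B" and s: "0 \<le> s" "s \<le> 1" and R: "0 \<le> R" "R \<le> B" and W: "\<bar>W\<bar> \<le> 1"
    and m: "\<bar>m - W * (1 + 2 * s * R)\<bar> \<le> 18 * B\<^sup>2 * s\<^sup>2"
  shows "m\<^sup>2 \<le> (1 + 8 * B\<^sup>2 * s) * W\<^sup>2 + 432 * B ^ 4 * s\<^sup>2"
proof -
  define e where "e = m - W * (1 + 2 * s * R)"
  have e: "\<bar>e\<bar> \<le> 18 * B\<^sup>2 * s\<^sup>2" using m by (simp add: e_def)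
  have B2: "B \<le> B\<^sup>2" "B\<^sup>2 \<le> B ^ 4" "1 \<le> B\<^sup>2" using B by (auto simp: power2_eq_square power4_eq_xxxx intro!: mult_mono order_trans[OF B])
  have s2: "s\<^sup>2 \<le> s" "s\<^sup>2 \<le> 1" using s by (auto simp: power2_eq_square mult_left_le mult_le_one)
  have sR: "0 \<le> s * R" "s * R \<le> s * B" "s * R \<le> B" using s R mult_mono[of s 1 R B] by (auto intro: mult_left_mono)
  have "(s * R)\<^sup>2 \<le> (s * B)\<^sup>2" using sR by (intro power_mono) auto
  also have "\<dots> = s\<^sup>2 * B\<^sup>2" by (simp add: power_mult_distrib)
  also have "\<dots> \<le> s * B\<^sup>2" using s2 by (intro mult_right_mono) auto
  finally have 1: "(s * R)\<^sup>2 \<le> s * B\<^sup>2" .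
  have "s * R \<le> s * B\<^sup>2" using sR mult_left_mono[OF B2(1) s(1)] by simp
  then have "(1 + 2 * s * R)\<^sup>2 \<le> 1 + 8 * B\<^sup>2 * s" using 1 by (simp add: power2_sum power_mult_distrib algebra_simps)
  then have "W\<^sup>2 * (1 + 2 * s * R)\<^sup>2 \<le> W\<^sup>2 * (1 + 8 * B\<^sup>2 * s)" by (rule mult_left_mono) simp
  then have a: "(W * (1 + 2 * s * R))\<^sup>2 \<le> (1 + 8 * B\<^sup>2 * s) * W\<^sup>2"
    by (simp only: power_mult_distrib mult.commute[of "1 + 8 * B\<^sup>2 * s"])
  have "\<bar>W * (1 + 2 * s * R)\<bar> \<le> 1 * (3 * B)"
    unfolding abs_mult using W sR B by (intro mult_mono) (auto simp: abs_of_nonneg)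
  then have "\<bar>W * (1 + 2 * s * R)\<bar> * \<bar>e\<bar> \<le> (3 * B) * (18 * B\<^sup>2 * s\<^sup>2)" using e B by (intro mult_mono) auto
  also have "\<dots> = 54 * (B ^ 3 * s\<^sup>2)" by (simp add: power3_eq_cube power2_eq_square)
  also have "\<dots> \<le> 54 * (B ^ 4 * s\<^sup>2)" using B by (intro mult_left_mono mult_right_mono power_increasing) auto
  finally have b': "\<bar>W * (1 + 2 * s * R)\<bar> * \<bar>e\<bar> \<le> 54 * (B ^ 4 * s\<^sup>2)" .
  have "W * (1 + 2 * s * R) * e \<le> \<bar>W * (1 + 2 * s * R)\<bar> * \<bar>e\<bar>" by (metis abs_ge_self abs_mult)
  then have b: "2 * (W * (1 + 2 * s * R) * e) \<le> 108 * (B ^ 4 * s\<^sup>2)" using b' by linarith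
  have "e\<^sup>2 \<le> (18 * B\<^sup>2 * s\<^sup>2)\<^sup>2" using e by (metis abs_ge_zero power2_abs power_mono)
  also have "\<dots> = 324 * (B ^ 4 * (s\<^sup>2 * s\<^sup>2))" by (simp add: power2_eq_square power4_eq_xxxx)
  also have "\<dots> \<le> 324 * (B ^ 4 * (s\<^sup>2 * 1))" using s2 B by (intro mult_left_mono) auto
  finally have c: "e\<^sup>2 \<le> 324 * (B ^ 4 * s\<^sup>2)" by simp
  have "m\<^sup>2 = (W * (1 + 2 * s * R))\<^sup>2 + 2 * (W * (1 + 2 * s * R) * e) + e\<^sup>2"
    unfolding e_def by (simp add: power2_eq_square algebra_simps)
  then show ?thesis using a b c by linarith
qed

lemma exp_taylor2: "\<bar>exp y - 1 - y\<bar> \<le> exp \<bar>y\<bar> * y\<^sup>2 / 2" for y :: real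
proof -
  obtain t where t: "\<bar>t\<bar> \<le> \<bar>y\<bar>" "exp y = (\<Sum>m<2. y ^ m / fact m) + exp t / fact 2 * y ^ 2"
    using Maclaurin_exp_le[of y 2] by blast
  have "\<bar>exp y - 1 - y\<bar> = exp t * y\<^sup>2 / 2" using t(2) by (simp add: numeral_2_eq_2 abs_mult)
  also have "\<dots> \<le> exp \<bar>y\<bar> * y\<^sup>2 / 2" using t(1) by (intro divide_right_mono mult_right_mono) auto
  finally show ?thesis .
qed

text \<open>With x = k * \<delta> / 2 the constant comes from exp x >= x^2 / 2. The threshold is -
  \<delta> / 2, not - \<delta>, because one step may move l slightly above - \<delta>.\<close>

lemma square_exp_bound:
  assumes "0 < \<delta>" "l \<le> - \<delta> / 2"
  shows "(real k)\<^sup>2 * exp (real k * l) \<le> 8 / \<delta>\<^sup>2"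
proof -
  define x where "x = real k * \<delta> / 2"
  have x: "0 \<le> x" using assms by (simp add: x_def)
  have "x\<^sup>2 / 2 \<le> exp x" using exp_lower_Taylor_quadratic[OF x] x by linarith
  then have "x\<^sup>2 / 2 * exp (- x) \<le> 1" by (simp add: exp_minus field_simps)
  moreover have "(real k)\<^sup>2 * exp (- x) = 8 / \<delta>\<^sup>2 * (x\<^sup>2 / 2 * exp (- x))"
    using assms by (simp add: x_def field_simps power2_eq_square)
  moreover have "8 / \<delta>\<^sup>2 * (x\<^sup>2 / 2 * exp (- x)) \<le> 8 / \<delta>\<^sup>2 * 1"
    using calculation(1) by (intro mult_left_mono) auto
  moreover have "exp (real k * l) \<le> exp (- x)"
    using mult_left_mono[OF assms(2), of "real k"] by (simp add: x_def)
  then have "(real k)\<^sup>2 * exp (real k * l) \<le> (real k)\<^sup>2 * exp (- x)" by (intro mult_left_mono) auto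
  ultimately show ?thesis by simp
qed

context frozen
begin

section \<open>The generating function of the tree sizes at z = exp l\<close>

abbreviation expo :: "real \<Rightarrow> nat \<Rightarrow> real" where "expo l \<equiv> \<lambda>k. exp (real k * l)"

definition expo_mass :: "real \<Rightarrow> mgraph \<Rightarrow> real" where
  "expo_mass l E = tree_sum n (expo l) E / real n"

text \<open>The derivative of \<open>expo_mass\<close> in l: \<open>tree_weight\<close> contributes
  the factor k.\<close>

definition expo_mass' :: "real \<Rightarrow> mgraph \<Rightarrow> real" where
  "expo_mass' l E = (\<Sum>v\<in>{1..n}. tree_weight (expo l) E v) / real n"

text \<open>The chance h + p * (1 - h) that an edge from a tree vertex to a uniformly chosen vertex
  is kept.\<close>

definition survival :: "mgraph \<Rightarrow> real" where
  "survival E = 1 - (1 - p) * (1 - trees E / real n)"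

lemma trees_range: "0 \<le> trees E" "trees E \<le> real n"
proof -
  have "trees E \<le> (\<Sum>v\<in>{1..n}. 1)" unfolding trees_def tree_sum_def by (intro sum_mono) auto
  then show "trees E \<le> real n" by simp
  show "0 \<le> trees E" unfolding trees_def tree_sum_def by (intro sum_nonneg) auto
qed

lemma survival_range: "0 \<le> survival E" "survival E \<le> 1"
proof -
  have f: "0 \<le> 1 - trees E / real n" "1 - trees E / real n \<le> 1" using trees_range[of E] n by (auto simp: divide_le_eq)
  show "survival E \<le> 1" using f p by (simp add: survival_def)
  have "(1 - p) * (1 - trees E / real n) \<le> 1 * 1" using f p by (intro mult_mono) auto
  then show "0 \<le> survival E" by (simp add: survival_def)
qed

lemma expo_mass_range: "l \<le> 0 \<Longrightarrow> 0 \<le> expo_mass l E \<and> expo_mass l E \<le> trees E / real n"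
proof -
  assume "l \<le> 0"
  then have "tree_sum n (expo l) E \<le> trees E"
    unfolding trees_def tree_sum_def by (intro sum_mono) (auto simp: mult_nonneg_nonpos)
  moreover have "0 \<le> tree_sum n (expo l) E" unfolding tree_sum_def by (intro sum_nonneg) auto
  ultimately show ?thesis by (simp add: expo_mass_def divide_right_mono)
qed

text \<open>For vertices in different components the mean change is exactly
  \<open>k u * r v + r u * k v\<close>, so the double sum factors. Pairs inside one component err by
  at most 2 * k u, and a tree of size c makes this 2 * c^2 * z^c per vertex, at most 2 * B.\<close>

lemma mean_change_expo_sum:
  assumes valid: "valid_graph n E" and l: "l \<le> 0" and B: "\<And>k. (real k)\<^sup>2 * exp (real k * l) \<le> B"
  shows "\<bar>(\<Sum>u\<in>{1..n}. \<Sum>v\<in>{1..n} - {u}. mean_change (expo l) E u v)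
    - 2 * (real n)\<^sup>2 * expo_mass' l E * (expo_mass l E - survival E)\<bar> \<le> 2 * real n * B"
proof -
  let ?V = "{1..n}"
  let ?c = "\<lambda>v. card (component E v)"
  define k where "k = tree_weight (expo l) E"
  define \<tau> where "\<tau> v = (if in_tree E v then 1 else 0 :: real)" for v
  define x where "x v = (if in_tree E v then exp (real (?c v) * l) else 0)" for v
  define r where "r v = x v - \<tau> v - p * (1 - \<tau> v)" for v
  define ideal where "ideal u v = k u * r v + r u * k v" for u v
  let ?\<mu> = "mean_change (expo l) E"
  have k_nonneg: "0 \<le> k v" for v by (simp add: k_def tree_weight_def)
  have x01: "0 \<le> x v" "x v \<le> \<tau> v" for v using l by (auto simp: x_def \<tau>_def mult_nonneg_nonpos)
  have kx: "k v = real (?c v) * x v" for v by (simp add: k_def tree_weight_def x_def)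
  have err: "\<bar>(if v = u then 0 else ?\<mu> u v) - ideal u v\<bar> \<le> (if v \<in> component E u then 2 * k u else 0)" for u v
  proof (cases "v \<in> component E u")
    case True
    then have eq: "k v = k u" "r v = r u" "in_tree E v = in_tree E u"
      by (simp_all add: k_def r_def x_def \<tau>_def tree_weight_component in_tree_component component_eq)
    show ?thesis
    proof (cases "in_tree E u")
      case tree: True
      have ru: "r u = x u - 1" and mu: "?\<mu> u v = - k u" using tree True eq(3) by (simp_all add: r_def \<tau>_def mean_change_def k_def)
      then have d: "(if v = u then 0 else ?\<mu> u v) - ideal u v = (if v = u then 0 else - k u) + 2 * k u - 2 * (k u * x u)"
        unfolding ideal_def eq(1,2) ru mu by (simp add: algebra_simps)
      have "0 \<le> k u * x u" "k u * x u \<le> k u" using k_nonneg[of u] x01[of u] tree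
        by (auto simp: \<tau>_def mult_left_le)
      then show ?thesis unfolding d using True k_nonneg[of u] by auto
    next
      case False
      then have "k u = 0" "?\<mu> u v = 0" using eq by (simp_all add: kx x_def mean_change_def)
      then show ?thesis using eq by (simp add: ideal_def)
    qed
  next
    case False
    then have "v \<noteq> u" by auto
    have "?\<mu> u v = ideal u v"
    proof -
      have merge: "real (?c u + ?c v) * exp (real (?c u + ?c v) * l) = k u * x v + x u * k v"
        if "in_tree E u" "in_tree E v"
        using that by (simp add: kx x_def distrib_right exp_add algebra_simps)
      have kw: "tree_weight (\<lambda>k. exp (real k * l)) E w = k w" for w by (simp add: k_def)
      have tree: "r w = x w - 1" if "in_tree E w" for w using that by (simp add: r_def \<tau>_def)
      have not_tree: "r w = - p" "k w = 0" if "\<not> in_tree E w" for w using that by (simp_all add: r_def x_def \<tau>_def kx)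
      consider "in_tree E u" "in_tree E v" | "in_tree E u \<noteq> in_tree E v" | "\<not> in_tree E u" "\<not> in_tree E v" by blast
      then show ?thesis
      proof cases
        case 1
        then have "?\<mu> u v = k u * x v + x u * k v - k u - k v"
          using False merge[OF 1] by (simp only: mean_change_def kw if_True if_False simp_thms)
        then show ?thesis unfolding ideal_def tree[OF 1(1)] tree[OF 1(2)] by (simp add: algebra_simps)
      next
        case 2
        then have "?\<mu> u v = - p * (k u + k v)" by (auto simp only: mean_change_def kw if_True if_False simp_thms)
        then show ?thesis using 2 not_tree[of u] not_tree[of v] by (cases "in_tree E u") (simp_all add: ideal_def)
      next
        case 3
        then show ?thesis using not_tree by (simp add: ideal_def mean_change_def)
      qed
    qed
    then show ?thesis using False \<open>v \<noteq> u\<close> by simp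
  qed
  have row: "(\<Sum>v\<in>?V. if v \<in> component E u then 2 * k u else 0) \<le> 2 * B" if u: "u \<in> ?V" for u
  proof -
    have "component E u \<subseteq> ?V" using valid u by (intro component_subset) (auto simp: valid_graph_def)
    then have "?V \<inter> component E u = component E u" by auto
    then have "(\<Sum>v\<in>?V. if v \<in> component E u then 2 * k u else 0) = real (?c u) * (2 * k u)"
      by (simp add: sum.If_cases)
    also have "\<dots> = 2 * ((real (?c u))\<^sup>2 * x u)" by (simp add: kx power2_eq_square)
    also have "\<dots> \<le> 2 * B" using B[of "?c u"] B[of 0] by (auto simp: x_def)
    finally show ?thesis .
  qed
  have xs: "(\<Sum>v\<in>?V. x v) = real n * expo_mass l E" using n by (simp add: expo_mass_def tree_sum_def x_def)
  have ks: "(\<Sum>v\<in>?V. k v) = real n * expo_mass' l E" using n by (simp add: expo_mass'_def k_def)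
  have ts: "(\<Sum>v\<in>?V. \<tau> v) = trees E" by (simp add: trees_def tree_sum_def \<tau>_def)
  have "(\<Sum>v\<in>?V. r v) = real n * expo_mass l E - trees E - p * (real n - trees E)"
    unfolding r_def sum_subtractf sum_distrib_left[symmetric] xs ts by simp
  also have "\<dots> = real n * (expo_mass l E - survival E)"
    using n by (simp add: survival_def field_simps)
  finally have rs: "(\<Sum>v\<in>?V. r v) = real n * (expo_mass l E - survival E)" .
  have "(\<Sum>u\<in>?V. \<Sum>v\<in>?V. ideal u v) = 2 * ((\<Sum>v\<in>?V. k v) * (\<Sum>v\<in>?V. r v))"
    unfolding ideal_def sum.distrib sum_product[symmetric] by simp
  also have "\<dots> = 2 * (real n)\<^sup>2 * expo_mass' l E * (expo_mass l E - survival E)"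
    unfolding ks rs by (simp add: power2_eq_square)
  finally have ideal: "(\<Sum>u\<in>?V. \<Sum>v\<in>?V. ideal u v) = 2 * (real n)\<^sup>2 * expo_mass' l E * (expo_mass l E - survival E)" .
  have "(\<Sum>v\<in>?V - {u}. ?\<mu> u v) = (\<Sum>v\<in>?V. if v = u then 0 else ?\<mu> u v)" if "u \<in> ?V" for u
  proof -
    have "(\<Sum>v\<in>?V. if v = u then 0 else ?\<mu> u v) = (\<Sum>v\<in>?V - {u}. if v = u then 0 else ?\<mu> u v)"
      by (rule sum.mono_neutral_right) auto
    also have "\<dots> = (\<Sum>v\<in>?V - {u}. ?\<mu> u v)" by (rule sum.cong) auto
    finally show ?thesis ..
  qed
  then have "(\<Sum>u\<in>?V. \<Sum>v\<in>?V - {u}. ?\<mu> u v) - (\<Sum>u\<in>?V. \<Sum>v\<in>?V. ideal u v) =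
      (\<Sum>u\<in>?V. \<Sum>v\<in>?V. (if v = u then 0 else ?\<mu> u v) - ideal u v)"
    by (simp add: sum_subtractf)
  also have "\<bar>\<dots>\<bar> \<le> (\<Sum>u\<in>?V. \<Sum>v\<in>?V. if v \<in> component E u then 2 * k u else 0)"
    by (intro order_trans[OF sum_abs] sum_mono order_trans[OF sum_abs] err)
  also have "\<dots> \<le> (\<Sum>u\<in>?V. 2 * B)" by (intro sum_mono row)
  also have "\<dots> = 2 * real n * B" by simp
  finally show ?thesis unfolding ideal .
qed

lemma expo_mass'_range:
  assumes B: "\<And>k. (real k)\<^sup>2 * exp (real k * l) \<le> B"
  shows "0 \<le> expo_mass' l E" "expo_mass' l E \<le> B"
proof -
  have "tree_weight (expo l) E v \<le> B" for v
  proof -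
    have "real k * exp (real k * l) \<le> (real k)\<^sup>2 * exp (real k * l)" for k
      by (cases k) (auto simp: power2_eq_square intro!: mult_right_mono)
    then have "real k * exp (real k * l) \<le> B" for k using B order_trans by blast
    then show ?thesis using B[of 0] by (auto simp: tree_weight_def)
  qed
  then have "(\<Sum>v\<in>{1..n}. tree_weight (expo l) E v) \<le> (\<Sum>v\<in>{1..n}. B)" by (intro sum_mono)
  then show "expo_mass' l E \<le> B" using n by (simp add: expo_mass'_def divide_le_eq mult.commute)
  show "0 \<le> expo_mass' l E" unfolding expo_mass'_def
    by (intro divide_nonneg_nonneg sum_nonneg) (auto simp: tree_weight_def)
qed

text \<open>Second-order Taylor expansion at the new point l + \<theta>, because the drift of the
  step is evaluated there. The remainder carries k^2 and may sit anywhere within the shift, hence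
  the extra absolute value in the exponent.\<close>

lemma expo_mass_shift:
  assumes B: "\<And>k. (real k)\<^sup>2 * exp (real k * (l + \<theta> + \<bar>\<theta>\<bar>)) \<le> B"
  shows "\<bar>expo_mass (l + \<theta>) E - expo_mass l E - \<theta> * expo_mass' (l + \<theta>) E\<bar> \<le> B * \<theta>\<^sup>2 / 2"
proof -
  let ?V = "{1..n}"
  let ?t = "\<lambda>k. expo (l + \<theta>) k - expo l k - \<theta> * (real k * expo (l + \<theta>) k)"
  have t: "\<bar>?t k\<bar> \<le> B * \<theta>\<^sup>2 / 2" for k
  proof -
    let ?y = "- (real k * \<theta>)"
    have "exp (real k * l) = exp (real k * (l + \<theta>)) * exp ?y"
      by (simp add: exp_add[symmetric] algebra_simps)
    then have "?t k = - (exp (real k * (l + \<theta>)) * (exp ?y - 1 - ?y))"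
      by (simp add: algebra_simps)
    then have "\<bar>?t k\<bar> = exp (real k * (l + \<theta>)) * \<bar>exp ?y - 1 - ?y\<bar>"
      by (simp only: abs_minus_cancel abs_mult abs_exp_cancel)
    also have "\<dots> \<le> exp (real k * (l + \<theta>)) * (exp \<bar>?y\<bar> * ?y\<^sup>2 / 2)"
      by (intro mult_left_mono exp_taylor2) auto
    also have "\<dots> = (real k)\<^sup>2 * exp (real k * (l + \<theta> + \<bar>\<theta>\<bar>)) * (\<theta>\<^sup>2 / 2)"
      by (simp add: exp_add abs_mult distrib_left power_mult_distrib)
    also have "\<dots> \<le> B * (\<theta>\<^sup>2 / 2)" using B by (intro mult_right_mono) auto
    finally show ?thesis by simp
  qed
  have "expo_mass (l + \<theta>) E - expo_mass l E - \<theta> * expo_mass' (l + \<theta>) E =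
      (\<Sum>v\<in>?V. if in_tree E v then ?t (card (component E v)) else 0) / real n"
    unfolding expo_mass_def expo_mass'_def tree_sum_def tree_weight_def times_divide_eq_right sum_distrib_left
      diff_divide_distrib[symmetric] sum_subtractf[symmetric]
    by (intro arg_cong2[where f = "(/)"] sum.cong) auto
  also have "\<bar>\<dots>\<bar> \<le> (\<Sum>v\<in>?V. B * \<theta>\<^sup>2 / 2) / real n"
  proof -
    have "0 \<le> B * \<theta>\<^sup>2 / 2" using t[of 0] by linarith
    then have "\<bar>\<Sum>v\<in>?V. if in_tree E v then ?t (card (component E v)) else 0\<bar> \<le> (\<Sum>v\<in>?V. B * \<theta>\<^sup>2 / 2)"
      using t by (intro order_trans[OF sum_abs] sum_mono) auto
    then show ?thesis unfolding abs_divide abs_of_nat by (rule divide_right_mono) simp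
  qed
  also have "\<dots> = B * \<theta>\<^sup>2 / 2" using n by simp
  finally show ?thesis .
qed

text \<open>The shift \<open>\<theta>\<close> moves \<open>l\<close> along the characteristic, which cancels the drift of \<open>expo_mass\<close> up to
  a term proportional to \<open>expo_mass l (fst x) - a\<close> and an error of order \<open>1 / n\<^sup>2\<close>.\<close>

lemma expo_mass_step:
  assumes valid: "valid_graph n (fst x)" and \<delta>: "0 < \<delta>" "\<delta> \<le> 1" "8 / \<delta> \<le> real n" and l: "l \<le> - \<delta>"
    and a: "0 < a" "a \<le> 1"
  defines "\<theta> \<equiv> 2 / real n * (survival (fst x) - a)" and "B \<equiv> 8 / \<delta>\<^sup>2"
  shows "measure_pmf.expectation (frozen_step p n x) (\<lambda>y. (expo_mass (l + \<theta>) (fst y) - a)\<^sup>2) \<le>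
    (1 + 8 * B\<^sup>2 / real n) * (expo_mass l (fst x) - a)\<^sup>2 + 436 * B ^ 4 / (real n)\<^sup>2"
proof -
  let ?E = "fst x"
  let ?K = "frozen_step p n x"
  define s where "s = 1 / real n"
  have s: "0 < s" "s \<le> 1" "real n * s = 1" "real n \<noteq> 0" using n by (auto simp: s_def)
  define R where "R = expo_mass' (l + \<theta>) ?E"
  define W where "W = expo_mass l ?E - a"
  define X where "X = expo_mass (l + \<theta>) ?E"
  define q where "q = survival ?E"
  have q: "0 \<le> q" "q \<le> 1" using survival_range by (auto simp: q_def)
  have \<theta>: "\<theta> = 2 * s * (q - a)" by (simp add: \<theta>_def s_def q_def)
  have "\<bar>q - a\<bar> \<le> 1" using q a by auto
  then have \<theta>_abs: "\<bar>\<theta>\<bar> \<le> 2 * s" unfolding \<theta> using s by (simp add: abs_mult mult_left_le)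
  have s\<delta>: "8 * s \<le> \<delta>" using \<delta> n by (simp add: s_def field_simps)
  have l1: "l + \<theta> + \<bar>\<theta>\<bar> \<le> - \<delta> / 2" and l2: "l + \<theta> \<le> - \<delta> / 2" using l \<theta>_abs s\<delta> s by linarith+
  have B1: "1 \<le> B" using \<delta> power_le_one[of \<delta> 2] by (simp add: B_def divide_simps)
  have b1: "(real k)\<^sup>2 * exp (real k * (l + \<theta> + \<bar>\<theta>\<bar>)) \<le> B" for k
    unfolding B_def by (rule square_exp_bound[OF \<delta>(1) l1])
  have b2: "(real k)\<^sup>2 * exp (real k * (l + \<theta>)) \<le> B" for k
    unfolding B_def by (rule square_exp_bound[OF \<delta>(1) l2])
  have b3: "0 \<le> real k * exp (real k * (l + \<theta>))" "real k * exp (real k * (l + \<theta>)) \<le> B" for k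
  proof -
    have "real k * exp (real k * (l + \<theta>)) \<le> (real k)\<^sup>2 * exp (real k * (l + \<theta>))"
      by (cases k) (auto simp: power2_eq_square intro!: mult_right_mono)
    then show "real k * exp (real k * (l + \<theta>)) \<le> B" using b2 order_trans by blast
  qed simp
  have R: "0 \<le> R" "R \<le> B" unfolding R_def using expo_mass'_range[OF b2] by auto
  have h: "trees ?E / real n \<le> 1" using trees_range n by simp
  have X: "0 \<le> X" "X \<le> 1"
    unfolding X_def using expo_mass_range[of "l + \<theta>" ?E] l2 \<delta> h by auto
  have W: "\<bar>W\<bar> \<le> 1"
    unfolding W_def using expo_mass_range[of l ?E] l \<delta> h a by auto
  have "\<bar>X - expo_mass l ?E - \<theta> * R\<bar> \<le> B * \<theta>\<^sup>2 / 2"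
    unfolding X_def R_def by (rule expo_mass_shift[OF b1])
  also have "\<dots> \<le> B * (2 * s)\<^sup>2 / 2"
    using power_mono[OF \<theta>_abs abs_ge_zero, of 2] B1 by (intro divide_right_mono mult_left_mono) simp_all
  finally have shift: "\<bar>(X - a) - W - \<theta> * R\<bar> \<le> 2 * B * s\<^sup>2" by (simp add: W_def power_mult_distrib)
  let ?f = "\<lambda>y :: mgraph \<times> nat. expo_mass (l + \<theta>) (fst y) - a"
  let ?m = "measure_pmf.expectation ?K ?f"
  define S where "S = (\<Sum>u\<in>{1..n}. \<Sum>v\<in>{1..n} - {u}. mean_change (expo (l + \<theta>)) ?E u v)"
  have "?m = measure_pmf.expectation ?K (\<lambda>y. s * tree_sum n (expo (l + \<theta>)) (fst y) + (- a))"
    by (simp add: expo_mass_def s_def)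
  also have "\<dots> = s * (tree_sum n (expo (l + \<theta>)) ?E + S / (real n * (real n - 1))) + (- a)"
    unfolding expectation_affine_pmf[OF finite_step] expectation_tree_sum_step[OF valid] S_def ..
  also have "\<dots> = X - a + s * (S / (real n * (real n - 1)))"
    by (simp add: X_def expo_mass_def s_def distrib_left)
  finally have m: "?m = X - a + s * (S / (real n * (real n - 1)))" .
  have "\<bar>S - 2 * (real n)\<^sup>2 * R * (X - q)\<bar> \<le> 2 * real n * B"
    unfolding S_def R_def X_def q_def by (rule mean_change_expo_sum[OF valid _ b2]) (use l2 \<delta> in auto)
  define e1 where "e1 = (S - 2 * (real n)\<^sup>2 * R * (X - q)) / (real n)\<^sup>2"
  have S: "S = (real n)\<^sup>2 * (2 * R * (X - q) + e1)" using n by (simp add: e1_def field_simps)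
  have e1: "\<bar>e1\<bar> \<le> 2 * B * s"
  proof -
    have "\<bar>e1\<bar> \<le> 2 * real n * B / (real n)\<^sup>2"
      unfolding e1_def abs_divide using \<open>\<bar>S - _\<bar> \<le> _\<close> by (simp add: divide_right_mono)
    then show ?thesis using s(4) by (simp add: s_def power2_eq_square)
  qed
  \<comment> \<open>The number of edges gives the factor 1 / (n - 1) where the limit has s = 1 / n;
    the discrepancy s * w is of second order.\<close>
  define w where "w = 1 / (real n - 1)"
  have w: "0 \<le> w" "w \<le> 2 * s" "w - s = s * w" using n by (auto simp: w_def s_def field_simps)
  have sS: "s * (S / (real n * (real n - 1))) = w * (2 * R * (X - q) + e1)"
    unfolding S using n by (simp add: s_def w_def field_simps power2_eq_square)
  have RX: "\<bar>2 * R * (X - q)\<bar> \<le> 2 * B"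
  proof -
    have "\<bar>2 * R * (X - q)\<bar> \<le> (2 * B) * 1" unfolding abs_mult using R X q B1 by (intro mult_mono) auto
    then show ?thesis by simp
  qed
  have xi: "\<bar>w * (2 * R * (X - q) + e1) - s * (2 * R * (X - q))\<bar> \<le> 8 * B * s\<^sup>2"
  proof -
    have "w * (2 * R * (X - q) + e1) - s * (2 * R * (X - q)) = (w - s) * (2 * R * (X - q)) + w * e1"
      by (simp add: algebra_simps)
    also have "\<dots> = w * (s * (2 * R * (X - q)) + e1)" unfolding w(3) by (simp add: algebra_simps)
    also have "\<bar>\<dots>\<bar> \<le> 2 * s * (s * (2 * B) + 2 * B * s)"
      unfolding abs_mult[of w] using w s e1 RX B1
      by (intro mult_mono order_trans[OF abs_triangle_ineq] add_mono) (auto simp: abs_mult[of s] intro!: mult_left_mono)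
    also have "\<dots> = 8 * B * s\<^sup>2" by (simp add: power2_eq_square)
    finally show ?thesis .
  qed
  have m_bound: "\<bar>?m - W * (1 + 2 * s * R)\<bar> \<le> 18 * B\<^sup>2 * s\<^sup>2"
  proof -
    define e2 where "e2 = (X - a) - W - \<theta> * R"
    define e3 where "e3 = w * (2 * R * (X - q) + e1) - s * (2 * R * (X - q))"
    have e2: "\<bar>e2\<bar> \<le> 2 * B * s\<^sup>2" using shift by (simp add: e2_def)
    have e3: "\<bar>e3\<bar> \<le> 8 * B * s\<^sup>2" using xi by (simp add: e3_def)
    \<comment> \<open>The cancellation: the drift 2 * s * R * (X - q) and the shift \<theta> * R = 2
      * s * R * (q - a) add up to 2 * s * R * (X - a), and replacing X - a by W costs only
      second-order terms.\<close>
    have "M - W * (1 + 2 * s * R) = 2 * s * R * (\<theta> * R + e2) + (e2 + e3)"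
      if "M = X - a + w * (2 * R * (X - q) + e1)" for M
      unfolding that e2_def e3_def \<theta> by (simp add: algebra_simps)
    from this[of ?m] have "?m - W * (1 + 2 * s * R) = 2 * s * R * (\<theta> * R + e2) + (e2 + e3)"
      using m sS by simp
    also have "\<bar>\<dots>\<bar> \<le> 2 * s * B * (2 * s * B + 2 * B * s) + (2 * B * s\<^sup>2 + 8 * B * s\<^sup>2)"
    proof (intro order_trans[OF abs_triangle_ineq] add_mono e2 e3)
      have "\<bar>\<theta> * R\<bar> \<le> 2 * s * B" unfolding abs_mult using \<theta>_abs R s by (intro mult_mono) auto
      moreover have "2 * B * s\<^sup>2 \<le> 2 * B * s" using s B1 by (simp add: power2_eq_square mult_left_le)
      ultimately have "\<bar>\<theta> * R + e2\<bar> \<le> 2 * s * B + 2 * B * s" using e2 by linarith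
      then show "\<bar>2 * s * R * (\<theta> * R + e2)\<bar> \<le> 2 * s * B * (2 * s * B + 2 * B * s)"
        unfolding abs_mult[of "2 * s * R"] using R s B1 by (intro mult_mono) auto
    qed
    also have "\<dots> = 8 * (B\<^sup>2 * s\<^sup>2) + 10 * (B * s\<^sup>2)" by (simp add: power2_eq_square algebra_simps)
    also have "\<dots> \<le> 8 * (B\<^sup>2 * s\<^sup>2) + 10 * (B\<^sup>2 * s\<^sup>2)"
      using B1 by (intro add_left_mono mult_left_mono mult_right_mono) (auto simp: power2_eq_square)
    finally show ?thesis by simp
  qed
  have "measure_pmf.expectation ?K (\<lambda>y. (?f y)\<^sup>2) \<le> ?m\<^sup>2 + (2 * B * s)\<^sup>2"
  proof (rule expectation_square_le[OF finite_step, where c = "X - a"])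
    fix y assume "y \<in> set_pmf ?K"
    then have "\<bar>tree_sum n (expo (l + \<theta>)) (fst y) - tree_sum n (expo (l + \<theta>)) ?E\<bar> \<le> 2 * B"
      by (rule tree_sum_step_bound[OF valid _ b3])
    then have "\<bar>tree_sum n (expo (l + \<theta>)) (fst y) - tree_sum n (expo (l + \<theta>)) ?E\<bar> * s \<le> 2 * B * s"
      using s by (intro mult_right_mono) auto
    moreover have "?f y - (X - a) = (tree_sum n (expo (l + \<theta>)) (fst y) - tree_sum n (expo (l + \<theta>)) ?E) * s"
      by (simp add: X_def expo_mass_def s_def diff_divide_distrib)
    ultimately show "\<bar>?f y - (X - a)\<bar> \<le> 2 * B * s" using s by (simp add: abs_mult)
  qed
  also have "?m\<^sup>2 \<le> (1 + 8 * B\<^sup>2 * s) * W\<^sup>2 + 432 * B ^ 4 * s\<^sup>2"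
    by (rule square_recursion[OF B1 _ s(2) R W m_bound]) (use s in simp)
  also have "(2 * B * s)\<^sup>2 = 4 * (B\<^sup>2 * s\<^sup>2)" by (simp add: power_mult_distrib)
  also have "B\<^sup>2 * s\<^sup>2 \<le> B ^ 4 * s\<^sup>2" using B1 by (intro mult_right_mono power_increasing) auto
  finally show ?thesis by (simp add: W_def s_def power_divide)
qed

end

section \<open>Concentration along a run\<close>

sublocale frozen \<subseteq> limit_param p
  by unfold_locales (rule p)+

context frozen
begin

definition start :: "(mgraph \<times> nat) list" where "start = [({#}, 0)]"

text \<open>With the newest state first, the sorting condition says that the number of tree vertices
  never increases in time; it supplies \<open>h_mono\<close> of \<open>profile\<close>.\<close>

definition admissible :: "(mgraph \<times> nat) list \<Rightarrow> bool" where
  "admissible xs \<longleftrightarrow> xs \<noteq> [] \<and> (\<forall>x\<in>set xs. valid_graph n (fst x)) \<and>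
     sorted_wrt (\<lambda>x y. trees (fst x) \<le> trees (fst y)) xs"

lemma admissible_start: "admissible start"
  by (simp add: admissible_def start_def valid_graph_empty)

lemma admissible_step:
  assumes "admissible xs" "y \<in> set_pmf (frozen_step p n (hd xs))"
  shows "admissible (y # xs)"
proof -
  have v: "valid_graph n (fst (hd xs))" using assms(1) by (simp add: admissible_def)
  have "trees (fst y) \<le> trees (fst (hd xs))"
    unfolding trees_def by (rule tree_sum_step_le[OF v assms(2)])
  moreover have "trees (fst (hd xs)) \<le> trees (fst x)" if "x \<in> set xs" for x
    using assms(1) that by (cases xs) (auto simp: admissible_def)
  ultimately have "trees (fst y) \<le> trees (fst x)" if "x \<in> set xs" for x using that order_trans by blast
  then show ?thesis using assms(1) valid_step[OF v assms(2)] by (auto simp: admissible_def)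
qed

lemma admissible_not_Nil: "admissible xs \<Longrightarrow> xs \<noteq> []"
  by (simp add: admissible_def)

lemma admissible_hd: "admissible xs \<Longrightarrow> valid_graph n (fst (hd xs))"
  by (simp add: admissible_def)

text \<open>\<open>log_char\<close> read off a history. Using \<open>tl\<close> makes it
  predictable: its next value is known before the next step is drawn.\<close>

definition run_char :: "real \<Rightarrow> (mgraph \<times> nat) list \<Rightarrow> real" where
  "run_char a xs = ln a + 2 / real n * (\<Sum>x\<leftarrow>tl xs. survival (fst x) - a)"

definition expo_dev :: "real \<Rightarrow> (mgraph \<times> nat) list \<Rightarrow> real" where
  "expo_dev a xs = expo_mass (run_char a xs) (fst (hd xs)) - a"

text \<open>The compensated discard count divided by n, a martingale.\<close>

definition disc_dev :: "(mgraph \<times> nat) list \<Rightarrow> real" where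
  "disc_dev xs = (real (snd (hd xs)) - (\<Sum>x\<leftarrow>tl xs. discard_rate (fst x))) / real n"

lemma run_char_Cons: "xs \<noteq> [] \<Longrightarrow> run_char a (y # xs) = run_char a xs + 2 / real n * (survival (fst (hd xs)) - a)"
  by (cases xs) (simp_all add: run_char_def algebra_simps)

lemma tree_sum_empty: "tree_sum n \<phi> {#} = real n * \<phi> 1"
  by (simp add: tree_sum_def in_tree_def component_edges_def component_empty)

text \<open>The deviation starts at 0, since all trees are singletons and z = a. Over N <= n * T
  steps the growth factors compound to a constant and the errors O(1 / n^2) add up to O(1 /
  n).\<close>

lemma prob_expo_dev:
  assumes \<delta>: "0 < \<delta>" "\<delta> \<le> 1" "8 / \<delta> \<le> real n" and a: "0 < a" "a \<le> 1" and \<epsilon>: "0 < \<epsilon>"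
    and N: "real N \<le> real n * T"
  shows "measure_pmf.prob (run_pmf (frozen_step p n) N start)
      {ys. \<exists>m\<le>N. (expo_dev a (drop m ys))\<^sup>2 \<ge> \<epsilon>\<^sup>2 \<and> (\<forall>k\<in>{m..N}. run_char a (drop k ys) \<le> - \<delta>)}
    \<le> exp (8 * (8 / \<delta>\<^sup>2)\<^sup>2 * T) * (T * (436 * (8 / \<delta>\<^sup>2) ^ 4)) / \<epsilon>\<^sup>2 / real n"
proof -
  let ?B = "8 / \<delta>\<^sup>2"
  let ?\<alpha> = "8 * ?B\<^sup>2 / real n" and ?\<beta> = "436 * ?B ^ 4 / (real n)\<^sup>2"
  have dev0: "expo_dev a start = 0"
    using a n by (simp add: expo_dev_def run_char_def start_def expo_mass_def tree_sum_empty)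
  have "measure_pmf.prob (run_pmf (frozen_step p n) N start)
      {ys. \<exists>m\<le>N. (expo_dev a (drop m ys))\<^sup>2 \<ge> \<epsilon>\<^sup>2 \<and> (\<forall>k\<in>{m..N}. run_char a (drop k ys) \<le> - \<delta>)}
    \<le> (1 + ?\<alpha>) ^ N * ((expo_dev a start)\<^sup>2 + real N * ?\<beta>) / \<epsilon>\<^sup>2"
  proof (rule run_pmf_maximal_ineq[where I = admissible])
    fix xs assume xs: "admissible xs" "run_char a xs \<le> - \<delta>"
    have "expo_dev a (y # xs) = expo_mass (run_char a xs + 2 / real n * (survival (fst (hd xs)) - a)) (fst y) - a" for y
      using admissible_not_Nil[OF xs(1)] by (simp add: expo_dev_def run_char_Cons)
    then show "measure_pmf.expectation (frozen_step p n (hd xs)) (\<lambda>y. (expo_dev a (y # xs))\<^sup>2)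
        \<le> (1 + ?\<alpha>) * (expo_dev a xs)\<^sup>2 + ?\<beta>"
      using expo_mass_step[OF admissible_hd[OF xs(1)] \<delta> xs(2) a] by (simp only: expo_dev_def[of a xs])
  qed (use finite_step admissible_start admissible_step \<epsilon> n in auto)
  also have "\<dots> = (1 + ?\<alpha>) ^ N * (real N * ?\<beta>) / \<epsilon>\<^sup>2" by (simp add: dev0)
  also have "\<dots> \<le> exp (8 * ?B\<^sup>2 * T) * ((real n * T) * ?\<beta>) / \<epsilon>\<^sup>2"
  proof -
    have "(1 + ?\<alpha>) ^ N \<le> exp ?\<alpha> ^ N" using exp_ge_add_one_self[of ?\<alpha>] by (intro power_mono) auto
    also have "\<dots> = exp (real N * ?\<alpha>)" by (rule exp_of_nat_mult[symmetric])
    also have "\<dots> \<le> exp ((real n * T) * ?\<alpha>)" using N by (simp only: exp_le_cancel_iff) (intro mult_right_mono, auto)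
    also have "(real n * T) * ?\<alpha> = 8 * ?B\<^sup>2 * T" using n by simp
    finally show ?thesis using N n by (intro divide_right_mono mult_mono) auto
  qed
  also have "(real n * T) * ?\<beta> = T * (436 * ?B ^ 4) / real n" using n by (simp add: power2_eq_square)
  finally show ?thesis by (simp add: mult_ac)
qed

text \<open>A step adds at most 1 / n^2 to the second moment of this martingale, because a step
  discards at most one edge.\<close>

lemma prob_disc_dev:
  assumes \<epsilon>: "0 < \<epsilon>" and N: "real N \<le> real n * T"
  shows "measure_pmf.prob (run_pmf (frozen_step p n) N start) {ys. \<exists>m\<le>N. (disc_dev (drop m ys))\<^sup>2 \<ge> \<epsilon>\<^sup>2}
    \<le> T / \<epsilon>\<^sup>2 / real n"
proof -
  have dev0: "disc_dev start = 0" by (simp add: disc_dev_def start_def)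
  have "measure_pmf.prob (run_pmf (frozen_step p n) N start)
      {ys. \<exists>m\<le>N. (disc_dev (drop m ys))\<^sup>2 \<ge> \<epsilon>\<^sup>2 \<and> (\<forall>k\<in>{m..N}. True)}
    \<le> (1 + 0) ^ N * ((disc_dev start)\<^sup>2 + real N * (1 / (real n)\<^sup>2)) / \<epsilon>\<^sup>2"
  proof (rule run_pmf_maximal_ineq[where I = admissible])
    fix xs assume xs: "admissible xs"
    let ?x = "hd xs"
    let ?K = "frozen_step p n ?x"
    let ?c = "(\<Sum>x\<leftarrow>xs. discard_rate (fst x))"
    have dev: "disc_dev (y # xs) = 1 / real n * real (snd y) + (- ?c / real n)" for y
      by (simp add: disc_dev_def diff_divide_distrib)
    have c: "?c = discard_rate (fst ?x) + (\<Sum>x\<leftarrow>tl xs. discard_rate (fst x))"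
      using admissible_not_Nil[OF xs] by (cases xs) auto
    have mean: "measure_pmf.expectation ?K (\<lambda>y. disc_dev (y # xs)) = disc_dev xs"
      unfolding dev expectation_affine_pmf[OF finite_step] expectation_discarded_step[OF admissible_hd[OF xs]] c
      by (simp add: disc_dev_def add_divide_distrib diff_divide_distrib)
    have "measure_pmf.expectation ?K (\<lambda>y. (disc_dev (y # xs))\<^sup>2) \<le>
        (measure_pmf.expectation ?K (\<lambda>y. disc_dev (y # xs)))\<^sup>2 + (1 / real n)\<^sup>2"
    proof (rule expectation_square_le[OF finite_step, where c = "1 / real n * real (snd ?x) + (- ?c / real n)"])
      fix y assume "y \<in> set_pmf ?K"
      then obtain u v b where "(u, v) \<in> possible_edges n" and y: "y = update ?x ((u, v), b)" by (rule step_cases)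
      obtain E d where x: "?x = (E, d)" by (cases ?x)
      have "snd y = snd ?x \<or> snd y = Suc (snd ?x)"
        unfolding y x by (simp add: update_def)
      then show "\<bar>disc_dev (y # xs) - (1 / real n * real (snd ?x) + (- ?c / real n))\<bar> \<le> 1 / real n"
        unfolding dev by (auto simp: diff_divide_distrib[symmetric] add_divide_distrib)
    qed
    then show "measure_pmf.expectation ?K (\<lambda>y. (disc_dev (y # xs))\<^sup>2) \<le> (1 + 0) * (disc_dev xs)\<^sup>2 + 1 / (real n)\<^sup>2"
      unfolding mean by (simp add: power_divide)
  qed (use finite_step admissible_start admissible_step \<epsilon> in auto)
  also have "\<dots> = real N / (real n)\<^sup>2 / \<epsilon>\<^sup>2" by (simp add: dev0)
  also have "\<dots> \<le> (real n * T) / (real n)\<^sup>2 / \<epsilon>\<^sup>2" using N by (intro divide_right_mono) auto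
  also have "\<dots> = T / \<epsilon>\<^sup>2 / real n" using n by (simp add: power2_eq_square)
  finally show ?thesis by simp
qed

text \<open>The potential starts at n / K and pays for the squares of the large mass. The gap
  between b * (b - 1) / (n * (n - 1)) and (b / n)^2 costs at most 1 / n per step, in total at most
  T; Markov's inequality finishes.\<close>

lemma prob_big_mass:
  assumes K: "1 \<le> K" and s: "0 < s" and N: "real N \<le> real n * T"
  shows "measure_pmf.prob (run_pmf (frozen_step p n) N start)
      {ys. (\<Sum>x\<leftarrow>tl ys. (big_mass K (fst x) / real n)\<^sup>2) \<ge> s * real n} \<le> (1 / real K + T / real n) / s"
proof -
  let ?R = "run_pmf (frozen_step p n) N start"
  let ?y = "\<lambda>x :: mgraph \<times> nat. (big_mass K (fst x) / real n)\<^sup>2"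
  have fin: "finite (set_pmf ?R)" by (rule finite_set_run_pmf[OF finite_step])
  have pot: "measure_pmf.expectation ?R (\<lambda>ys. \<Sum>x\<leftarrow>tl ys. ?y x - 1 / real n)
      \<le> (\<Sum>x\<leftarrow>tl start. ?y x - 1 / real n) + big_potential K (fst (hd start))"
  proof (rule run_pmf_potential[where I = admissible])
    fix xs assume xs: "admissible xs"
    let ?b = "big_mass K (fst (hd xs))"
    have key: "(b / m)\<^sup>2 - 1 / m \<le> b * (b - 1) / (m * (m - 1))" if "m \<ge> 2" for b m :: real
    proof -
      \<comment> \<open>Completing the square in 4 * (b^2 - m * b + m^2 - m).\<close>
      have "0 \<le> (2 * b - m)\<^sup>2 + (3 * m - 4) * m" using that by simp
      then have "0 \<le> b\<^sup>2 - m * b + m\<^sup>2 - m" by (simp add: power2_eq_square algebra_simps)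
      then have "0 \<le> (b\<^sup>2 - m * b + m\<^sup>2 - m) / (m\<^sup>2 * (m - 1))" using that by (intro divide_nonneg_nonneg) auto
      also have "\<dots> = b * (b - 1) / (m * (m - 1)) - ((b / m)\<^sup>2 - 1 / m)"
        using that by (simp add: divide_simps) (simp add: power2_eq_square algebra_simps)
      finally show ?thesis by simp
    qed
    have "?y (hd xs) - 1 / real n \<le> ?b * (?b - 1) / (real n * (real n - 1))"
      by (rule key) (use n in simp)
    then show "measure_pmf.expectation (frozen_step p n (hd xs)) (\<lambda>x. big_potential K (fst x))
        \<le> big_potential K (fst (hd xs)) - (?y (hd xs) - 1 / real n)"
      using big_potential_drift[OF admissible_hd[OF xs] K] by linarith
  qed (use finite_step admissible_start admissible_step admissible_not_Nil in
      \<open>auto simp: big_potential_def tree_sum_def intro!: sum_nonneg\<close>)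
  have "measure_pmf.expectation ?R (\<lambda>ys. \<Sum>x\<leftarrow>tl ys. ?y x)
      \<le> measure_pmf.expectation ?R (\<lambda>ys. 1 * (\<Sum>x\<leftarrow>tl ys. ?y x - 1 / real n) + real N / real n)"
  proof (rule expectation_mono_pmf[OF fin])
    fix ys assume "ys \<in> set_pmf ?R"
    then have "length (tl ys) = N" using length_run_pmf[of ys _ N start] by (simp add: start_def)
    moreover have "(\<Sum>x\<leftarrow>zs. ?y x) = (\<Sum>x\<leftarrow>zs. ?y x - 1 / real n) + real (length zs) / real n" for zs
      by (induction zs) (auto simp: add_divide_distrib)
    ultimately show "(\<Sum>x\<leftarrow>tl ys. ?y x) \<le> 1 * (\<Sum>x\<leftarrow>tl ys. ?y x - 1 / real n) + real N / real n" by simp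
  qed
  also have "\<dots> = 1 * measure_pmf.expectation ?R (\<lambda>ys. \<Sum>x\<leftarrow>tl ys. ?y x - 1 / real n) + real N / real n"
    by (rule expectation_affine_pmf[OF fin])
  also have "\<dots> \<le> real n / real K + T"
  proof -
    have "big_potential K {#} = real n / real K" using K by (simp add: big_potential_def tree_sum_empty max_def)
    moreover have "real N / real n \<le> T" using N n by (simp add: divide_le_eq mult.commute)
    ultimately show ?thesis using pot by (simp add: start_def)
  qed
  finally have E: "measure_pmf.expectation ?R (\<lambda>ys. \<Sum>x\<leftarrow>tl ys. ?y x) \<le> real n / real K + T" .
  have "measure_pmf.prob ?R {ys. (\<Sum>x\<leftarrow>tl ys. ?y x) \<ge> s * real n}
      \<le> measure_pmf.expectation ?R (\<lambda>ys. \<Sum>x\<leftarrow>tl ys. ?y x) / (s * real n)"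
    by (rule prob_le_expectation_pmf[OF fin]) (use s n in \<open>auto intro!: sum_list_nonneg\<close>)
  also have "\<dots> \<le> (real n / real K + T) / (s * real n)" using E s n by (intro divide_right_mono) auto
  also have "\<dots> = (1 / real K + T / real n) / s" using s n K by (simp add: field_simps)
  finally show ?thesis .
qed

text \<open>The passage from z = exp l to 1: a vertex in a large tree loses at most 1, and one in a
  tree smaller than K at most K * (- l), by exp x >= 1 + x.\<close>

lemma expo_mass_ge:
  assumes "l \<le> 0"
  shows "trees E / real n - expo_mass l E \<le> big_mass K E / real n + real K * (- l)"
proof -
  let ?V = "{1..n}"
  have "trees E - tree_sum n (expo l) E = (\<Sum>v\<in>?V. if in_tree E v then 1 - exp (real (card (component E v)) * l) else 0)"
    unfolding trees_def tree_sum_def sum_subtractf[symmetric] by (rule sum.cong) auto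
  also have "\<dots> \<le> (\<Sum>v\<in>?V. (if in_tree E v then if K \<le> card (component E v) then 1 else 0 else 0) + real K * (- l))"
  proof (rule sum_mono)
    fix v
    let ?k = "card (component E v)"
    have "1 - exp (real ?k * l) \<le> real K * (- l)" if "?k < K"
    proof -
      have "1 - exp (real ?k * l) \<le> real ?k * (- l)" using exp_ge_add_one_self[of "real ?k * l"] by linarith
      also have "\<dots> \<le> real K * (- l)" using that assms by (intro mult_right_mono) auto
      finally show ?thesis .
    qed
    moreover have "0 \<le> real K * (- l)" using assms by (simp add: mult_nonneg_nonpos)
    ultimately show "(if in_tree E v then 1 - exp (real ?k * l) else 0) \<le>
        (if in_tree E v then if K \<le> ?k then 1 else 0 else 0) + real K * (- l)"
      by (cases "?k < K") (auto intro: order_trans[OF _ exp_ge_zero])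
  qed
  also have "\<dots> = big_mass K E + real n * (real K * (- l))"
    by (simp only: sum.distrib big_mass_def tree_sum_def sum_constant card_atLeastAtMost) simp
  finally have "(trees E - tree_sum n (expo l) E) / real n \<le> (big_mass K E + real n * (real K * (- l))) / real n"
    by (rule divide_right_mono) simp
  then show ?thesis using n by (simp add: expo_mass_def diff_divide_distrib add_divide_distrib)
qed

lemma discard_rate_approx: "\<bar>discard_rate E - d_rate (1 - trees E / real n)\<bar> \<le> 2 / real n"
proof -
  define g where "g = 1 - trees E / real n"
  have g: "0 \<le> g" "g \<le> 1" using trees_range[of E] n by (auto simp: g_def divide_le_eq)
  have t: "trees E = real n * (1 - g)" using n by (simp add: g_def)
  have n1: "real n - 1 > 0" using n by simp
  have "(real n - trees E)\<^sup>2 + 2 * (1 - p) * trees E * (real n - trees E) - (real n - trees E) =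
      real n * (real n * d_rate g - g)"
    unfolding t by (simp add: d_rate_def power2_eq_square algebra_simps)
  then have "discard_rate E = real n * (real n * d_rate g - g) / (real n * (real n - 1))"
    by (simp add: discard_rate_def)
  also have "\<dots> = (real n * d_rate g - g) / (real n - 1)" using n by simp
  finally have "discard_rate E - d_rate g = (d_rate g - g) / (real n - 1)"
    using n1 by (simp add: field_simps)
  moreover have "\<bar>d_rate g - g\<bar> \<le> 1" using d_rate_range[OF g] g by auto
  ultimately have "\<bar>discard_rate E - d_rate g\<bar> \<le> 1 / (real n - 1)"
    using n1 by (simp add: divide_right_mono)
  also have "\<dots> \<le> 2 / real n" using n by (simp add: field_simps)
  finally show ?thesis by (simp add: g_def)
qed

lemma num_frozen_eq:
  assumes "valid_graph n E"
  shows "real (num_frozen n E) / real n = 1 - trees E / real n"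
proof -
  have "real (num_frozen n E) = (\<Sum>v\<in>{1..n}. if in_unicycle E v then 1 else 0)"
    unfolding num_frozen_def by (simp add: sum.If_cases Int_def)
  also have "\<dots> = (\<Sum>v\<in>{1..n}. 1 - (if in_tree E v then 1 else 0))"
    using assms not_in_tree_and_unicycle by (intro sum.cong) (auto simp: valid_graph_def)
  also have "\<dots> = real n - trees E" by (simp add: sum_subtractf trees_def tree_sum_def)
  finally show ?thesis using n by (simp add: diff_divide_distrib)
qed

end

section \<open>Convergence\<close>

lemma set_hist: "set (hist s N) = s ` {..N}"
  by (induction N) (auto simp: atMost_Suc)

lemma sorted_wrt_hist: "sorted_wrt P (hist s N) \<Longrightarrow> k < m \<Longrightarrow> m \<le> N \<Longrightarrow> P (s m) (s k)"
proof (induction N)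
  case (Suc N)
  then show ?case by (cases "m = Suc N") (auto simp: set_hist)
qed simp

context limit_param
begin

text \<open>\<open>hist\<close> restores the forward indexing by time. The constant 4 * T + 2
  collects \<omega> for the martingale, 4 * T * \<omega> for its compensator and 1 / n <= \<omega>
  for the Riemann sum.\<close>

definition close_runs :: "real \<Rightarrow> real \<Rightarrow> nat \<Rightarrow> nat \<Rightarrow> (mgraph \<times> nat) list set" where
  "close_runs T \<omega> n N = {xs. \<forall>s. xs = hist s N \<longrightarrow> (\<forall>m\<le>N.
     \<bar>real (num_frozen n (fst (s m))) / real n - g_lim p (real m / real n)\<bar> \<le> \<omega> \<and>
     \<bar>real (snd (s m)) / real n - d_lim p (real m / real n)\<bar> \<le> (4 * T + 2) * \<omega>)}"

end

context frozen
begin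

definition bad_expo :: "real \<Rightarrow> real \<Rightarrow> real \<Rightarrow> nat \<Rightarrow> (mgraph \<times> nat) list set" where
  "bad_expo a \<delta> \<epsilon> N =
     {ys. \<exists>m\<le>N. (expo_dev a (drop m ys))\<^sup>2 \<ge> \<epsilon>\<^sup>2 \<and> (\<forall>k\<in>{m..N}. run_char a (drop k ys) \<le> - \<delta>)}"

definition bad_mass :: "nat \<Rightarrow> real \<Rightarrow> (mgraph \<times> nat) list set" where
  "bad_mass K s = {ys. (\<Sum>x\<leftarrow>tl ys. (big_mass K (fst x) / real n)\<^sup>2) \<ge> s * real n}"

definition bad_disc :: "real \<Rightarrow> nat \<Rightarrow> (mgraph \<times> nat) list set" where
  "bad_disc \<epsilon> N = {ys. \<exists>m\<le>N. (disc_dev (drop m ys))\<^sup>2 \<ge> \<epsilon>\<^sup>2}"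

text \<open>The deterministic half: outside the three kinds of bad events, h and y of a single
  history satisfy the premises of \<open>stability\<close>, and the discards follow from the
  closeness of h.\<close>

lemma good_run_is_close:
  assumes run: "xs \<in> set_pmf (run_pmf (frozen_step p n) N start)"
    and T: "1 \<le> T" and N: "real N \<le> real n * T" and \<omega>: "1 / real n \<le> \<omega>"
    and pos: "0 < \<delta>" "0 < \<epsilon>" "0 < \<kappa>" and S: "S \<subseteq> {0<..1}"
    and stab: "\<And>h y. profile p T n N h \<Longrightarrow> (\<forall>k. 0 \<le> y k) \<Longrightarrow>
       (\<forall>a\<in>S. \<forall>m\<le>N. (\<forall>k\<le>m. log_char n h k a \<le> - \<delta>) \<longrightarrow>
          a - \<epsilon> \<le> h m \<and> h m \<le> a + \<epsilon> + y m + real K * (- log_char n h m a)) \<Longrightarrow>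
       (\<Sum>k<N. y k) \<le> \<kappa> * real n \<Longrightarrow> (\<forall>m\<le>N. \<bar>h m - h_lim (real m / real n)\<bar> \<le> \<omega>)"
    and good: "xs \<notin> (\<Union>a\<in>S. bad_expo a \<delta> \<epsilon> N)" "xs \<notin> bad_mass K (\<kappa>\<^sup>2 / (4 * T))" "xs \<notin> bad_disc \<omega> N"
  shows "xs \<in> close_runs T \<omega> n N"
  unfolding close_runs_def
proof (intro CollectI allI impI)
  fix s m assume xs: "xs = hist s N" and m: "m \<le> N"
  have n0: "real n > 0" using n by simp
  have adm: "admissible xs"
    by (rule run_pmf_invariant[OF run admissible_start admissible_step])
  define h where "h k = trees (fst (s k)) / real n" for k
  define y where "y k = big_mass K (fst (s k)) / real n" for k
  have valid: "valid_graph n (fst (s k))" if "k \<le> N" for k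
    using adm that by (auto simp: admissible_def xs set_hist)
  have h01: "0 \<le> h k" "h k \<le> 1" for k using trees_range n0 by (auto simp: h_def divide_le_eq)
  have y0: "0 \<le> y k" for k by (simp add: y_def big_mass_def tree_sum_def sum_nonneg)
  have drop_xs: "drop (N - k) xs = hist s k" if "k \<le> N" for k using drop_hist[OF that] by (simp add: xs)
  have prof: "profile p T n N h"
  proof unfold_locales
    fix k m assume km: "k \<le> m" "m \<le> N"
    have "sorted_wrt (\<lambda>x y. trees (fst x) \<le> trees (fst y)) (hist s N)" using adm by (simp add: admissible_def xs)
    then have "trees (fst (s m)) \<le> trees (fst (s k))"
      using sorted_wrt_hist[of "\<lambda>x y. trees (fst x) \<le> trees (fst y)" s N k m] km by (cases "k = m") auto
    then show "h m \<le> h k" by (simp add: h_def divide_right_mono)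
  qed (use T N n h01 in auto)
  have run_char: "run_char a (hist s k) = log_char n h k a" for a k
  proof -
    have "(\<Sum>i<k. survival (fst (s i)) - a) = (\<Sum>i<k. 1 - (1 - p) * (1 - h i)) - real k * a"
      by (simp add: sum_subtractf survival_def h_def)
    then show ?thesis
      unfolding run_char_def sum_list_tl_hist log_char_def drift_def by (simp add: right_diff_distrib)
  qed
  have ctrl: "a - \<epsilon> \<le> h m \<and> h m \<le> a + \<epsilon> + y m + real K * (- log_char n h m a)"
    if a: "a \<in> S" and m: "m \<le> N" and alive: "\<forall>k\<le>m. log_char n h k a \<le> - \<delta>" for a m
  proof -
    let ?l = "log_char n h m a"
    \<comment> \<open>Time reversal: dropping k entries leaves the history up to step N - k, which
      is at most m.\<close>
    have "\<forall>k\<in>{N - m..N}. run_char a (drop k xs) \<le> - \<delta>"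
    proof
      fix k assume k: "k \<in> {N - m..N}"
      then have "drop k xs = hist s (N - k)" using drop_xs[of "N - k"] by simp
      moreover have "N - k \<le> m" using k m by auto
      ultimately show "run_char a (drop k xs) \<le> - \<delta>" using alive by (simp add: run_char)
    qed
    moreover have "xs \<notin> bad_expo a \<delta> \<epsilon> N" using good(1) a by blast
    moreover have "xs \<in> bad_expo a \<delta> \<epsilon> N"
      if "\<forall>k\<in>{N - m..N}. run_char a (drop k xs) \<le> - \<delta>" "(expo_dev a (drop (N - m) xs))\<^sup>2 \<ge> \<epsilon>\<^sup>2"
      unfolding bad_expo_def by (intro CollectI exI[of _ "N - m"]) (use that in auto)
    ultimately have "\<not> (expo_dev a (drop (N - m) xs))\<^sup>2 \<ge> \<epsilon>\<^sup>2" by blast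
    then have "\<bar>expo_mass ?l (fst (s m)) - a\<bar> < \<epsilon>"
      using pos(2) unfolding drop_xs[OF m] expo_dev_def run_char hd_hist
      by (metis not_le abs_le_square_iff abs_of_pos)
    moreover have l: "?l \<le> 0" using alive pos(1) by force
    have "expo_mass ?l (fst (s m)) \<le> h m" using expo_mass_range[OF l] by (simp add: h_def)
    moreover have "h m - expo_mass ?l (fst (s m)) \<le> y m + real K * (- ?l)"
      using expo_mass_ge[OF l] by (simp add: h_def y_def)
    ultimately show ?thesis by linarith
  qed
  have mass: "(\<Sum>k<N. y k) \<le> \<kappa> * real n"
  proof -
    \<comment> \<open>A bound on the sum of squares becomes one on the sum through y <= \<theta> +
      y^2 / \<theta>. The two parts contribute \<kappa> / 2 * n each, which explains the level
      \<kappa>^2 / (4 * T) in \<open>bad_mass\<close>.\<close>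
    let ?\<theta> = "\<kappa> / (2 * T)"
    have \<theta>: "0 < ?\<theta>" using pos T by simp
    have "(\<Sum>k<N. (y k)\<^sup>2) < \<kappa>\<^sup>2 / (4 * T) * real n"
      using good(2) by (simp add: bad_mass_def xs sum_list_tl_hist y_def not_le)
    then have 1: "(\<Sum>k<N. (y k)\<^sup>2) / ?\<theta> \<le> \<kappa>\<^sup>2 / (4 * T) * real n / ?\<theta>"
      using \<theta> by (intro divide_right_mono) auto
    have 2: "\<kappa>\<^sup>2 / (4 * T) * real n / ?\<theta> = \<kappa> / 2 * real n"
      using pos T by (simp add: field_simps power2_eq_square)
    have "y k \<le> ?\<theta> + (y k)\<^sup>2 / ?\<theta>" for k
    proof (cases "y k \<le> ?\<theta>")
      case True
      have "0 \<le> (y k)\<^sup>2 / ?\<theta>" by (rule divide_nonneg_pos[OF zero_le_power2 \<theta>])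
      then show ?thesis using True by linarith
    next
      case False
      then have "y k * ?\<theta> \<le> y k * y k" using y0[of k] by (intro mult_left_mono) auto
      then have "y k * ?\<theta> \<le> (y k)\<^sup>2" by (simp only: power2_eq_square)
      then have "y k \<le> (y k)\<^sup>2 / ?\<theta>" using \<theta> by (simp only: pos_le_divide_eq)
      then show ?thesis using \<theta> by linarith
    qed
    then have "(\<Sum>k<N. y k) \<le> (\<Sum>k<N. ?\<theta> + (y k)\<^sup>2 / ?\<theta>)" by (intro sum_mono)
    also have "\<dots> = real N * ?\<theta> + (\<Sum>k<N. (y k)\<^sup>2) / ?\<theta>"
      by (simp only: sum.distrib sum_constant card_lessThan sum_divide_distrib)
    also have "real N * ?\<theta> \<le> real n * T * ?\<theta>" using N \<theta> by (intro mult_right_mono) auto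
    also have "real n * T * ?\<theta> = \<kappa> / 2 * real n" using T by simp
    finally show ?thesis using 1 2 by linarith
  qed
  have hc: "\<bar>h k - h_lim (real k / real n)\<bar> \<le> \<omega>" if "k \<le> N" for k
    using stab[OF prof, of y] y0 ctrl mass that by blast
  have "real (num_frozen n (fst (s m))) / real n = 1 - h m"
    using num_frozen_eq[OF valid[OF m]] by (simp add: h_def)
  then have G: "\<bar>real (num_frozen n (fst (s m))) / real n - g_lim p (real m / real n)\<bar> \<le> \<omega>"
    using hc[OF m] by (simp add: abs_le_iff)
  let ?r = "\<lambda>k. discard_rate (fst (s k))"
  let ?g = "\<lambda>k. g_lim p (real k / real n)"
  have "\<not> (disc_dev (drop (N - m) xs))\<^sup>2 \<ge> \<omega>\<^sup>2" using good(3) by (auto simp: bad_disc_def)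
  then have "\<bar>disc_dev (hist s m)\<bar> < \<bar>\<omega>\<bar>" unfolding drop_xs[OF m] by (metis not_le abs_le_square_iff)
  moreover have \<omega>_pos: "0 < \<omega>" using \<omega> n0 by (meson less_le_trans zero_less_divide_1_iff)
  ultimately have 1: "\<bar>real (snd (s m)) / real n - (\<Sum>k<m. ?r k) / real n\<bar> \<le> \<omega>"
    by (simp add: disc_dev_def sum_list_tl_hist diff_divide_distrib)
  have "\<bar>?r k - d_rate (?g k)\<bar> \<le> 2 / real n + 2 * \<omega>" if "k < m" for k
  proof -
    have "\<bar>d_rate (1 - h k) - d_rate (?g k)\<bar> \<le> 2 * \<bar>(1 - h k) - ?g k\<bar>"
      using h01[of k] g_lim_range[of "real k / real n"] by (intro d_rate_lipschitz) auto
    also have "\<dots> \<le> 2 * \<omega>" using hc[of k] that m by (simp add: abs_le_iff)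
    finally have "\<bar>d_rate (1 - h k) - d_rate (?g k)\<bar> \<le> 2 * \<omega>" .
    moreover have "\<bar>?r k - d_rate (1 - h k)\<bar> \<le> 2 / real n" unfolding h_def by (rule discard_rate_approx)
    ultimately show ?thesis by linarith
  qed
  then have "(\<Sum>k<m. \<bar>?r k - d_rate (?g k)\<bar>) \<le> (\<Sum>k<m. 2 / real n + 2 * \<omega>)" by (intro sum_mono) auto
  moreover have "\<bar>(\<Sum>k<m. ?r k) - (\<Sum>k<m. d_rate (?g k))\<bar> \<le> (\<Sum>k<m. \<bar>?r k - d_rate (?g k)\<bar>)"
    unfolding sum_subtractf[symmetric] by (rule sum_abs)
  ultimately have "\<bar>(\<Sum>k<m. ?r k) - (\<Sum>k<m. d_rate (?g k))\<bar> \<le> real m * (2 / real n + 2 * \<omega>)" by simp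
  also have "\<dots> \<le> real n * T * (4 * \<omega>)"
  proof (rule mult_mono)
    show "real m \<le> real n * T" using m N by (meson of_nat_le_iff order_trans)
    show "2 / real n + 2 * \<omega> \<le> 4 * \<omega>" using \<omega> by simp
  qed (use T n0 \<omega>_pos in simp_all)
  finally have "\<bar>(\<Sum>k<m. ?r k) - (\<Sum>k<m. d_rate (?g k))\<bar> / real n \<le> 4 * T * \<omega>"
    using n0 by (simp add: divide_le_eq mult_ac)
  then have 2: "\<bar>(\<Sum>k<m. ?r k) / real n - (\<Sum>k<m. d_rate (?g k)) / real n\<bar> \<le> 4 * T * \<omega>"
    by (simp add: diff_divide_distrib[symmetric] abs_divide)
  have 3: "\<bar>(\<Sum>k<m. d_rate (?g k)) / real n - d_lim p (real m / real n)\<bar> \<le> 1 / real n"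
    using n by (intro d_lim_riemann) simp
  have "\<bar>real (snd (s m)) / real n - d_lim p (real m / real n)\<bar> \<le> (4 * T + 2) * \<omega>"
    using 1 2 3 \<omega> unfolding distrib_right by linarith
  with G show "\<bar>real (num_frozen n (fst (s m))) / real n - g_lim p (real m / real n)\<bar> \<le> \<omega> \<and>
     \<bar>real (snd (s m)) / real n - d_lim p (real m / real n)\<bar> \<le> (4 * T + 2) * \<omega>" ..
qed

end

context limit_param
begin

text \<open>The error \<xi> is split into quarters: one for all characteristics of the grid, two for
  the mass of the large trees, one for the discards.\<close>

lemma prob_close_runs:
  assumes T: "1 \<le> T" and \<omega>: "0 < \<omega>" and \<xi>: "0 < \<xi>"
  shows "\<exists>n0. \<forall>n\<ge>n0. \<forall>N. real N \<le> real n * T \<longrightarrow>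
    measure_pmf.prob (run_pmf (frozen_step p n) N [({#}, 0)]) (- close_runs T \<omega> n N) \<le> \<xi>"
proof -
  obtain \<kappa> where \<kappa>: "0 < \<kappa>" and stab: "\<forall>K\<ge>0. \<exists>\<delta> \<epsilon> S n0. 0 < \<delta> \<and> \<delta> \<le> 1 \<and> 0 < \<epsilon> \<and> finite S \<and> S \<subseteq> {0<..1} \<and>
    (\<forall>n\<ge>n0. \<forall>N h y. profile p T n N h \<longrightarrow> (\<forall>k. 0 \<le> y k) \<longrightarrow>
       (\<forall>a\<in>S. \<forall>m\<le>N. (\<forall>k\<le>m. log_char n h k a \<le> - \<delta>) \<longrightarrow>
          a - \<epsilon> \<le> h m \<and> h m \<le> a + \<epsilon> + y m + K * (- log_char n h m a)) \<longrightarrow>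
       (\<Sum>k<N. y k) \<le> \<kappa> * real n \<longrightarrow> (\<forall>m\<le>N. \<bar>h m - h_lim (real m / real n)\<bar> \<le> \<omega>))"
    using stability[OF T \<omega>] by (elim exE conjE) (rule that)
  define s where "s = \<kappa>\<^sup>2 / (4 * T)"
  have s: "0 < s" using \<kappa> T by (simp add: s_def)
  \<comment> \<open>The part 1 / (K * s) of the bound in \<open>prob_big_mass\<close> does not
    vanish as n grows, so K alone has to make it small; K is fixed before \<delta>, \<epsilon> and
    S.\<close>
  define K where "K = nat \<lceil>4 / (\<xi> * s)\<rceil> + 1"
  have "4 / (\<xi> * s) \<le> real K" unfolding K_def by linarith
  moreover have "1 \<le> K" by (simp add: K_def)
  ultimately have K: "1 \<le> K" "1 / real K / s \<le> \<xi> / 4" using \<xi> s by (simp_all add: field_simps)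
  obtain \<delta> \<epsilon> S n1 where \<delta>: "0 < \<delta>" "\<delta> \<le> 1" and \<epsilon>: "0 < \<epsilon>" and S: "finite S" "S \<subseteq> {0<..1}"
    and close: "\<forall>n\<ge>n1. \<forall>N h y. profile p T n N h \<longrightarrow> (\<forall>k. 0 \<le> y k) \<longrightarrow>
       (\<forall>a\<in>S. \<forall>m\<le>N. (\<forall>k\<le>m. log_char n h k a \<le> - \<delta>) \<longrightarrow>
          a - \<epsilon> \<le> h m \<and> h m \<le> a + \<epsilon> + y m + real K * (- log_char n h m a)) \<longrightarrow>
       (\<Sum>k<N. y k) \<le> \<kappa> * real n \<longrightarrow> (\<forall>m\<le>N. \<bar>h m - h_lim (real m / real n)\<bar> \<le> \<omega>)"
    using stab[THEN spec, THEN mp, OF of_nat_0_le_iff[of K]] by (elim exE conjE) (rule that)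
  define C where "C = exp (8 * (8 / \<delta>\<^sup>2)\<^sup>2 * T) * (T * (436 * (8 / \<delta>\<^sup>2) ^ 4)) / \<epsilon>\<^sup>2"
  define n0 where "n0 = n1 + 2 + nat \<lceil>8 / \<delta>\<rceil> + nat \<lceil>1 / \<omega>\<rceil> + nat \<lceil>real (card S) * C * 4 / \<xi>\<rceil>
    + nat \<lceil>T / \<omega>\<^sup>2 * 4 / \<xi>\<rceil> + nat \<lceil>T / s * 4 / \<xi>\<rceil>"
  have "measure_pmf.prob (run_pmf (frozen_step p n) N [({#}, 0)]) (- close_runs T \<omega> n N) \<le> \<xi>"
    if n_ge: "n0 \<le> n" and N: "real N \<le> real n * T" for n N
  proof -
    have n2: "n1 \<le> n" "2 \<le> n" using n_ge by (simp_all add: n0_def)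
    interpret frozen p n using p n2 by unfold_locales auto
    let ?R = "run_pmf (frozen_step p n) N start"
    have real_n: "8 / \<delta> \<le> real n" "1 / \<omega> \<le> real n" "real (card S) * C * 4 / \<xi> \<le> real n"
        "T / \<omega>\<^sup>2 * 4 / \<xi> \<le> real n" "T / s * 4 / \<xi> \<le> real n"
      using n_ge unfolding n0_def by linarith+
    have n_pos: "0 < real n" using n2 by simp
    have le: "x / real n \<le> \<xi> / 4" if "x * 4 / \<xi> \<le> real n" for x
      using that \<xi> n_pos by (simp add: field_simps)
    have n_inv: "1 / real n \<le> \<omega>" using real_n(2) \<omega> n_pos by (simp add: field_simps)
    have stable: "\<forall>m\<le>N. \<bar>h m - h_lim (real m / real n)\<bar> \<le> \<omega>"
      if "profile p T n N h" "\<forall>k. 0 \<le> y k"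
        "\<forall>a\<in>S. \<forall>m\<le>N. (\<forall>k\<le>m. log_char n h k a \<le> - \<delta>) \<longrightarrow>
          a - \<epsilon> \<le> h m \<and> h m \<le> a + \<epsilon> + y m + real K * (- log_char n h m a)"
        "(\<Sum>k<N. y k) \<le> \<kappa> * real n" for h y
      using close[THEN spec, THEN mp, OF n2(1), THEN spec, THEN spec, THEN spec, THEN mp, THEN mp, THEN mp, THEN mp, OF that] .
    have good: "xs \<in> close_runs T \<omega> n N"
      if "xs \<in> set_pmf ?R" "xs \<notin> (\<Union>a\<in>S. bad_expo a \<delta> \<epsilon> N)" "xs \<notin> bad_mass K s" "xs \<notin> bad_disc \<omega> N" for xs
      by (rule good_run_is_close[OF that(1) T N n_inv \<delta>(1) \<epsilon> \<kappa> S(2) _ that(2) that(3)[unfolded s_def] that(4)])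
         (rule stable)
    let ?A = "\<Union>a\<in>S. bad_expo a \<delta> \<epsilon> N" and ?B = "bad_mass K s" and ?C = "bad_disc \<omega> N"
    have "measure_pmf.prob ?R (- close_runs T \<omega> n N) \<le> measure_pmf.prob ?R (?A \<union> (?B \<union> ?C))"
    proof (rule measure_pmf.finite_measure_mono_AE)
      show "AE xs in ?R. xs \<in> - close_runs T \<omega> n N \<longrightarrow> xs \<in> ?A \<union> (?B \<union> ?C)"
        unfolding AE_measure_pmf_iff using good by blast
    qed simp
    also have "\<dots> \<le> measure_pmf.prob ?R ?A + measure_pmf.prob ?R (?B \<union> ?C)"
      by (rule measure_Un_le) simp_all
    also have "measure_pmf.prob ?R (?B \<union> ?C) \<le> measure_pmf.prob ?R ?B + measure_pmf.prob ?R ?C"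
      by (rule measure_Un_le) simp_all
    finally have union: "measure_pmf.prob ?R (- close_runs T \<omega> n N) \<le>
        measure_pmf.prob ?R ?A + (measure_pmf.prob ?R ?B + measure_pmf.prob ?R ?C)" by simp
    have "measure_pmf.prob ?R ?A \<le> (\<Sum>a\<in>S. measure_pmf.prob ?R (bad_expo a \<delta> \<epsilon> N))"
      using S(1) by (rule measure_UNION_le) simp
    also have "\<dots> \<le> (\<Sum>a\<in>S. C / real n)"
    proof (rule sum_mono)
      fix a assume "a \<in> S"
      then have "0 < a" "a \<le> 1" using S(2) by auto
      then show "measure_pmf.prob ?R (bad_expo a \<delta> \<epsilon> N) \<le> C / real n"
        unfolding bad_expo_def C_def by (rule prob_expo_dev[OF \<delta> real_n(1) _ _ \<epsilon> N])
    qed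
    also have "(\<Sum>a\<in>S. C / real n) = real (card S) * C / real n" by simp
    also have "\<dots> \<le> \<xi> / 4" by (rule le[OF real_n(3)])
    finally have A: "measure_pmf.prob ?R ?A \<le> \<xi> / 4" .
    have "measure_pmf.prob ?R ?B \<le> (1 / real K + T / real n) / s"
      unfolding bad_mass_def by (rule prob_big_mass[OF K(1) s N])
    also have "\<dots> = 1 / real K / s + T / s / real n"
      by (simp add: add_divide_distrib mult.commute)
    finally have B: "measure_pmf.prob ?R ?B \<le> \<xi> / 4 + \<xi> / 4" using K(2) le[OF real_n(5)] by linarith
    have C: "measure_pmf.prob ?R ?C \<le> \<xi> / 4"
      unfolding bad_disc_def using prob_disc_dev[OF \<omega> N] le[OF real_n(4)] by (rule order_trans)
    show ?thesis using union A B C unfolding start_def by linarith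
  qed
  then show ?thesis by (intro exI allI impI)
qed

end

theorem theorem1p2:
  fixes p :: real
    and M :: "nat \<Rightarrow> 'a measure"
    and F :: "nat \<Rightarrow> nat \<Rightarrow> 'a \<Rightarrow> mgraph"
    and D :: "nat \<Rightarrow> nat \<Rightarrow> 'a \<Rightarrow> nat"
  assumes "0 < p" and "p \<le> 1"
    and "\<And>n. n \<ge> 2 \<Longrightarrow> frozen_process p n (M n) (F n) (D n)"
  shows "converges_ucp M
           (\<lambda>n t \<omega>. (real (num_frozen n (F n (nat \<lfloor>real n * t\<rfloor>) \<omega>)) / real n,
                      real (D n (nat \<lfloor>real n * t\<rfloor>) \<omega>) / real n))
           (\<lambda>t. (g_lim p t, d_lim p t))"
  unfolding converges_ucp_def
proof (intro allI impI)
  interpret limit_param p using assms by unfold_locales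
  fix I :: "real set" and \<epsilon> :: real
  assume "compact I \<and> I \<subseteq> {0..} \<and> \<epsilon> > 0"
  then have I: "compact I" "I \<subseteq> {0..}" and \<epsilon>: "0 < \<epsilon>" by auto
  let ?bad = "\<lambda>n. {\<omega> \<in> space (M n). \<exists>t\<in>I. dist (real (num_frozen n (F n (nat \<lfloor>real n * t\<rfloor>) \<omega>)) / real n,
                      real (D n (nat \<lfloor>real n * t\<rfloor>) \<omega>) / real n) (g_lim p t, d_lim p t) > \<epsilon>}"
  obtain b where b: "\<And>t. t \<in> I \<Longrightarrow> \<bar>t\<bar> \<le> b"
    using compact_imp_bounded[OF I(1)] unfolding bounded_iff real_norm_def by blast
  define T where "T = max 1 b"
  have T: "1 \<le> T" and IT: "\<And>t. t \<in> I \<Longrightarrow> 0 \<le> t \<and> t \<le> T"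
    using b I(2) by (force simp: T_def)+
  \<comment> \<open>Each coordinate gets \<epsilon> / 4 for the distance at the lattice time m / n
    and \<epsilon> / 4 for moving the limit from m / n to t; the two coordinates add up to
    \<epsilon>.\<close>
  define \<omega>0 where "\<omega>0 = \<epsilon> / (4 * (4 * T + 2))"
  have "c * (\<epsilon> / (4 * c)) = \<epsilon> / 4" if "0 < c" for c using that by simp
  from this[of "4 * T + 2"] have \<omega>0: "0 < \<omega>0" "(4 * T + 2) * \<omega>0 = \<epsilon> / 4"
    using \<epsilon> T by (simp_all add: \<omega>0_def)
  have "1 * \<omega>0 \<le> (4 * T + 2) * \<omega>0" using \<omega>0(1) T by (intro mult_right_mono) auto
  then have \<omega>1: "\<omega>0 \<le> \<epsilon> / 4" by (simp only: \<omega>0(2) mult_1)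
  have uc: "\<exists>r>0. \<forall>s\<in>{0..T}. \<forall>t\<in>{0..T}. dist s t < r \<longrightarrow> dist (f s) (f t) < \<epsilon> / 4"
    if "\<And>t. isCont f t" for f :: "real \<Rightarrow> real"
  proof -
    have "uniformly_continuous_on {0..T} f"
      using that by (intro compact_uniformly_continuous continuous_at_imp_continuous_on) auto
    moreover have "0 < \<epsilon> / 4" using \<epsilon> by simp
    ultimately show ?thesis unfolding uniformly_continuous_on_def by blast
  qed
  obtain r1 where r1: "0 < r1" "\<And>s t. s \<in> {0..T} \<Longrightarrow> t \<in> {0..T} \<Longrightarrow> dist s t < r1 \<Longrightarrow> dist (g_lim p s) (g_lim p t) < \<epsilon> / 4"
    using uc[of "g_lim p"] g_lim_isCont by metis
  obtain r2 where r2: "0 < r2" "\<And>s t. s \<in> {0..T} \<Longrightarrow> t \<in> {0..T} \<Longrightarrow> dist s t < r2 \<Longrightarrow> dist (d_lim p s) (d_lim p t) < \<epsilon> / 4"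
    using uc[of "d_lim p"] d_lim_cont by metis
  show "(\<lambda>n. measure (M n) (?bad n)) \<longlonglongrightarrow> 0"
  proof (rule LIMSEQ_I)
    fix \<xi> :: real assume \<xi>: "0 < \<xi>"
    then have "0 < \<xi> / 2" by simp
    then obtain n0 where n0: "\<And>n N. n0 \<le> n \<Longrightarrow> real N \<le> real n * T \<Longrightarrow>
        measure_pmf.prob (run_pmf (frozen_step p n) N [({#}, 0)]) (- close_runs T \<omega>0 n N) \<le> \<xi> / 2"
      using prob_close_runs[OF T \<omega>0(1), of "\<xi> / 2"] by blast
    define n1 where "n1 = n0 + 2 + nat \<lceil>1 / r1\<rceil> + nat \<lceil>1 / r2\<rceil>"
    show "\<exists>n1. \<forall>n\<ge>n1. norm (measure (M n) (?bad n) - 0) < \<xi>"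
    proof (intro exI allI impI)
      fix n assume n: "n1 \<le> n"
      have n2: "n0 \<le> n" "2 \<le> n" using n by (simp_all add: n1_def)
      have n_pos: "0 < real n" using n2 by simp
      have "1 / r1 < real n" "1 / r2 < real n" using n unfolding n1_def by linarith+
      then have rn: "1 / real n < r1" "1 / real n < r2" using r1(1) r2(1) n_pos by (simp_all add: field_simps)
      interpret frozen p n using assms n2 by unfold_locales auto
      have fp: "frozen_process p n (M n) (F n) (D n)" by (rule assms(3)[OF n2(2)])
      interpret prob_space "M n" using fp by (simp add: frozen_process_def)
      define N where "N = nat \<lfloor>real n * T\<rfloor>"
      have N: "real N \<le> real n * T" using n_pos T by (simp add: N_def)
      let ?X = "\<lambda>\<omega> i. (F n i \<omega>, D n i \<omega>)"
      \<comment> \<open>All lattice times belonging to t in I are at most N, so a single history up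
        to step N decides the event for the whole compact set.\<close>
      have sub: "?bad n \<subseteq> {\<omega> \<in> space (M n). hist (?X \<omega>) N \<in> - close_runs T \<omega>0 n N}"
      proof (intro subsetI)
        fix \<omega> assume "\<omega> \<in> ?bad n"
        then obtain t where \<omega>: "\<omega> \<in> space (M n)" and t: "t \<in> I"
          and far: "dist (real (num_frozen n (F n (nat \<lfloor>real n * t\<rfloor>) \<omega>)) / real n,
                      real (D n (nat \<lfloor>real n * t\<rfloor>) \<omega>) / real n) (g_lim p t, d_lim p t) > \<epsilon>" by blast
        define m where "m = nat \<lfloor>real n * t\<rfloor>"
        let ?G = "real (num_frozen n (F n m \<omega>)) / real n" and ?D = "real (D n m \<omega>) / real n"
        have t0: "0 \<le> t" "t \<le> T" using IT[OF t] by auto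
        have m: "real m \<le> real n * t" "real n * t < real m + 1" using t0 n_pos by (simp_all add: m_def)
        have "t \<le> (real m + 1) / real n" using m n_pos by (simp add: pos_le_divide_eq mult.commute)
        then have mt: "real m / real n \<le> t" "t - real m / real n \<le> 1 / real n"
          using m n_pos by (simp_all add: pos_divide_le_eq mult.commute add_divide_distrib)
        have mN: "m \<le> N" unfolding m_def N_def using t0 n_pos by (intro nat_mono floor_mono mult_left_mono) auto
        have mem: "real m / real n \<in> {0..T}" "t \<in> {0..T}" using mt t0 by auto
        have d: "dist (real m / real n) t \<le> 1 / real n" using mt by (simp add: dist_real_def)
        have "hist (?X \<omega>) N \<notin> close_runs T \<omega>0 n N"
        proof
          assume "hist (?X \<omega>) N \<in> close_runs T \<omega>0 n N"
          then have "\<bar>?G - g_lim p (real m / real n)\<bar> \<le> \<omega>0" "\<bar>?D - d_lim p (real m / real n)\<bar> \<le> (4 * T + 2) * \<omega>0"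
            using mN unfolding close_runs_def by force+
          moreover have "dist (g_lim p (real m / real n)) (g_lim p t) < \<epsilon> / 4" "dist (d_lim p (real m / real n)) (d_lim p t) < \<epsilon> / 4"
            using r1(2)[OF mem] r2(2)[OF mem] d rn by auto
          ultimately have "dist ?G (g_lim p t) \<le> \<epsilon> / 2" "dist ?D (d_lim p t) \<le> \<epsilon> / 2"
            using \<omega>0(2) \<omega>1 unfolding dist_real_def by linarith+
          moreover have "dist (?G, ?D) (g_lim p t, d_lim p t) \<le> dist ?G (g_lim p t) + dist ?D (d_lim p t)"
            unfolding dist_Pair_Pair by (rule sqrt_sum_squares_le_sum) auto
          ultimately show False using far by (simp add: m_def)
        qed
        then show "\<omega> \<in> {\<omega> \<in> space (M n). hist (?X \<omega>) N \<in> - close_runs T \<omega>0 n N}" using \<omega> by simp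
      qed
      have "measure (M n) (?bad n) \<le> measure_pmf.prob (run_pmf (frozen_step p n) N [({#}, 0)]) (- close_runs T \<omega>0 n N)"
        using frozen_process_prob_le[OF fp finite_step sub] .
      also have "\<dots> \<le> \<xi> / 2" by (rule n0[OF n2(1) N])
      finally show "norm (measure (M n) (?bad n) - 0) < \<xi>" using \<xi> by simp
    qed
  qed
qed

end
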